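(* Let $\mathbf{a}\in\mathfrak{A}_3$ be generic. Put $N_e=\mathcal{A}_{[\mathbf{a}]}\cdot M_e[(13)(23)]=\bigoplus_{g\neq e}M_e[g]\oplus\langle m_{\mathrm{top}}\rangle$. The nonzero submodules of the Verma module $M_e$ are $$\langle m_{\mathrm{top}}\rangle\subsetneq\mathcal{A}_{[\mathbf{a}]}\cdot v\subsetneq N_e\subsetneq M_e$$ for any $v\in M_e[(13)(23)]\setminus\{0\}$. The submodules $\mathcal{A}_{[\mathbf{a}]}\cdot v$ and $\mathcal{A}_{[\mathbf{a}]}\cdot u$ (with $u,v\in M_e[(13)(23)]\setminus\{0\}$) coincide if and only if $v\in\langle u\rangle$. The quotients $\mathcal{A}_{[\mathbf{a}]}\cdot v/\langle m_{\mathrm{top}}\rangle$ and $N_e/\mathcal{A}_{[\mathbf{a}]}\cdot v$ are isomorphic to $L$; and $M_e/N_e$ and $\langle m_{\mathrm{top}}\rangle$ are isomorphic to $\Bbbk_e$.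
   Context: $\Bbbk$ is an algebraically closed field of characteristic $0$; $\langle S\rangle$ denotes the linear span of $S$. $\mathcal{O}_2^3=\{(12),(13),(23)\}\subset\mathbb{S}_3$; $\Bbbk^{\mathbb{S}_3}$ is the algebra of functions on $\mathbb{S}_3$ with basis the characteristic functions $\delta_g$ of $\{g\}$, $g\in\mathbb{S}_3$. $\mathfrak{A}_3=\{\mathbf{a}=(a_{(12)},a_{(13)},a_{(23)})\in\Bbbk^3: a_{(12)}+a_{(13)}+a_{(23)}=0\}$. For $\mathbf{a}\in\mathfrak{A}_3$ and $(ij)\in\mathcal{O}_2^3$ put $f_{ij}=\sum_{g\in\mathbb{S}_3}(a_{(ij)}-a_{g^{-1}(ij)g})\delta_g\in\Bbbk^{\mathbb{S}_3}$. $\mathcal{A}_{[\mathbf{a}]}$ is the algebra generated by $\Bbbk^{\mathbb{S}_3}$ and $x_{(12)},x_{(13)},x_{(23)}$ with relations $\delta_h x_{(ij)}=x_{(ij)}\delta_{(ij)h}$ ($h\in\mathbb{S}_3$), $x_{(ij)}^2=f_{ij}$, $x_{(13)}x_{(23)}+x_{(23)}x_{(12)}+x_{(12)}x_{(13)}=0$ and $x_{(23)}x_{(13)}+x_{(13)}x_{(12)}+x_{(12)}x_{(23)}=0$. (It is known to have dimension $72$ and to contain $\Bbbk^{\mathbb{S}_3}$ as a subalgebra.) Modules are left modules. For an $\mathcal{A}_{[\mathbf{a}]}$-module $M$ and $g\in\mathbb{S}_3$, $M[g]=\delta_g\cdot M$. The Verma module is $M_g=\mathcal{A}_{[\mathbf{a}]}\otimes_{\Bbbk^{\mathbb{S}_3}}\Bbbk_g$,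 where $\Bbbk_g$ is the one-dimensional $\Bbbk^{\mathbb{S}_3}$-module with $f\cdot 1=f(g)1$. In $M_g$ write $m_{\mathrm{top}}=x_{(13)}x_{(12)}x_{(23)}x_{(12)}\otimes 1$. $\mathbf{a}$ is generic when $a_{(12)},a_{(13)},a_{(23)}$ are pairwise distinct. $\Bbbk_e$ also denotes the one-dimensional $\mathcal{A}_{[\mathbf{a}]}$-module on which every $x_{(ij)}$ acts by $0$ and $f\in\Bbbk^{\mathbb{S}_3}$ acts by $f(e)$. For $\mathbf{a}$ generic, $L$ is the $\mathcal{A}_{[\mathbf{a}]}$-module with basis $\{v_g: e\neq g\in\mathbb{S}_3\}$, $v_g\in L[g]$, and $x_{(ij)}\cdot v_g=v_{(ij)g}$ if $\operatorname{sgn} g=1$, $x_{(ij)}\cdot v_g=f_{ij}(g)v_{(ij)g}$ if $\operatorname{sgn} g=-1$ (read as $0$ when $g=(ij)$, since $f_{ij}((ij))=0$). *)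

theory Defs
  imports
    "HOL-Computational_Algebra.Polynomial"
    "HOL-Library.Poly_Mapping"
    "HOL-Library.Function_Algebras"
    "HOL-Library.Numeral_Type"
    "HOL-Combinatorics.Perm"
    "HOL-Combinatorics.Permutations"
    "HOL-Algebra.Module"
    "HOL-Algebra.QuotRing"
    "HOL-Algebra.Generated_Groups"
    "HOL-Algebra.Algebraic_Closure_Type"
begin

section \<open>Left modules over a not necessarily commutative ring\<close>

text \<open>
  The locale \<^locale>\<open>module\<close> requires a commutative ring of scalars.  We use the same
  record type (whose fields \<open>mult\<close> and \<open>one\<close> play no role for modules) and the same axioms
  over an arbitrary ring.  The locale \<^locale>\<open>submodule\<close> of the library does not need
  commutativity and is used as it is.
\<close>

locale left_module = R?: ring R + M?: abelian_group M
  for R :: "('a, 'r) ring_scheme" (structure) and M :: "('a, 'm, 'c) module_scheme" (structure) +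
  assumes smult_closed:
      "\<lbrakk>r \<in> carrier R; x \<in> carrier M\<rbrakk> \<Longrightarrow> r \<odot>\<^bsub>M\<^esub> x \<in> carrier M"
    and smult_l_distr:
      "\<lbrakk>r \<in> carrier R; s \<in> carrier R; x \<in> carrier M\<rbrakk> \<Longrightarrow>
        (r \<oplus>\<^bsub>R\<^esub> s) \<odot>\<^bsub>M\<^esub> x = r \<odot>\<^bsub>M\<^esub> x \<oplus>\<^bsub>M\<^esub> s \<odot>\<^bsub>M\<^esub> x"
    and smult_r_distr:
      "\<lbrakk>r \<in> carrier R; x \<in> carrier M; y \<in> carrier M\<rbrakk> \<Longrightarrow>
        r \<odot>\<^bsub>M\<^esub> (x \<oplus>\<^bsub>M\<^esub> y) = r \<odot>\<^bsub>M\<^esub> x \<oplus>\<^bsub>M\<^esub> r \<odot>\<^bsub>M\<^esub> y"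
    and smult_assoc:
      "\<lbrakk>r \<in> carrier R; s \<in> carrier R; x \<in> carrier M\<rbrakk> \<Longrightarrow>
        (r \<otimes>\<^bsub>R\<^esub> s) \<odot>\<^bsub>M\<^esub> x = r \<odot>\<^bsub>M\<^esub> (s \<odot>\<^bsub>M\<^esub> x)"
    and smult_one: "x \<in> carrier M \<Longrightarrow> \<one>\<^bsub>R\<^esub> \<odot>\<^bsub>M\<^esub> x = x"

definition module_isomorphic ::
    "('a, 'r) ring_scheme \<Rightarrow> ('a, 'm, 'c) module_scheme \<Rightarrow> ('a, 'n, 'd) module_scheme \<Rightarrow> bool"
  where "module_isomorphic R M N \<longleftrightarrow>
    left_module R M \<and> left_module R N \<and>
    (\<exists>\<phi>. bij_betw \<phi> (carrier M) (carrier N) \<and>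
      (\<forall>x \<in> carrier M. \<forall>y \<in> carrier M. \<phi> (x \<oplus>\<^bsub>M\<^esub> y) = \<phi> x \<oplus>\<^bsub>N\<^esub> \<phi> y) \<and>
      (\<forall>r \<in> carrier R. \<forall>x \<in> carrier M. \<phi> (r \<odot>\<^bsub>M\<^esub> x) = r \<odot>\<^bsub>N\<^esub> \<phi> x))"

definition quot_module :: "('a, 'm, 'c) module_scheme \<Rightarrow> 'm set \<Rightarrow> ('a, 'm set) module"
  where "quot_module M H =
    \<lparr>carrier = a_rcosets\<^bsub>M\<^esub> H, monoid.mult = undefined, one = undefined,
     ring.zero = H, add = set_add M,
     module.smult = (\<lambda>r C. \<Union>m\<in>C. H +>\<^bsub>M\<^esub> (r \<odot>\<^bsub>M\<^esub> m))\<rparr>"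

text \<open>
  The additive subgroup of finite sums of elements \<open>r s\<close>.  With \<open>R\<close> the whole ring and
  \<open>S = {v}\<close> it is the cyclic submodule generated by \<open>v\<close>; with \<open>R\<close> the scalars of the
  ground field it is the linear span of \<open>S\<close>.
\<close>

definition set_prod_span :: "('a, 'm, 'c) module_scheme \<Rightarrow> 'a set \<Rightarrow> 'm set \<Rightarrow> 'm set"
  where "set_prod_span M R S = generate (add_monoid M) {r \<odot>\<^bsub>M\<^esub> s | r s. r \<in> R \<and> s \<in> S}"

text \<open>Every element of \<open>N\<close> is uniquely a sum of elements of the subgroups \<open>W i\<close>, and conversely.\<close>

definition internal_direct_sum ::
    "('a, 'm, 'c) module_scheme \<Rightarrow> ('i \<Rightarrow> 'm set) \<Rightarrow> 'i set \<Rightarrow> 'm set \<Rightarrow> bool"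
  where "internal_direct_sum M W I N \<longleftrightarrow>
    finite I \<and> (\<forall>i \<in> I. subgroup (W i) (add_monoid M)) \<and>
    bij_betw (\<lambda>m. finsum M m I) (Pi\<^sub>E I W) N"

section \<open>Extension of scalars\<close>

text \<open>
  For a map of rings \<open>\<iota>\<close> from \<open>S\<close> to \<open>R\<close> and a left \<open>S\<close>-module \<open>N\<close>, the left \<open>R\<close>-module
  obtained by tensoring \<open>R\<close>, viewed as a right \<open>S\<close>-module through \<open>\<iota>\<close>, with \<open>N\<close> over \<open>S\<close>:
  the free abelian group on pairs modulo the subgroup generated by the biadditivity and
  balancing relations.
\<close>

definition free_pairs ::
    "('a, 'r) ring_scheme \<Rightarrow> ('s, 'n, 'c) module_scheme \<Rightarrow> ('a, ('a \<times> 'n) \<Rightarrow>\<^sub>0 int) module"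
  where "free_pairs R N =
    \<lparr>carrier = {c. Poly_Mapping.keys c \<subseteq> carrier R \<times> carrier N},
     monoid.mult = undefined, one = undefined, ring.zero = 0, add = (+),
     module.smult = (\<lambda>r. frag_extend (\<lambda>(t, n). frag_of (r \<otimes>\<^bsub>R\<^esub> t, n)))\<rparr>"

definition tensor_relations ::
    "('a, 'r) ring_scheme \<Rightarrow> ('s, 't) ring_scheme \<Rightarrow> ('s \<Rightarrow> 'a) \<Rightarrow> ('s, 'n, 'c) module_scheme \<Rightarrow>
      (('a \<times> 'n) \<Rightarrow>\<^sub>0 int) set"
  where "tensor_relations R S \<iota> N =
    {frag_of (r \<oplus>\<^bsub>R\<^esub> r', n) - frag_of (r, n) - frag_of (r', n) | r r' n.
      r \<in> carrier R \<and> r' \<in> carrier R \<and> n \<in> carrier N} \<union>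
    {frag_of (r, n \<oplus>\<^bsub>N\<^esub> n') - frag_of (r, n) - frag_of (r, n') | r n n'.
      r \<in> carrier R \<and> n \<in> carrier N \<and> n' \<in> carrier N} \<union>
    {frag_of (r \<otimes>\<^bsub>R\<^esub> \<iota> s, n) - frag_of (r, s \<odot>\<^bsub>N\<^esub> n) | r s n.
      r \<in> carrier R \<and> s \<in> carrier S \<and> n \<in> carrier N}"

definition tensor_kernel ::
    "('a, 'r) ring_scheme \<Rightarrow> ('s, 't) ring_scheme \<Rightarrow> ('s \<Rightarrow> 'a) \<Rightarrow> ('s, 'n, 'c) module_scheme \<Rightarrow>
      (('a \<times> 'n) \<Rightarrow>\<^sub>0 int) set"
  where "tensor_kernel R S \<iota> N =
    generate (add_monoid (free_pairs R N)) (tensor_relations R S \<iota> N)"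

definition extend_scalars ::
    "('a, 'r) ring_scheme \<Rightarrow> ('s, 't) ring_scheme \<Rightarrow> ('s \<Rightarrow> 'a) \<Rightarrow> ('s, 'n, 'c) module_scheme \<Rightarrow>
      ('a, (('a \<times> 'n) \<Rightarrow>\<^sub>0 int) set) module"
  where "extend_scalars R S \<iota> N = quot_module (free_pairs R N) (tensor_kernel R S \<iota> N)"

definition pure_tensor ::
    "('a, 'r) ring_scheme \<Rightarrow> ('s, 't) ring_scheme \<Rightarrow> ('s \<Rightarrow> 'a) \<Rightarrow> ('s, 'n, 'c) module_scheme \<Rightarrow>
      'a \<Rightarrow> 'n \<Rightarrow> (('a \<times> 'n) \<Rightarrow>\<^sub>0 int) set"
  where "pure_tensor R S \<iota> N r n = tensor_kernel R S \<iota> N +>\<^bsub>free_pairs R N\<^esub> frag_of (r, n)"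

section \<open>The symmetric group and its transpositions\<close>

text \<open>
  The type \<open>3\<close> has the elements \<open>1\<close>, \<open>2\<close> and \<open>3\<close> (where \<open>3 = 0\<close>), so \<open>3 perm\<close> is the
  symmetric group on three letters, with composition as product.
\<close>

type_synonym s3 = "3 perm"

typedef transp = "{Perm.swap 1 2, Perm.swap 1 3, Perm.swap 2 3 :: s3}"
  by blast

definition t12 :: transp where "t12 = Abs_transp (Perm.swap 1 2)"
definition t13 :: transp where "t13 = Abs_transp (Perm.swap 1 3)"
definition t23 :: transp where "t23 = Abs_transp (Perm.swap 2 3)"

definition conj_transp :: "s3 \<Rightarrow> transp \<Rightarrow> transp"
  where "conj_transp g t = Abs_transp (inverse g * Rep_transp t * g)"

text \<open>The representing permutation in \<^const>\<open>conj_transp\<close> is indeed a transposition.\<close>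

lemma conj_transp_mem:
  "inverse g * Rep_transp t * g \<in> {Perm.swap 1 2, Perm.swap 1 3, Perm.swap 2 3}"
proof -
  have three: "p = 1 \<or> p = 2 \<or> p = 3" for p :: 3
  proof (induct p)
    case (of_int z)
    then have "z = 0 \<or> z = 1 \<or> z = 2" by fastforce
    then show ?case by auto
  qed
  have "(1 :: 3) \<noteq> 2" "(1 :: 3) \<noteq> 3" "(2 :: 3) \<noteq> 3" by simp_all
  then obtain i j where ij: "i \<noteq> j" "Rep_transp t = Perm.swap i j"
    using Rep_transp[of t] by blast
  let ?h = "Perm.apply (inverse g)"
  have h: "Perm.apply g (?h b) = b" "?h (Perm.apply g b) = b" for b
    by (simp_all add: apply_sequence)
  have "Perm.apply (inverse g * Perm.swap i j * g) c = Perm.apply (Perm.swap (?h i) (?h j)) c" for c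
  proof -
    have "Perm.apply (inverse g * Perm.swap i j * g) c =
        ?h (Perm.apply (Perm.swap i j) (Perm.apply g c))"
      by (simp add: apply_times)
    also have "\<dots> = Perm.apply (Perm.swap (?h i) (?h j)) c"
      by (metis h apply_swap_simp apply_swap_same)
    finally show ?thesis .
  qed
  then have eq: "inverse g * Perm.swap i j * g = Perm.swap (?h i) (?h j)"
    by (rule perm_eqI)
  have ne: "?h i \<noteq> ?h j"
    using ij(1) by (simp add: apply_inj)
  have "Perm.swap p q \<in> {Perm.swap 1 2, Perm.swap 1 3, Perm.swap 2 3}" if "p \<noteq> q" for p q :: 3
    using that three[of p] three[of q] swap_sym[of p q] by auto
  with eq ne ij show ?thesis by metis
qed

text \<open>Sums over all of \<open>s3\<close> occur below.\<close>

lemma finite_s3: "finite (UNIV :: s3 set)"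
proof -
  have "range (Perm.apply :: s3 \<Rightarrow> 3 \<Rightarrow> 3) \<subseteq> UNIV" by simp
  then have "finite (range (Perm.apply :: s3 \<Rightarrow> 3 \<Rightarrow> 3))"
    by (rule finite_subset) simp
  then show ?thesis
    by (rule finite_imageD) (simp add: inj_def perm_eq_iff)
qed

definition parameters :: "(transp \<Rightarrow> 'k::field) set"
  where "parameters = {a. a t12 + a t13 + a t23 = 0}"

definition generic :: "(transp \<Rightarrow> 'k::field) \<Rightarrow> bool"
  where "generic a \<longleftrightarrow> a t12 \<noteq> a t13 \<and> a t12 \<noteq> a t23 \<and> a t13 \<noteq> a t23"

definition f_fun :: "(transp \<Rightarrow> 'k::field) \<Rightarrow> transp \<Rightarrow> s3 \<Rightarrow> 'k"
  where "f_fun a t = (\<lambda>g. a t - a (conj_transp g t))"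

section \<open>The algebra by generators and relations\<close>

text \<open>
  The free algebra on a set is the monoid algebra of the free monoid, that is, of lists
  under concatenation.
\<close>

instantiation list :: (type) monoid_add
begin
definition zero_list :: "'a list" where "zero_list = []"
definition plus_list :: "'a list \<Rightarrow> 'a list \<Rightarrow> 'a list" where "plus_list = (@)"
instance by standard (simp_all add: zero_list_def plus_list_def)
end

datatype gen = Delta s3 | Xvar transp

type_synonym 'k free_alg = "gen list \<Rightarrow>\<^sub>0 'k"

abbreviation free_ring :: "('k::field) free_alg ring"
  where "free_ring \<equiv> ring_of_type_algebra"

abbreviation dgen :: "s3 \<Rightarrow> ('k::field) free_alg"
  where "dgen g \<equiv> Poly_Mapping.single [Delta g] 1"

abbreviation xgen :: "transp \<Rightarrow> ('k::field) free_alg"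
  where "xgen t \<equiv> Poly_Mapping.single [Xvar t] 1"

definition fun_elt :: "(s3 \<Rightarrow> 'k::field) \<Rightarrow> 'k free_alg"
  where "fun_elt f = (\<Sum>g \<in> UNIV. Poly_Mapping.single [Delta g] (f g))"

text \<open>
  The first two sets of relations present the algebra of functions on the group in terms
  of its basis of characteristic functions.
\<close>

definition relations :: "(transp \<Rightarrow> 'k::field) \<Rightarrow> 'k free_alg set"
  where "relations a =
    {dgen g * dgen h - (if g = h then dgen g else 0) | g h. True} \<union>
    {(\<Sum>g \<in> UNIV. dgen g) - 1} \<union>
    {dgen h * xgen t - xgen t * dgen (Rep_transp t * h) | h t. True} \<union>
    {xgen t * xgen t - fun_elt (f_fun a t) | t. True} \<union>
    {xgen t13 * xgen t23 + xgen t23 * xgen t12 + xgen t12 * xgen t13,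
     xgen t23 * xgen t13 + xgen t13 * xgen t12 + xgen t12 * xgen t23}"

definition rel_ideal :: "(transp \<Rightarrow> 'k::field) \<Rightarrow> 'k free_alg set"
  where "rel_ideal a = genideal free_ring (relations a)"

definition alg :: "(transp \<Rightarrow> 'k::field) \<Rightarrow> 'k free_alg set ring"
  where "alg a = free_ring Quot rel_ideal a"

lemma ring_alg: "ring (alg a)"
proof -
  have "\<exists>q. p + q = 0" for p :: "'a free_alg"
    using add.right_inverse by blast
  then interpret ring "free_ring :: 'a free_alg ring"
    unfolding ring_of_type_algebra_def
    by unfold_locales (auto simp: algebra_simps Units_def)
  have "ideal (rel_ideal a) free_ring"
    unfolding rel_ideal_def by (rule genideal_ideal) (simp add: ring_of_type_algebra_def)
  then show ?thesis
    unfolding alg_def by (rule ideal.quotient_is_ring)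
qed

definition cls :: "(transp \<Rightarrow> 'k::field) \<Rightarrow> 'k free_alg \<Rightarrow> 'k free_alg set"
  where "cls a p = rel_ideal a +>\<^bsub>free_ring\<^esub> p"

definition scalars :: "(transp \<Rightarrow> 'k::field) \<Rightarrow> 'k free_alg set set"
  where "scalars a = {cls a (Poly_Mapping.single [] c) | c. True}"

definition lin_span :: "(transp \<Rightarrow> 'k::field) \<Rightarrow>
    ('k free_alg set, 'm, 'c) module_scheme \<Rightarrow> 'm set \<Rightarrow> 'm set"
  where "lin_span a M S = set_prod_span M (scalars a) S"

definition alg_span :: "(transp \<Rightarrow> 'k::field) \<Rightarrow>
    ('k free_alg set, 'm, 'c) module_scheme \<Rightarrow> 'm set \<Rightarrow> 'm set"
  where "alg_span a M S = set_prod_span M (carrier (alg a)) S"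

definition weight_space :: "(transp \<Rightarrow> 'k::field) \<Rightarrow>
    ('k free_alg set, 'm, 'c) module_scheme \<Rightarrow> s3 \<Rightarrow> 'm set"
  where "weight_space a M g = {cls a (dgen g) \<odot>\<^bsub>M\<^esub> m | m. m \<in> carrier M}"

section \<open>Verma modules\<close>

abbreviation fun_ring :: "(s3 \<Rightarrow> 'k::field) ring"
  where "fun_ring \<equiv> ring_of_type_algebra"

definition fun_incl :: "(transp \<Rightarrow> 'k::field) \<Rightarrow> (s3 \<Rightarrow> 'k) \<Rightarrow> 'k free_alg set"
  where "fun_incl a f = cls a (fun_elt f)"

definition point_module :: "s3 \<Rightarrow> (s3 \<Rightarrow> 'k::field, 'k) module"
  where "point_module g =
    \<lparr>carrier = UNIV, monoid.mult = undefined, one = undefined, ring.zero = 0, add = (+),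
     module.smult = (\<lambda>f c. f g * c)\<rparr>"

type_synonym 'k verma_elt = "(('k free_alg set \<times> 'k) \<Rightarrow>\<^sub>0 int) set"

definition verma :: "(transp \<Rightarrow> 'k::field) \<Rightarrow> s3 \<Rightarrow> ('k free_alg set, 'k verma_elt) module"
  where "verma a g = extend_scalars (alg a) fun_ring (fun_incl a) (point_module g)"

definition m_top :: "(transp \<Rightarrow> 'k::field) \<Rightarrow> s3 \<Rightarrow> 'k verma_elt"
  where "m_top a g = pure_tensor (alg a) fun_ring (fun_incl a) (point_module g)
    (cls a (xgen t13) \<otimes>\<^bsub>alg a\<^esub> cls a (xgen t12) \<otimes>\<^bsub>alg a\<^esub> cls a (xgen t23) \<otimes>\<^bsub>alg a\<^esub> cls a (xgen t12)) 1"

definition W_e :: "(transp \<Rightarrow> 'k::field) \<Rightarrow> 'k verma_elt set"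
  where "W_e a = weight_space a (verma a 1) (Rep_transp t13 * Rep_transp t23)"

definition N_e :: "(transp \<Rightarrow> 'k::field) \<Rightarrow> 'k verma_elt set"
  where "N_e a = alg_span a (verma a 1) (W_e a)"

section \<open>Modules given by the action of the generators\<close>

text \<open>
  An assignment \<open>\<rho>\<close> of linear operators to the generators extends to the free algebra; words
  act by composition, the last letter first.  An element of the quotient algebra, which is
  a coset, acts by the common value of its representatives; this is meaningful when the
  relations act by zero on the carrier, and then yields a left module.
\<close>

definition word_act :: "('k::field \<Rightarrow> 'v \<Rightarrow> 'v) \<Rightarrow> (gen \<Rightarrow> 'v \<Rightarrow> 'v) \<Rightarrow> 'k free_alg \<Rightarrow> 'v \<Rightarrow> 'v::ab_group_add"
  where "word_act sc \<rho> p v =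
    (\<Sum>w \<in> Poly_Mapping.keys p. sc (Poly_Mapping.lookup p w) (foldr \<rho> w v))"

definition rep_module :: "('k::field \<Rightarrow> 'v \<Rightarrow> 'v) \<Rightarrow> (gen \<Rightarrow> 'v \<Rightarrow> 'v) \<Rightarrow> 'v::ab_group_add set \<Rightarrow>
    ('k free_alg set, 'v) module"
  where "rep_module sc \<rho> V =
    \<lparr>carrier = V, monoid.mult = undefined, one = undefined, ring.zero = 0, add = (+),
     module.smult = (\<lambda>r v. the_elem ((\<lambda>p. word_act sc \<rho> p v) ` r))\<rparr>"

fun k_e_act :: "gen \<Rightarrow> 'k::field \<Rightarrow> 'k"
  where
    "k_e_act (Delta h) c = (if h = 1 then c else 0)"
  | "k_e_act (Xvar t) c = 0"

definition k_e :: "('k::field free_alg set, 'k) module"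
  where "k_e = rep_module (*) k_e_act UNIV"

definition basis_vec :: "s3 \<Rightarrow> s3 \<Rightarrow> 'k::field"
  where "basis_vec g = (\<lambda>h. if h = g then 1 else 0)"

text \<open>
  The vector \<open>c\<close> below stands for the combination of the basis vectors \<open>v\<^sub>g\<close>, \<open>g \<noteq> 1\<close>, with
  coefficients \<open>c g\<close>.  For \<open>g\<close> equal to the transposition \<open>t\<close> the coefficient
  \<^term>\<open>f_fun a t g\<close> vanishes, so that the function \<^term>\<open>basis_vec 1\<close>, which is not in the
  carrier, does not contribute.
\<close>

fun L_act :: "(transp \<Rightarrow> 'k::field) \<Rightarrow> gen \<Rightarrow> (s3 \<Rightarrow> 'k) \<Rightarrow> (s3 \<Rightarrow> 'k)"
  where
    "L_act a (Delta h) c = (\<lambda>g. if g = h then c g else 0)"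
  | "L_act a (Xvar t) c =
      (\<Sum>g \<in> UNIV - {1}. (\<lambda>h. c g * (if sign (Perm.apply g) = 1 then 1 else f_fun a t g) *
        basis_vec (Rep_transp t * g) h))"

definition L_mod :: "(transp \<Rightarrow> 'k::field) \<Rightarrow> ('k free_alg set, s3 \<Rightarrow> 'k) module"
  where "L_mod a = rep_module (\<lambda>b c g. b * c g) (L_act a) {c. c 1 = 0}"

end

theory Submission
  imports Defs
begin

text \<open>
  In weights other than \<open>e\<close> the Verma module \<open>M\<^sub>e\<close> is two copies of \<open>L\<close>, so it has the form
  \<open>\<langle>1\<rangle> \<oplus> (L \<otimes> k\<^sup>2) \<oplus> \<langle>m\<^sub>t\<^sub>o\<^sub>p\<rangle>\<close>, where \<open>x\<^sub>t\<close> sends \<open>1\<close> to \<open>v\<^sub>t \<otimes> u\<^sub>t\<close> and \<open>v\<^sub>t \<otimes> w\<close> to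
  \<open>\<lambda>\<^sub>t(w) m\<^sub>t\<^sub>o\<^sub>p\<close>, for three pairwise independent vectors \<open>u\<^sub>t\<close> and functionals \<open>\<lambda>\<^sub>t\<close> that vanish on
  them.  That this twelve-dimensional model is the Verma module is seen in two steps: the model satisfies
  the relations, so \<open>M\<^sub>e\<close> maps onto it, and conversely the relations make any vector of weight \<open>e\<close>
  in a representation the image of \<open>1\<close> under a homomorphism from the model.  As all weights
  \<open>g \<noteq> e\<close> are linked by invertible actions of the \<open>x\<^sub>t\<close>, a submodule of the model that
  does not contain a vector with nonzero component along \<open>1\<close> is determined by a subspace of
  \<open>k\<^sup>2\<close>, up to \<open>m\<^sub>t\<^sub>o\<^sub>p\<close>, which belongs to it as soon as that subspace is nonzero.
\<close>

text \<open>The obstacle is that \<open>verma a 1\<close> consists of cosets in a free abelian group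
  on pairs whose first entries are again cosets. Nothing is computed there: one isomorphism onto the
  model is constructed, and submodules, spans and weight spaces are then read off as subsets of a
  function type. The bound from above becomes: if \<open>p\<close> in the free algebra kills the
  vector \<open>1\<close> of the model, then \<open>p \<otimes> 1 = 0\<close>. The \<open>p\<close>
  with \<open>p \<otimes> 1 = 0\<close> form a left ideal, and projecting along it yields operators
  on the free algebra itself, a type with a group structure, where words of length up to five can be
  evaluated.

  Genericity enters twice: the vectors \<open>u_t\<close> arise by dividing by the differences
  \<open>spar a t\<close>, and on the weight of a transposition \<open>s\<close> every
  \<open>x_t\<close> with \<open>t \<noteq> s\<close> has a nonzero coefficient. Any two of the
  \<open>u_t\<close> form a basis of \<open>k\<^sup>2\<close>, so a vector with a component along
  \<open>1\<close> generates everything; dually, no nonzero vector of \<open>k\<^sup>2\<close> is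
  killed by two of the \<open>\<lambda>_t\<close>, which is why the top vector lies in every
  submodule with a component outside weight \<open>e\<close>. The lines of \<open>k\<^sup>2\<close>
  give the submodules generated by a single \<open>v\<close>.\<close>

section \<open>Products, conjugation and signs in the symmetric group on three letters\<close>

abbreviation s12 :: s3 where "s12 \<equiv> Perm.swap 1 2"
abbreviation s13 :: s3 where "s13 \<equiv> Perm.swap 1 3"
abbreviation s23 :: s3 where "s23 \<equiv> Perm.swap 2 3"
text \<open>The two three-cycles. All three products of transpositions in the first quadratic
  relation equal \<open>c3\<close>, and all three in the second equal \<open>d3\<close>, so each
  relation shifts weights by one of them. The generators \<open>v\<close> of the theorem have weight
  \<open>c3\<close>.\<close>

definition c3 :: s3 where "c3 = s13 * s23"
definition d3 :: s3 where "d3 = s23 * s13"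

lemma three_cases: "p = 1 \<or> p = 2 \<or> p = 3" for p :: 3
proof (induct p)
  case (of_int z)
  then have "z = 0 \<or> z = 1 \<or> z = 2" by fastforce
  then show ?case by auto
qed

lemma s3_eqI:
  fixes p q :: s3
  assumes "Perm.apply p 1 = Perm.apply q 1" "Perm.apply p 2 = Perm.apply q 2"
    "Perm.apply p 3 = Perm.apply q 3"
  shows "p = q"
  using assms three_cases by (intro perm_eqI) metis

lemma apply_swap_if: "Perm.apply (Perm.swap x y) z = (if z = x then y else if z = y then x else z)"
  by (metis apply_swap_simp apply_swap_same)

lemma s3_neqI:
  fixes p q :: s3
  assumes "(Perm.apply p 1, Perm.apply p 2) \<noteq> (Perm.apply q 1, Perm.apply q 2)"
  shows "p \<noteq> q"
  using assms by auto

lemma s3_distinct [simp]: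
  "s12 \<noteq> 1" "s13 \<noteq> 1" "s23 \<noteq> 1" "c3 \<noteq> 1" "d3 \<noteq> 1"
  "s12 \<noteq> s13" "s12 \<noteq> s23" "s12 \<noteq> c3" "s12 \<noteq> d3"
  "s13 \<noteq> s23" "s13 \<noteq> c3" "s13 \<noteq> d3" "s23 \<noteq> c3" "s23 \<noteq> d3" "c3 \<noteq> d3"
  by (rule s3_neqI, simp add: apply_swap_if apply_times c3_def d3_def)+

lemmas s3_distinct' [simp] = s3_distinct[symmetric]

text \<open>Together with \<open>s3_distinct\<close> this lets the simplifier decide equality of
  products, with \<open>1\<close>, \<open>s12\<close>, \<open>s13\<close>, \<open>s23\<close>,
  \<open>c3\<close>, \<open>d3\<close> as normal forms.\<close>

lemma s3_mult [simp]:
  "s12 * s12 = 1" "s12 * s13 = c3" "s12 * s23 = d3" "s12 * c3 = s13" "s12 * d3 = s23"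
  "s13 * s12 = d3" "s13 * s13 = 1" "s13 * s23 = c3" "s13 * c3 = s23" "s13 * d3 = s12"
  "s23 * s12 = c3" "s23 * s13 = d3" "s23 * s23 = 1" "s23 * c3 = s12" "s23 * d3 = s13"
  "c3 * s12 = s23" "c3 * s13 = s12" "c3 * s23 = s13" "c3 * c3 = d3" "c3 * d3 = 1"
  "d3 * s12 = s13" "d3 * s13 = s23" "d3 * s23 = s12" "d3 * c3 = 1" "d3 * d3 = c3"
  by (rule s3_eqI; simp add: apply_swap_if apply_times c3_def d3_def)+

lemma inverse_c3 [simp]: "inverse c3 = d3" and inverse_d3 [simp]: "inverse d3 = c3"
  by (rule perm.inverse_unique, simp)+

lemma Rep_transp_simps [simp]:
  "Rep_transp t12 = s12" "Rep_transp t13 = s13" "Rep_transp t23 = s23"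
  by (simp_all add: t12_def t13_def t23_def Abs_transp_inverse)

lemma transp_cases: "t = t12 \<or> t = t13 \<or> t = t23"
  using Rep_transp[of t] by (simp add: t12_def t13_def t23_def) (metis Rep_transp_inverse)

lemma transp_distinct [simp]: "t12 \<noteq> t13" "t12 \<noteq> t23" "t13 \<noteq> t23" "t13 \<noteq> t12" "t23 \<noteq> t12" "t23 \<noteq> t13"
  by (metis Rep_transp_simps s3_distinct)+

lemma apply_s3 [simp]:
  "Perm.apply c3 1 = 3" "Perm.apply c3 2 = 1" "Perm.apply c3 3 = 2"
  "Perm.apply d3 1 = 2" "Perm.apply d3 2 = 3" "Perm.apply d3 3 = 1"
  by (simp_all only: c3_def d3_def apply_times o_apply) (simp_all add: apply_swap_if)

lemma s3_cases: "g = 1 \<or> g = s12 \<or> g = s13 \<or> g = s23 \<or> g = c3 \<or> g = d3" for g :: s3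
proof -
  have inj: "Perm.apply g x \<noteq> Perm.apply g y" if "x \<noteq> y" for x y
    using that by (simp add: apply_inj)
  have "Perm.apply g 1 \<noteq> Perm.apply g 2" "Perm.apply g 1 \<noteq> Perm.apply g 3"
    "Perm.apply g 2 \<noteq> Perm.apply g 3"
    by (rule inj; simp)+
  with three_cases[of "Perm.apply g 1"] three_cases[of "Perm.apply g 2"]
    three_cases[of "Perm.apply g 3"]
  consider
      "Perm.apply g 1 = 1" "Perm.apply g 2 = 2" "Perm.apply g 3 = 3"
    | "Perm.apply g 1 = 1" "Perm.apply g 2 = 3" "Perm.apply g 3 = 2"
    | "Perm.apply g 1 = 2" "Perm.apply g 2 = 1" "Perm.apply g 3 = 3"
    | "Perm.apply g 1 = 2" "Perm.apply g 2 = 3" "Perm.apply g 3 = 1"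
    | "Perm.apply g 1 = 3" "Perm.apply g 2 = 1" "Perm.apply g 3 = 2"
    | "Perm.apply g 1 = 3" "Perm.apply g 2 = 2" "Perm.apply g 3 = 1"
    by metis
  then show ?thesis
  proof cases
    case 1
    then have "g = 1" by (intro s3_eqI) simp_all
    then show ?thesis by simp
  next
    case 2
    then have "g = s23" by (intro s3_eqI) (simp_all add: apply_swap_if)
    then show ?thesis by simp
  next
    case 3
    then have "g = s12" by (intro s3_eqI) (simp_all add: apply_swap_if)
    then show ?thesis by simp
  next
    case 4
    then have "g = d3" by (intro s3_eqI) simp_all
    then show ?thesis by simp
  next
    case 5
    then have "g = c3" by (intro s3_eqI) simp_all
    then show ?thesis by simp
  next
    case 6
    then have "g = s13" by (intro s3_eqI) (simp_all add: apply_swap_if)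
    then show ?thesis by simp
  qed
qed

lemma conj_transp_eqI: "inverse g * Rep_transp t * g = Rep_transp u \<Longrightarrow> conj_transp g t = u"
  by (simp add: conj_transp_def Rep_transp_inverse)

lemma conj_transp_simps [simp]:
  "conj_transp 1 t = t"
  "conj_transp s12 t12 = t12" "conj_transp s12 t13 = t23" "conj_transp s12 t23 = t13"
  "conj_transp s13 t12 = t23" "conj_transp s13 t13 = t13" "conj_transp s13 t23 = t12"
  "conj_transp s23 t12 = t13" "conj_transp s23 t13 = t12" "conj_transp s23 t23 = t23"
  "conj_transp c3 t12 = t23" "conj_transp c3 t13 = t12" "conj_transp c3 t23 = t13"
  "conj_transp d3 t12 = t13" "conj_transp d3 t13 = t23" "conj_transp d3 t23 = t12"
  by (rule conj_transp_eqI, simp)+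

lemma sign_s3 [simp]:
  "sign (Perm.apply s12) = -1" "sign (Perm.apply s13) = -1" "sign (Perm.apply s23) = -1"
  "sign (Perm.apply c3) = 1" "sign (Perm.apply d3) = 1" "sign (Perm.apply (1 :: s3)) = 1"
proof -
  have sw: "sign (Perm.apply (Perm.swap x y)) = (if x = y then 1 else -1)" for x y :: 3
    by (simp add: swap.rep_eq sign_swap_id)
  have perm: "permutation (Perm.apply p)" for p :: s3
    by (simp add: permutation bij_apply finite_subset[OF subset_UNIV])
  show "sign (Perm.apply s12) = -1" "sign (Perm.apply s13) = -1" "sign (Perm.apply s23) = -1"
    by (simp_all add: sw)
  show "sign (Perm.apply c3) = 1" "sign (Perm.apply d3) = 1"
    by (simp_all only: c3_def d3_def apply_times sign_compose[OF perm perm] sw) simp_all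
  show "sign (Perm.apply (1 :: s3)) = 1" by (simp add: one_perm.rep_eq sign_id)
qed

section \<open>The algebra\<close>

lemma free_ring_simps [simp]:
  "carrier free_ring = UNIV" "p \<oplus>\<^bsub>free_ring\<^esub> q = p + q" "p \<otimes>\<^bsub>free_ring\<^esub> q = p * q"
  "\<zero>\<^bsub>free_ring\<^esub> = 0" "\<one>\<^bsub>free_ring\<^esub> = 1"
  by (simp_all add: ring_of_type_algebra_def)

lemma ring_free_ring: "ring (free_ring :: ('k::field) free_alg ring)"
proof -
  have "\<exists>q. p + q = 0" for p :: "'k free_alg"
    using add.right_inverse by blast
  then show ?thesis
    unfolding ring_of_type_algebra_def
    by unfold_locales (auto simp: algebra_simps Units_def)
qed

lemma ideal_rel_ideal: "ideal (rel_ideal a) free_ring"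
  unfolding rel_ideal_def by (rule ring.genideal_ideal[OF ring_free_ring]) simp

lemma a_inv_free_ring [simp]: "\<ominus>\<^bsub>free_ring\<^esub> p = - p"
proof -
  interpret ring "free_ring :: 'a free_alg ring" by (rule ring_free_ring)
  show ?thesis by (rule minus_equality) auto
qed

lemma rel_ideal_closed:
  shows rel_ideal_zero: "0 \<in> rel_ideal a"
    and rel_ideal_add: "p \<in> rel_ideal a \<Longrightarrow> q \<in> rel_ideal a \<Longrightarrow> p + q \<in> rel_ideal a"
    and rel_ideal_minus: "p \<in> rel_ideal a \<Longrightarrow> - p \<in> rel_ideal a"
    and rel_ideal_mult_right: "p \<in> rel_ideal a \<Longrightarrow> p * r \<in> rel_ideal a"
proof -
  interpret ideal "rel_ideal a" free_ring by (rule ideal_rel_ideal)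
  show "0 \<in> rel_ideal a" using additive_subgroup.zero_closed[OF additive_subgroup_axioms] by simp
  show "p \<in> rel_ideal a \<Longrightarrow> q \<in> rel_ideal a \<Longrightarrow> p + q \<in> rel_ideal a" using additive_subgroup.a_closed[OF additive_subgroup_axioms, of p q] by simp
  show "p \<in> rel_ideal a \<Longrightarrow> - p \<in> rel_ideal a" using additive_subgroup.a_inv_closed[OF additive_subgroup_axioms, of p] by simp
  show "p \<in> rel_ideal a \<Longrightarrow> p * r \<in> rel_ideal a" using I_r_closed[of p r] by simp
qed

lemma relations_rel_ideal: "r \<in> relations a \<Longrightarrow> r \<in> rel_ideal a"
  unfolding rel_ideal_def using ring.genideal_self[OF ring_free_ring, of "relations a"] by auto

lemma mem_cls: "q \<in> cls a p \<longleftrightarrow> q - p \<in> rel_ideal a"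
  unfolding cls_def a_r_coset_def' by (auto simp: algebra_simps) (metis add.commute diff_add_cancel)

lemma cls_self: "p \<in> cls a p"
  by (simp add: mem_cls rel_ideal_zero)

lemma cls_eq_iff: "cls a p = cls a q \<longleftrightarrow> p - q \<in> rel_ideal a"
proof
  assume "cls a p = cls a q"
  then show "p - q \<in> rel_ideal a" using cls_self[of p a] by (simp add: mem_cls)
next
  assume pq: "p - q \<in> rel_ideal a"
  have "r - p \<in> rel_ideal a \<longleftrightarrow> r - q \<in> rel_ideal a" for r
    using rel_ideal_add[OF pq, of "r - p"] rel_ideal_add[OF rel_ideal_minus[OF pq], of "r - q"]
    by (auto simp: algebra_simps)
  then show "cls a p = cls a q" by (auto simp: mem_cls)
qed

lemma alg_simps [simp]:
  "carrier (alg a) = range (cls a)"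
  "cls a p \<oplus>\<^bsub>alg a\<^esub> cls a q = cls a (p + q)"
  "cls a p \<otimes>\<^bsub>alg a\<^esub> cls a q = cls a (p * q)"
  "\<zero>\<^bsub>alg a\<^esub> = cls a 0" "\<one>\<^bsub>alg a\<^esub> = cls a 1"
proof -
  interpret ideal "rel_ideal a" free_ring by (rule ideal_rel_ideal)
  show "carrier (alg a) = range (cls a)"
    by (auto simp: alg_def FactRing_def A_RCOSETS_def' cls_def)
  show "cls a p \<oplus>\<^bsub>alg a\<^esub> cls a q = cls a (p + q)"
    unfolding alg_def cls_def by (simp add: FactRing_def a_rcos_sum)
  show "cls a p \<otimes>\<^bsub>alg a\<^esub> cls a q = cls a (p * q)"
    unfolding alg_def cls_def by (simp add: FactRing_def rcoset_mult_add)
  show "\<zero>\<^bsub>alg a\<^esub> = cls a 0"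
    by (auto simp: alg_def FactRing_def set_eq_iff mem_cls)
  show "\<one>\<^bsub>alg a\<^esub> = cls a 1"
    by (simp add: alg_def FactRing_def cls_def)
qed

lemma free_alg_induct [case_names single add]:
  fixes p :: "('k::field) free_alg"
  assumes single: "\<And>w c. P (Poly_Mapping.single w c)" and add: "\<And>p q. P p \<Longrightarrow> P q \<Longrightarrow> P (p + q)"
  shows "P p"
proof (induct p rule: update_induct)
  case const
  show ?case using single[of _ 0] by simp
next
  case (update f w c)
  have "Poly_Mapping.update w c f = f + Poly_Mapping.single w c"
    using update(1) by (intro poly_mapping_eqI)
      (auto simp: lookup_update lookup_add lookup_single when_def in_keys_iff)
  then show ?case using add[OF update(3) single] by simp
qed

section \<open>Representations\<close>

locale free_rep = vector_space sc for sc :: "'k::field \<Rightarrow> 'v::ab_group_add \<Rightarrow> 'v" +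
  fixes \<rho> :: "gen \<Rightarrow> 'v \<Rightarrow> 'v"
  assumes rho_add: "\<rho> x (v + w) = \<rho> x v + \<rho> x w"
    and rho_scale: "\<rho> x (sc c v) = sc c (\<rho> x v)"
begin

abbreviation "act \<equiv> word_act sc \<rho>"

lemma foldr_add: "foldr \<rho> w (u + v) = foldr \<rho> w u + foldr \<rho> w v"
  by (induct w) (simp_all add: rho_add)

lemma foldr_scale: "foldr \<rho> w (sc c v) = sc c (foldr \<rho> w v)"
  by (induct w) (simp_all add: rho_scale)

lemma act_superset:
  assumes "finite S" "Poly_Mapping.keys p \<subseteq> S"
  shows "act p v = (\<Sum>w \<in> S. sc (Poly_Mapping.lookup p w) (foldr \<rho> w v))"
  unfolding word_act_def using assms by (intro sum.mono_neutral_left) (auto simp: in_keys_iff)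

lemma act_single [simp]: "act (Poly_Mapping.single w c) v = sc c (foldr \<rho> w v)"
  by (subst act_superset[of "{w}"]) (auto simp: lookup_single)

lemma act_add: "act (p + q) v = act p v + act q v"
  using keys_add[of p q]
  by (simp add: act_superset[of "Poly_Mapping.keys p \<union> Poly_Mapping.keys q"] lookup_add
      scale_left_distrib sum.distrib)

lemma act_zero [simp]: "act 0 v = 0"
  by (simp add: word_act_def)

lemma act_diff: "act (p - q) v = act p v - act q v"
  using act_add[of "p - q" q v] by simp

lemma act_minus: "act (- p) v = - act p v"
  using act_diff[of 0 p v] by simp

lemma act_sum: "act (\<Sum>i\<in>I. p i) v = (\<Sum>i\<in>I. act (p i) v)"
  by (induct I rule: infinite_finite_induct) (simp_all add: act_add)

lemma act_one [simp]: "act 1 v = v"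
  by (simp flip: single_one add: zero_list_def)

lemma act_add_right: "act p (u + v) = act p u + act p v"
  by (simp add: word_act_def foldr_add scale_right_distrib sum.distrib)

lemma act_scale: "act p (sc c v) = sc c (act p v)"
  by (simp add: word_act_def foldr_scale scale_sum_right mult.commute)

lemma act_zero_right [simp]: "act p 0 = 0"
  using act_scale[of p 0 0] by simp

lemma act_minus_right: "act p (- v) = - act p v"
  using act_scale[of p "-1" v] by simp

lemma act_mult: "act (p * q) v = act p (act q v)"
proof (induct p rule: free_alg_induct)
  case (single w c)
  show ?case
    by (induct q rule: free_alg_induct)
      (simp_all add: mult_single plus_list_def foldr_scale distrib_left act_add foldr_add
        scale_right_distrib)
qed (simp add: distrib_right act_add)

definition stable :: "'v set \<Rightarrow> bool" where "stable V \<longleftrightarrow> 0 \<in> V \<and> (\<forall>u\<in>V. \<forall>v\<in>V. u + v \<in> V) \<and> (\<forall>c. \<forall>v\<in>V. sc c v \<in> V) \<and>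
  (\<forall>x. \<forall>v\<in>V. \<rho> x v \<in> V)"

lemma stable_act:
  assumes "stable V" "v \<in> V"
  shows "act p v \<in> V"
proof (induct p rule: free_alg_induct)
  case (single w c)
  have "foldr \<rho> w v \<in> V" using assms by (induct w) (auto simp: stable_def)
  then show ?case using assms by (simp add: stable_def)
next
  case (add p q)
  then show ?case using assms by (simp add: stable_def act_add)
qed

lemma stable_add: "stable V \<Longrightarrow> u \<in> V \<Longrightarrow> v \<in> V \<Longrightarrow> u + v \<in> V"
  by (simp add: stable_def)

lemma stable_minus: "stable V \<Longrightarrow> v \<in> V \<Longrightarrow> - v \<in> V"
  using stable_act[of V v "- 1"] by (simp add: act_minus)

lemma stable_UNIV: "stable UNIV"
  by (simp add: stable_def)

end

text \<open>Words act by composition, so linearity and the generators suffice. All conditions are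
  restricted to a stable \<open>V\<close> because the maps used later intertwine only there, for
  instance \<open>pairing l\<close> on \<open>midset\<close>.\<close>

lemma act_intertwine:
  assumes "free_rep sc \<rho>" "free_rep sc' \<rho>'" "free_rep.stable sc \<rho> V"
    and add: "\<And>u v. u \<in> V \<Longrightarrow> v \<in> V \<Longrightarrow> \<phi> (u + v) = \<phi> u + \<phi> v"
    and scale: "\<And>c v. v \<in> V \<Longrightarrow> \<phi> (sc c v) = sc' c (\<phi> v)"
    and gen: "\<And>x v. v \<in> V \<Longrightarrow> \<phi> (\<rho> x v) = \<rho>' x (\<phi> v)"
    and v: "v \<in> V"
  shows "\<phi> (word_act sc \<rho> p v) = word_act sc' \<rho>' p (\<phi> v)"
proof -
  interpret R: free_rep sc \<rho> by fact
  interpret R': free_rep sc' \<rho>' by fact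
  have st: "foldr \<rho> w v \<in> V" for w
    using R.stable_act[OF assms(3) v, of "Poly_Mapping.single w 1"] by simp
  show ?thesis
  proof (induct p rule: free_alg_induct)
    case (single w c)
    have "\<phi> (foldr \<rho> w v) = foldr \<rho>' w (\<phi> v)"
      by (induct w) (use st gen in auto)
    then show ?case using st scale by simp
  next
    case (add p q)
    then show ?case using R.stable_act[OF assms(3) v] assms(4) by (simp add: R.act_add R'.act_add)
  qed
qed

text \<open>The operators are linear on the whole type, while the relations are imposed on a subset
  \<open>V\<close>; stable subsets of the model and images of intertwiners are then representations
  of the same kind.\<close>

locale alg_rep = free_rep sc \<rho> for sc :: "'k::field \<Rightarrow> 'v::ab_group_add \<Rightarrow> 'v" and \<rho> +
  fixes a :: "transp \<Rightarrow> 'k" and V :: "'v set"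
  assumes stable: "stable V"
    and relations_act: "\<And>r v. r \<in> relations a \<Longrightarrow> v \<in> V \<Longrightarrow> act r v = 0"
begin

text \<open>The elements that kill \<open>V\<close> form a two-sided ideal, closed under right
  multiplication because \<open>V\<close> is stable, and it contains the relations.\<close>

lemma rel_ideal_act:
  assumes "p \<in> rel_ideal a" "v \<in> V"
  shows "act p v = 0"
proof -
  interpret F: ring "free_ring :: 'k free_alg ring" by (rule ring_free_ring)
  let ?I = "{p. \<forall>v\<in>V. act p v = 0}"
  have "subgroup ?I (add_monoid free_ring)"
  proof (rule F.add.subgroupI)
    show "\<ominus>\<^bsub>free_ring\<^esub> p \<in> ?I" if "p \<in> ?I" for p
      using that by (simp add: act_minus)
  qed (auto simp: act_add intro: exI[of _ 0])
  then have "ideal ?I free_ring"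
    by (intro idealI[OF ring_free_ring]) (simp_all add: act_mult stable_act[OF stable])
  then have "rel_ideal a \<subseteq> ?I"
    unfolding rel_ideal_def by (rule F.genideal_minimal) (auto simp: relations_act)
  then show ?thesis using assms by auto
qed

abbreviation "Rep \<equiv> rep_module sc \<rho> V"

lemma rep_module_simps [simp]:
  "carrier Rep = V" "u \<oplus>\<^bsub>Rep\<^esub> v = u + v" "\<zero>\<^bsub>Rep\<^esub> = 0"
  by (simp_all add: rep_module_def)

text \<open>All representatives of a coset act alike on \<open>V\<close>, so the image under
  \<open>the_elem\<close> is a singleton.\<close>

lemma rep_module_smult [simp]:
  assumes "v \<in> V"
  shows "cls a p \<odot>\<^bsub>Rep\<^esub> v = act p v"
proof -
  have "act q v = act p v" if "q \<in> cls a p" for q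
    using rel_ideal_act[of "q - p" v] that assms by (simp add: mem_cls act_diff)
  then have "(\<lambda>q. act q v) ` cls a p = {act p v}"
    using cls_self[of p a] by blast
  then show ?thesis by (simp add: rep_module_def)
qed

lemma left_module_rep: "left_module (alg a) Rep"
proof -
  have "abelian_group Rep"
  proof (rule abelian_groupI)
    show "\<exists>u\<in>carrier Rep. u \<oplus>\<^bsub>Rep\<^esub> v = \<zero>\<^bsub>Rep\<^esub>" if "v \<in> carrier Rep" for v
      using that stable_minus[OF stable, of v] by (intro bexI[of _ "- v"]) simp_all
  qed (use stable in \<open>simp_all add: stable_def add_ac\<close>)
  show ?thesis
  proof (intro left_module.intro left_module_axioms.intro)
    show "ring (alg a)" by (rule ring_alg)
    show "abelian_group Rep" by fact
  qed (use stable in \<open>auto simp: stable_act stable_add act_add act_add_right act_mult\<close>)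
qed

end

section \<open>Transport of module structures\<close>

definition is_module_iso ::
    "('a, 'r) ring_scheme \<Rightarrow> ('a, 'm, 'c) module_scheme \<Rightarrow> ('a, 'n, 'd) module_scheme \<Rightarrow> ('m \<Rightarrow> 'n) \<Rightarrow> bool"
  where "is_module_iso R M N \<phi> \<longleftrightarrow>
    left_module R M \<and> left_module R N \<and> bij_betw \<phi> (carrier M) (carrier N) \<and>
    (\<forall>x \<in> carrier M. \<forall>y \<in> carrier M. \<phi> (x \<oplus>\<^bsub>M\<^esub> y) = \<phi> x \<oplus>\<^bsub>N\<^esub> \<phi> y) \<and>
    (\<forall>r \<in> carrier R. \<forall>x \<in> carrier M. \<phi> (r \<odot>\<^bsub>M\<^esub> x) = r \<odot>\<^bsub>N\<^esub> \<phi> x)"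

lemma module_isomorphic_iff: "module_isomorphic R M N \<longleftrightarrow> (\<exists>\<phi>. is_module_iso R M N \<phi>)"
  by (auto simp: module_isomorphic_def is_module_iso_def)

text \<open>Given closure under the operations, the module axioms of \<open>M\<close> are pulled
  back from \<open>N\<close> along the injective \<open>\<phi>\<close>. This spares a separate
  verification for quotients and for restricted carriers.\<close>

lemma is_module_iso_transport:
  assumes N: "left_module R N" and bij: "bij_betw \<phi> (carrier M) (carrier N)"
    and zero: "\<zero>\<^bsub>M\<^esub> \<in> carrier M" "\<phi> \<zero>\<^bsub>M\<^esub> = \<zero>\<^bsub>N\<^esub>"
    and add: "\<And>x y. x \<in> carrier M \<Longrightarrow> y \<in> carrier M \<Longrightarrow> x \<oplus>\<^bsub>M\<^esub> y \<in> carrier M"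
      "\<And>x y. x \<in> carrier M \<Longrightarrow> y \<in> carrier M \<Longrightarrow> \<phi> (x \<oplus>\<^bsub>M\<^esub> y) = \<phi> x \<oplus>\<^bsub>N\<^esub> \<phi> y"
    and smult: "\<And>r x. r \<in> carrier R \<Longrightarrow> x \<in> carrier M \<Longrightarrow> r \<odot>\<^bsub>M\<^esub> x \<in> carrier M"
      "\<And>r x. r \<in> carrier R \<Longrightarrow> x \<in> carrier M \<Longrightarrow> \<phi> (r \<odot>\<^bsub>M\<^esub> x) = r \<odot>\<^bsub>N\<^esub> \<phi> x"
  shows "is_module_iso R M N \<phi>"
proof -
  interpret N: left_module R N by fact
  have inj: "x = y" if "\<phi> x = \<phi> y" "x \<in> carrier M" "y \<in> carrier M" for x y
    using bij that by (auto simp: bij_betw_def inj_on_def)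
  have clo [simp]: "\<phi> x \<in> carrier N" if "x \<in> carrier M" for x
    using bij that by (auto simp: bij_betw_def)
  have "abelian_group M"
  proof (rule abelian_groupI)
    show "\<exists>y\<in>carrier M. y \<oplus>\<^bsub>M\<^esub> x = \<zero>\<^bsub>M\<^esub>" if x: "x \<in> carrier M" for x
    proof -
      have "\<ominus>\<^bsub>N\<^esub> \<phi> x \<in> \<phi> ` carrier M"
        using bij x by (simp add: bij_betw_def)
      then obtain y where y: "y \<in> carrier M" "\<phi> y = \<ominus>\<^bsub>N\<^esub> \<phi> x" by auto
      then have "\<phi> (y \<oplus>\<^bsub>M\<^esub> x) = \<phi> \<zero>\<^bsub>M\<^esub>"
        using x by (simp add: add zero N.l_neg)
      then show ?thesis using inj y x add zero by blast
    qed
  qed (auto intro!: inj simp: zero add N.a_ac)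
  then have "left_module R M"
    by (intro left_module.intro left_module_axioms.intro)
      (auto intro!: inj simp: add smult N.ring_axioms N.smult_closed N.smult_l_distr
        N.smult_r_distr N.smult_assoc N.smult_one)
  then show ?thesis using N bij add smult by (auto simp: is_module_iso_def)
qed

text \<open>The elements of the quotient are the fibres of \<open>\<phi>\<close>.\<close>

lemma quot_module_iso:
  assumes N: "left_module R N" and M: "abelian_group M"
    and smult: "\<And>r x. r \<in> carrier R \<Longrightarrow> x \<in> carrier M \<Longrightarrow> r \<odot>\<^bsub>M\<^esub> x \<in> carrier M"
      "\<And>r x. r \<in> carrier R \<Longrightarrow> x \<in> carrier M \<Longrightarrow> \<phi> (r \<odot>\<^bsub>M\<^esub> x) = r \<odot>\<^bsub>N\<^esub> \<phi> x"
    and add: "\<And>x y. x \<in> carrier M \<Longrightarrow> y \<in> carrier M \<Longrightarrow> \<phi> (x \<oplus>\<^bsub>M\<^esub> y) = \<phi> x \<oplus>\<^bsub>N\<^esub> \<phi> y"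
    and surj: "\<phi> ` carrier M = carrier N"
    and H: "H = {x \<in> carrier M. \<phi> x = \<zero>\<^bsub>N\<^esub>}"
  obtains \<psi> where "is_module_iso R (quot_module M H) N \<psi>"
    "\<And>x. x \<in> carrier M \<Longrightarrow> \<psi> (H +>\<^bsub>M\<^esub> x) = \<phi> x"
proof -
  interpret N: left_module R N by fact
  interpret M: abelian_group M by fact
  define F where "F n = {y \<in> carrier M. \<phi> y = n}" for n
  have clo [simp]: "\<phi> x \<in> carrier N" if "x \<in> carrier M" for x
    using surj that by auto
  have coset: "H +>\<^bsub>M\<^esub> x = F (\<phi> x)" if x: "x \<in> carrier M" for x
  proof
    show "H +>\<^bsub>M\<^esub> x \<subseteq> F (\<phi> x)"
      using x by (auto simp: a_r_coset_def' H F_def add)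
    show "F (\<phi> x) \<subseteq> H +>\<^bsub>M\<^esub> x"
    proof
      fix y assume "y \<in> F (\<phi> x)"
      then have y: "y \<in> carrier M" "\<phi> y = \<phi> x" by (auto simp: F_def)
      have eq: "(y \<ominus>\<^bsub>M\<^esub> x) \<oplus>\<^bsub>M\<^esub> x = y"
        using x y by (simp add: M.minus_eq M.a_assoc M.l_neg)
      then have "\<phi> (y \<ominus>\<^bsub>M\<^esub> x) \<oplus>\<^bsub>N\<^esub> \<phi> x = \<phi> x"
        using x y add[of "y \<ominus>\<^bsub>M\<^esub> x" x] by simp
      then have "\<phi> (y \<ominus>\<^bsub>M\<^esub> x) = \<zero>\<^bsub>N\<^esub>"
        using x y by (metis M.minus_closed N.add.l_cancel_one' N.add.r_cancel_one clo)
      then have "y \<ominus>\<^bsub>M\<^esub> x \<in> H" using x y by (simp add: H)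
      then show "y \<in> H +>\<^bsub>M\<^esub> x" using eq by (force simp: a_r_coset_def')
    qed
  qed
  have carr: "carrier (quot_module M H) = F ` carrier N"
    by (auto simp: quot_module_def A_RCOSETS_def' coset simp flip: surj)
  have zero: "\<zero>\<^bsub>quot_module M H\<^esub> = F \<zero>\<^bsub>N\<^esub>"
    by (simp add: quot_module_def H F_def)
  have F_add: "F m \<oplus>\<^bsub>quot_module M H\<^esub> F n = F (m \<oplus>\<^bsub>N\<^esub> n)" if mn: "m \<in> carrier N" "n \<in> carrier N" for m n
  proof -
    obtain x y where xy: "x \<in> carrier M" "\<phi> x = m" "y \<in> carrier M" "\<phi> y = n"
      using mn unfolding surj[symmetric] by blast
    have "z \<in> set_add M (F m) (F n)" if z: "z \<in> F (m \<oplus>\<^bsub>N\<^esub> n)" for z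
    proof -
      have "z \<in> H +>\<^bsub>M\<^esub> (x \<oplus>\<^bsub>M\<^esub> y)" using z xy by (simp add: coset add)
      then obtain h where h: "h \<in> H" "z = (h \<oplus>\<^bsub>M\<^esub> x) \<oplus>\<^bsub>M\<^esub> y"
        using xy by (auto simp: a_r_coset_def' M.a_assoc H)
      then have "h \<oplus>\<^bsub>M\<^esub> x \<in> F m" "y \<in> F n" using xy by (auto simp: F_def H add)
      then show ?thesis using h by (auto simp: set_add_def')
    qed
    moreover have "z \<in> F (m \<oplus>\<^bsub>N\<^esub> n)" if "z \<in> set_add M (F m) (F n)" for z
      using that by (auto simp: set_add_def' F_def add)
    ultimately show ?thesis by (auto simp: quot_module_def)
  qed
  have F_smult: "r \<odot>\<^bsub>quot_module M H\<^esub> F n = F (r \<odot>\<^bsub>N\<^esub> n)" if r: "r \<in> carrier R" and n: "n \<in> carrier N" for r n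
  proof -
    obtain x where x: "x \<in> carrier M" "\<phi> x = n"
      using n unfolding surj[symmetric] by blast
    have "H +>\<^bsub>M\<^esub> (r \<odot>\<^bsub>M\<^esub> y) = F (r \<odot>\<^bsub>N\<^esub> n)" if "y \<in> F n" for y
      using that r by (simp add: F_def coset smult)
    \<comment> \<open>The action on a coset is a union over its elements; all terms are the same
      fibre, and nonemptiness of \<open>F n\<close> makes the union equal to it.\<close>
    moreover have "x \<in> F n" using x by (simp add: F_def)
    ultimately show ?thesis by (auto simp: quot_module_def)
  qed
  define \<psi> where "\<psi> C = the_elem (\<phi> ` C)" for C
  have psi: "\<psi> (F n) = n" if n: "n \<in> carrier N" for n
  proof -
    have "\<phi> ` F n = {n}" using n unfolding surj[symmetric] by (auto simp: F_def)
    then show ?thesis by (simp add: \<psi>_def)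
  qed
  show ?thesis
  proof (rule that)
    show "is_module_iso R (quot_module M H) N \<psi>"
    proof (rule is_module_iso_transport[OF N])
      show "bij_betw \<psi> (carrier (quot_module M H)) (carrier N)"
        by (rule bij_betwI[where g = F]) (auto simp: carr psi)
    qed (auto simp: carr zero psi F_add F_smult N.smult_closed)
    show "\<psi> (H +>\<^bsub>M\<^esub> x) = \<phi> x" if "x \<in> carrier M" for x
      using that by (simp add: coset psi)
  qed
qed

text \<open>This is how \<open>L_act\<close> and \<open>k_e_act\<close> are seen to satisfy the
  relations: their carriers are images of stable subsets of the model.\<close>

lemma alg_rep_image:
  assumes "alg_rep sc \<rho> a V" "free_rep sc' \<rho>'"
    and add: "\<And>u v. u \<in> V \<Longrightarrow> v \<in> V \<Longrightarrow> \<phi> (u + v) = \<phi> u + \<phi> v"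
    and scale: "\<And>c v. v \<in> V \<Longrightarrow> \<phi> (sc c v) = sc' c (\<phi> v)"
    and gen: "\<And>x v. v \<in> V \<Longrightarrow> \<phi> (\<rho> x v) = \<rho>' x (\<phi> v)"
  shows "alg_rep sc' \<rho>' a (\<phi> ` V)"
proof -
  interpret R: alg_rep sc \<rho> a V by fact
  interpret R': free_rep sc' \<rho>' by fact
  have V: "0 \<in> V" "\<And>u v. u \<in> V \<Longrightarrow> v \<in> V \<Longrightarrow> u + v \<in> V" "\<And>c v. v \<in> V \<Longrightarrow> sc c v \<in> V"
    "\<And>x v. v \<in> V \<Longrightarrow> \<rho> x v \<in> V"
    using R.stable unfolding R.stable_def by blast+
  have zero: "\<phi> 0 = 0"
    using scale[of 0 0] V(1) by simp
  have tw: "\<phi> (R.act p v) = R'.act p (\<phi> v)" if "v \<in> V" for p v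
    using assms(2) R.free_rep_axioms R.stable that add scale gen
    by (intro act_intertwine[where V = V and \<phi> = \<phi>]) blast+
  show ?thesis
  proof
    show "R'.stable (\<phi> ` V)"
      unfolding R'.stable_def
    proof (intro conjI allI ballI)
      show "0 \<in> \<phi> ` V" using imageI[OF V(1), of \<phi>] by (simp only: zero)
      show "u + v \<in> \<phi> ` V" if "u \<in> \<phi> ` V" "v \<in> \<phi> ` V" for u v
        using that V(2) add by (metis (no_types, lifting) imageE imageI)
      show "sc' c v \<in> \<phi> ` V" if "v \<in> \<phi> ` V" for c v
        using that V(3) scale by (metis (no_types, lifting) imageE imageI)
      show "\<rho>' x v \<in> \<phi> ` V" if "v \<in> \<phi> ` V" for x v
        using that V(4) gen by (metis (no_types, lifting) imageE imageI)
    qed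
    show "R'.act r v = 0" if "r \<in> relations a" "v \<in> \<phi> ` V" for r v
      using that R.relations_act zero tw by (metis (no_types, lifting) imageE)
  qed
qed

section \<open>Submodules and spans read through an isomorphism with a representation\<close>

locale module_model = alg_rep sc \<rho> a UNIV
  for sc :: "'k::field \<Rightarrow> 'v::ab_group_add \<Rightarrow> 'v" and \<rho> a +
  fixes P :: "('k free_alg set, 'm) module" and \<Phi> :: "'m \<Rightarrow> 'v"
  assumes iso: "is_module_iso (alg a) P Rep \<Phi>"
begin

definition pull :: "'v set \<Rightarrow> 'm set" where "pull U = {m \<in> carrier P. \<Phi> m \<in> U}"

lemma left_module_P: "left_module (alg a) P"
  using iso by (simp add: is_module_iso_def)

sublocale P: left_module "alg a" P
  by (rule left_module_P)

lemma bij_Phi: "bij_betw \<Phi> (carrier P) UNIV"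
  using iso by (simp add: is_module_iso_def)

lemma Phi_add [simp]: "x \<in> carrier P \<Longrightarrow> y \<in> carrier P \<Longrightarrow> \<Phi> (x \<oplus>\<^bsub>P\<^esub> y) = \<Phi> x + \<Phi> y"
  using iso by (simp add: is_module_iso_def)

lemma Phi_smult [simp]: "x \<in> carrier P \<Longrightarrow> \<Phi> (cls a p \<odot>\<^bsub>P\<^esub> x) = act p (\<Phi> x)"
  using iso by (simp add: is_module_iso_def)

lemma smult_closed [simp]: "x \<in> carrier P \<Longrightarrow> cls a p \<odot>\<^bsub>P\<^esub> x \<in> carrier P"
  by (rule P.smult_closed) simp_all

lemma Phi_zero [simp]: "\<Phi> \<zero>\<^bsub>P\<^esub> = 0"
  using Phi_add[of "\<zero>\<^bsub>P\<^esub>" "\<zero>\<^bsub>P\<^esub>"] by simp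

lemma Phi_inj: "x \<in> carrier P \<Longrightarrow> y \<in> carrier P \<Longrightarrow> \<Phi> x = \<Phi> y \<longleftrightarrow> x = y"
  using bij_Phi by (auto simp: bij_betw_def inj_on_def)

lemma Phi_eq_zero: "x \<in> carrier P \<Longrightarrow> \<Phi> x = 0 \<longleftrightarrow> x = \<zero>\<^bsub>P\<^esub>"
  using Phi_inj[of x "\<zero>\<^bsub>P\<^esub>"] by simp

lemma Phi_surj: obtains x where "x \<in> carrier P" "\<Phi> x = v"
  using bij_Phi by (metis UNIV_I bij_betw_def imageE)

lemma Phi_a_inv [simp]: "x \<in> carrier P \<Longrightarrow> \<Phi> (\<ominus>\<^bsub>P\<^esub> x) = - \<Phi> x"
  using Phi_add[of "\<ominus>\<^bsub>P\<^esub> x" x] by (simp add: P.l_neg eq_neg_iff_add_eq_0)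

lemma Phi_finsum:
  "f \<in> I \<rightarrow> carrier P \<Longrightarrow> \<Phi> (finsum P f I) = (\<Sum>i\<in>I. \<Phi> (f i))"
  by (induct I rule: infinite_finite_induct) (auto simp: Pi_def)

lemma pull_image: "\<Phi> ` pull U = U"
  by (auto simp: pull_def image_iff) (metis Phi_surj)

lemma pull_subset_iff: "pull U \<subseteq> pull U' \<longleftrightarrow> U \<subseteq> U'"
proof
  assume "pull U \<subseteq> pull U'"
  from image_mono[OF this, of \<Phi>] show "U \<subseteq> U'" by (simp add: pull_image)
qed (auto simp: pull_def)

lemma pull_eq_iff: "pull U = pull U' \<longleftrightarrow> U = U'"
  by (metis pull_image)

lemma pull_psubset_iff: "pull U \<subset> pull U' \<longleftrightarrow> U \<subset> U'"
  by (simp add: psubset_eq pull_subset_iff pull_eq_iff)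

lemma pull_UNIV: "pull UNIV = carrier P"
  by (simp add: pull_def)

lemma pull_zero: "pull {0} = {\<zero>\<^bsub>P\<^esub>}"
  by (auto simp: pull_def Phi_eq_zero)

lemma subgroup_pull:
  assumes "0 \<in> U" "\<And>u v. u \<in> U \<Longrightarrow> v \<in> U \<Longrightarrow> u + v \<in> U" "\<And>u. u \<in> U \<Longrightarrow> - u \<in> U"
  shows "subgroup (pull U) (add_monoid P)"
  by (rule P.add.subgroupI) (use assms in \<open>auto simp: pull_def\<close>)

lemma submodule_pull:
  assumes "stable U"
  shows "submodule (pull U) (alg a) P"
proof (intro submodule.intro submodule_axioms.intro subgroup_pull)
  show "0 \<in> U" using assms by (simp add: stable_def)
  show "r \<odot>\<^bsub>P\<^esub> x \<in> pull U" if "r \<in> carrier (alg a)" "x \<in> pull U" for r x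
    using that stable_act[OF assms] by (auto simp: pull_def)
qed (use assms in \<open>auto simp: stable_add stable_minus\<close>)

text \<open>Scalars and generators act as classes of monomials of length zero and one, so a
  submodule over the algebra has a stable image.\<close>

lemma submoduleE:
  assumes "submodule H (alg a) P"
  obtains U where "stable U" "H = pull U"
proof -
  interpret H: submodule H "alg a" P by fact
  have sub: "H \<subseteq> carrier P" using H.subset by simp
  have clo: "cls a p \<odot>\<^bsub>P\<^esub> x \<in> H" if "x \<in> H" for p x
    using that by (intro H.smult_closed) auto
  have "stable (\<Phi> ` H)" unfolding stable_def
  proof (intro conjI ballI allI)
    show "0 \<in> \<Phi> ` H" using H.one_closed Phi_zero by (metis imageI monoid.select_convs(2))
    show "u + v \<in> \<Phi> ` H" if "u \<in> \<Phi> ` H" "v \<in> \<Phi> ` H" for u v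
    proof -
      from that obtain x y where xy: "x \<in> H" "y \<in> H" "u = \<Phi> x" "v = \<Phi> y" by blast
      then have "x \<oplus>\<^bsub>P\<^esub> y \<in> H" using H.m_closed by simp
      moreover have "\<Phi> (x \<oplus>\<^bsub>P\<^esub> y) = u + v" using xy sub by (simp add: subsetD)
      ultimately show ?thesis by (metis imageI)
    qed
    show "sc c u \<in> \<Phi> ` H" if "u \<in> \<Phi> ` H" for c u
    proof -
      from that obtain x where x: "x \<in> H" "u = \<Phi> x" by blast
      then have "\<Phi> (cls a (Poly_Mapping.single [] c) \<odot>\<^bsub>P\<^esub> x) = sc c u" using sub by (simp add: subsetD)
      then show ?thesis using clo x by (metis imageI)
    qed
    show "\<rho> y u \<in> \<Phi> ` H" if "u \<in> \<Phi> ` H" for y u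
    proof -
      from that obtain x where x: "x \<in> H" "u = \<Phi> x" by blast
      then have "\<Phi> (cls a (Poly_Mapping.single [y] 1) \<odot>\<^bsub>P\<^esub> x) = \<rho> y u" using sub by (simp add: subsetD)
      then show ?thesis using clo x by (metis imageI)
    qed
  qed
  moreover have "H = pull (\<Phi> ` H)"
    using sub Phi_inj by (auto simp: pull_def)
  ultimately show ?thesis by (rule that)
qed

lemma submodule_iff: "submodule H (alg a) P \<longleftrightarrow> (\<exists>U. stable U \<and> H = pull U)"
  using submodule_pull submoduleE by metis

text \<open>The span is defined as an additive subgroup, so its closure under the algebra is checked
  along the inductive generation of the subgroup. After that it is \<open>pull U'\<close> for a
  stable \<open>U'\<close>, and \<open>least\<close> applies.\<close>

lemma alg_span_eq:
  assumes S: "S \<subseteq> pull U" and U: "stable U"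
    and least: "\<And>U'. stable U' \<Longrightarrow> \<Phi> ` S \<subseteq> U' \<Longrightarrow> U \<subseteq> U'"
  shows "alg_span a P S = pull U"
proof -
  let ?G = "{r \<odot>\<^bsub>P\<^esub> s | r s. r \<in> carrier (alg a) \<and> s \<in> S}"
  have SM: "S \<subseteq> carrier P" using S by (auto simp: pull_def)
  have GU: "?G \<subseteq> pull U" using S stable_act[OF U] by (auto simp: pull_def)
  have sub: "subgroup (generate (add_monoid P) ?G) (add_monoid P)"
    by (rule P.add.generate_is_subgroup) (use SM in auto)
  have sm: "r \<odot>\<^bsub>P\<^esub> x \<in> generate (add_monoid P) ?G"
    if r: "r \<in> carrier (alg a)" and "x \<in> generate (add_monoid P) ?G" for r x
    using that(2)
  proof (induct rule: generate.induct)
    case one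
    have "r \<odot>\<^bsub>P\<^esub> \<zero>\<^bsub>P\<^esub> = \<zero>\<^bsub>P\<^esub>"
      using r by (auto simp flip: Phi_eq_zero)
    then show ?case using generate.one[of "add_monoid P"] by simp
  next
    case (incl h)
    then obtain q s where h: "h = q \<odot>\<^bsub>P\<^esub> s" "q \<in> carrier (alg a)" "s \<in> S" by auto
    then have "r \<odot>\<^bsub>P\<^esub> h = (r \<otimes>\<^bsub>alg a\<^esub> q) \<odot>\<^bsub>P\<^esub> s"
      using r SM by (subst P.smult_assoc) auto
    moreover have "r \<otimes>\<^bsub>alg a\<^esub> q \<in> carrier (alg a)" using r h by auto
    ultimately show ?case using h by (intro generate.incl) blast
  next
    case (inv h)
    then obtain q s where h: "h = q \<odot>\<^bsub>P\<^esub> s" "q \<in> carrier (alg a)" "s \<in> S" by auto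
    have s: "s \<in> carrier P" using h SM by auto
    obtain p p' where p: "r = cls a p" "q = cls a p'" using r h by auto
    have "r \<odot>\<^bsub>P\<^esub> (\<ominus>\<^bsub>P\<^esub> h) = cls a (- (p * p')) \<odot>\<^bsub>P\<^esub> s"
      using s p h by (subst Phi_inj[symmetric]) (auto simp: act_minus act_mult act_minus_right)
    then show ?case using h by (auto simp flip: a_inv_def intro!: generate.incl)
  next
    case (eng h1 h2)
    have "h1 \<in> carrier P" "h2 \<in> carrier P"
      using eng subgroup.mem_carrier[OF sub] by auto
    then have "r \<odot>\<^bsub>P\<^esub> (h1 \<oplus>\<^bsub>P\<^esub> h2) = r \<odot>\<^bsub>P\<^esub> h1 \<oplus>\<^bsub>P\<^esub> r \<odot>\<^bsub>P\<^esub> h2"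
      using r by (simp add: P.smult_r_distr del: alg_simps)
    then show ?case using generate.eng[OF eng(2,4)] by simp
  qed
  have "submodule (generate (add_monoid P) ?G) (alg a) P"
    by (intro submodule.intro submodule_axioms.intro sub sm)
  then obtain U' where U': "stable U'" "generate (add_monoid P) ?G = pull U'"
    by (rule submoduleE)
  have "s \<in> generate (add_monoid P) ?G" if s: "s \<in> S" for s
  proof -
    have "s = cls a 1 \<odot>\<^bsub>P\<^esub> s" using s SM by (subst Phi_inj[symmetric]) auto
    then show ?thesis using s by (intro generate.incl) auto
  qed
  then have "\<Phi> ` S \<subseteq> U'" unfolding U'(2) by (auto simp: pull_def)
  with U' have "U \<subseteq> U'" using least by auto
  moreover have "generate (add_monoid P) ?G \<subseteq> pull U"
    by (rule P.add.generate_subgroup_incl[OF GU])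
      (rule submodule.axioms(1)[OF submodule_pull[OF U]])
  ultimately show ?thesis
    unfolding alg_span_def set_prod_span_def using U' pull_subset_iff by auto
qed

text \<open>The multiples of a single vector already form a subgroup, so generation adds
  nothing.\<close>

lemma lin_span_eq:
  assumes m: "m \<in> carrier P"
  shows "lin_span a P {m} = pull (range (\<lambda>c. sc c (\<Phi> m)))"
proof -
  let ?U = "range (\<lambda>c. sc c (\<Phi> m))"
  have "{r \<odot>\<^bsub>P\<^esub> s | r s. r \<in> scalars a \<and> s \<in> {m}} = pull ?U"
  proof (intro equalityI subsetI)
    fix x assume "x \<in> {r \<odot>\<^bsub>P\<^esub> s | r s. r \<in> scalars a \<and> s \<in> {m}}"
    then show "x \<in> pull ?U" using m by (auto simp: scalars_def pull_def)
  next
    fix x assume "x \<in> pull ?U"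
    then obtain c where c: "x \<in> carrier P" "\<Phi> x = sc c (\<Phi> m)" by (auto simp: pull_def)
    then have "x = cls a (Poly_Mapping.single [] c) \<odot>\<^bsub>P\<^esub> m"
      using m by (subst Phi_inj[symmetric]) auto
    then show "x \<in> {r \<odot>\<^bsub>P\<^esub> s | r s. r \<in> scalars a \<and> s \<in> {m}}"
      by (auto simp: scalars_def)
  qed
  moreover have sub: "subgroup (pull ?U) (add_monoid P)"
  proof (rule subgroup_pull)
    show "0 \<in> ?U" by (rule range_eqI[of _ _ 0]) simp
    show "u + v \<in> ?U" if "u \<in> ?U" "v \<in> ?U" for u v
      using that by (auto simp flip: scale_left_distrib)
    show "- u \<in> ?U" if "u \<in> ?U" for u
      using that by (auto simp flip: scale_minus_left)
  qed
  moreover have "generate (add_monoid P) (pull ?U) = pull ?U"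
    using P.add.generate_subgroup_incl[OF subset_refl sub] by (auto intro: generate.incl)
  ultimately show ?thesis
    unfolding lin_span_def set_prod_span_def by metis
qed

lemma weight_space_eq: "weight_space a P g = pull (range (\<rho> (Delta g)))"
proof (intro equalityI subsetI)
  fix x assume "x \<in> weight_space a P g"
  then show "x \<in> pull (range (\<rho> (Delta g)))" by (auto simp: weight_space_def pull_def)
next
  fix x assume "x \<in> pull (range (\<rho> (Delta g)))"
  then obtain v where v: "x \<in> carrier P" "\<Phi> x = \<rho> (Delta g) v" by (auto simp: pull_def)
  obtain y where y: "y \<in> carrier P" "\<Phi> y = v" by (rule Phi_surj)
  have "x = cls a (dgen g) \<odot>\<^bsub>P\<^esub> y"
    using v y by (subst Phi_inj[symmetric]) auto
  then show "x \<in> weight_space a P g" using y by (auto simp: weight_space_def)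
qed

lemma alg_rep_stable: "stable U \<Longrightarrow> alg_rep sc \<rho> a U"
  using relations_act by unfold_locales auto

lemma pull_iso:
  assumes U: "stable U"
  shows "is_module_iso (alg a) (P\<lparr>carrier := pull U\<rparr>) (rep_module sc \<rho> U) \<Phi>"
proof -
  interpret U: alg_rep sc \<rho> a U by (rule alg_rep_stable[OF U])
  show ?thesis
  proof (rule is_module_iso_transport[OF U.left_module_rep])
    have "inj_on \<Phi> (pull U)"
      using Phi_inj by (auto simp: inj_on_def pull_def)
    then show "bij_betw \<Phi> (carrier (P\<lparr>carrier := pull U\<rparr>)) (carrier U.Rep)"
      by (simp add: bij_betw_def pull_image)
  qed (use U in \<open>auto simp: pull_def stable_add stable_act stable_def[of U]\<close>)
qed

section \<open>Quotients and images under a linear intertwiner\<close>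

context
  fixes sc' :: "'k \<Rightarrow> 'w::ab_group_add \<Rightarrow> 'w" and \<rho>' U and \<phi> :: "'v \<Rightarrow> 'w"
  assumes U: "stable U" and rep': "free_rep sc' \<rho>'"
    and add: "\<And>u v. u \<in> U \<Longrightarrow> v \<in> U \<Longrightarrow> \<phi> (u + v) = \<phi> u + \<phi> v"
    and scale: "\<And>c v. v \<in> U \<Longrightarrow> \<phi> (sc c v) = sc' c (\<phi> v)"
    and gen: "\<And>x v. v \<in> U \<Longrightarrow> \<phi> (\<rho> x v) = \<rho>' x (\<phi> v)"
begin

interpretation rep': free_rep sc' \<rho>' by (rule rep')

interpretation N: alg_rep sc' \<rho>' a "\<phi> ` U"
  using alg_rep_stable[OF U] rep' add scale gen by (intro alg_rep_image[where V = U and \<phi> = \<phi>]) blast+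

lemma pull_image_hom:
  shows "x \<in> pull U \<Longrightarrow> y \<in> pull U \<Longrightarrow> \<phi> (\<Phi> (x \<oplus>\<^bsub>P\<^esub> y)) = \<phi> (\<Phi> x) + \<phi> (\<Phi> y)"
    and "x \<in> pull U \<Longrightarrow> \<phi> (\<Phi> (cls a p \<odot>\<^bsub>P\<^esub> x)) = rep'.act p (\<phi> (\<Phi> x))"
proof -
  show "\<phi> (\<Phi> (x \<oplus>\<^bsub>P\<^esub> y)) = \<phi> (\<Phi> x) + \<phi> (\<Phi> y)" if "x \<in> pull U" "y \<in> pull U"
    using that by (simp add: pull_def add)
  show "\<phi> (\<Phi> (cls a p \<odot>\<^bsub>P\<^esub> x)) = rep'.act p (\<phi> (\<Phi> x))" if x: "x \<in> pull U"
  proof -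
    have "\<phi> (act p (\<Phi> x)) = rep'.act p (\<phi> (\<Phi> x))"
      by (rule act_intertwine[where V = U and \<phi> = \<phi>, OF free_rep_axioms rep' U])
        (use x add scale gen in \<open>auto simp: pull_def\<close>)
    then show ?thesis using x by (simp add: pull_def)
  qed
qed

lemma quot_pull_isomorphic:
  assumes ker: "U' = {u \<in> U. \<phi> u = 0}"
  shows "module_isomorphic (alg a) (quot_module (P\<lparr>carrier := pull U\<rparr>) (pull U')) (rep_module sc' \<rho>' (\<phi> ` U))"
proof -
  have P': "left_module (alg a) (P\<lparr>carrier := pull U\<rparr>)"
    using pull_iso[OF U] by (simp add: is_module_iso_def)
  interpret M': left_module "alg a" "P\<lparr>carrier := pull U\<rparr>" by (rule P')
  obtain \<psi> where "is_module_iso (alg a) (quot_module (P\<lparr>carrier := pull U\<rparr>) (pull U')) N.Rep \<psi>"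
  proof (rule quot_module_iso[OF N.left_module_rep M'.M.abelian_group_axioms, where \<phi> = "\<lambda>x. \<phi> (\<Phi> x)"])
    show "r \<odot>\<^bsub>P\<lparr>carrier := pull U\<rparr>\<^esub> x \<in> carrier (P\<lparr>carrier := pull U\<rparr>)"
      if "r \<in> carrier (alg a)" "x \<in> carrier (P\<lparr>carrier := pull U\<rparr>)" for r x
      using M'.smult_closed that by blast
    show "pull U' = {x \<in> carrier (P\<lparr>carrier := pull U\<rparr>). \<phi> (\<Phi> x) = \<zero>\<^bsub>N.Rep\<^esub>}"
      by (auto simp: ker pull_def)
    show "(\<lambda>x. \<phi> (\<Phi> x)) ` carrier (P\<lparr>carrier := pull U\<rparr>) = carrier N.Rep"
      using pull_image[of U] by (simp add: image_image[symmetric])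
  qed (auto simp: pull_image_hom, auto simp: pull_def)
  then show ?thesis by (auto simp: module_isomorphic_iff)
qed

lemma pull_isomorphic:
  assumes inj: "inj_on \<phi> U"
  shows "module_isomorphic (alg a) (P\<lparr>carrier := pull U\<rparr>) (rep_module sc' \<rho>' (\<phi> ` U))"
proof -
  have "is_module_iso (alg a) (P\<lparr>carrier := pull U\<rparr>) N.Rep (\<lambda>x. \<phi> (\<Phi> x))"
  proof (rule is_module_iso_transport[OF N.left_module_rep])
    show "bij_betw (\<lambda>x. \<phi> (\<Phi> x)) (carrier (P\<lparr>carrier := pull U\<rparr>)) (carrier N.Rep)"
      using bij_betw_trans[of \<Phi> "pull U" U \<phi> "\<phi> ` U"] pull_iso[OF U] inj
      by (simp add: is_module_iso_def comp_def inj_on_imp_bij_betw alg_rep.rep_module_simps[OF alg_rep_stable[OF U]])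
    show "\<phi> (\<Phi> \<zero>\<^bsub>P\<lparr>carrier := pull U\<rparr>\<^esub>) = \<zero>\<^bsub>N.Rep\<^esub>"
      using scale[of 0 0] U by (simp add: stable_def)
  qed (use U in \<open>auto simp: pull_image_hom\<close>, (use U in \<open>auto simp: pull_def stable_add stable_act stable_def[of U]\<close>)+)
  then show ?thesis by (auto simp: module_isomorphic_iff)
qed

end

end

section \<open>A model of the Verma module\<close>

text \<open>
  The vector \<open>v\<close> of the model stands for \<open>v 1 True \<cdot> 1 + v 1 False \<cdot> m + \<Sum>\<^bsub>g \<noteq> 1\<^esub> v\<^sub>g \<otimes> v g\<close>,
  where \<open>m\<close> is \<open>m\<^sub>t\<^sub>o\<^sub>p\<close> up to sign and pairs are written as functions on \<^typ>\<open>bool\<close>.  The action is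
  forced by the relations: the sum of the \<open>spar a t \<cdot> u\<^sub>t\<close>, and the sum of the functionals \<open>\<lambda>\<^sub>t\<close>, must
  vanish, and \<open>\<lambda>\<^sub>t(u\<^sub>t) = 0\<close>.  We take vectors \<open>pvec t\<close> with sum zero, \<open>u\<^sub>t = pvec t / spar a t\<close> and
  \<open>\<lambda>\<^sub>t = det2 (pvec t)\<close>.
\<close>

definition pvec :: "transp \<Rightarrow> bool \<Rightarrow> 'k::field" where
  "pvec t b = (if t = t12 then of_bool b else if t = t13 then of_bool (\<not> b) else -1)"

text \<open>For transpositions \<open>s \<noteq> t\<close> the value of \<open>f_fun\<close> for
  \<open>s\<close> at the weight \<open>t\<close> is \<open>spar a t\<close> if
  \<open>s t = c3\<close> and \<open>- spar a t\<close> if \<open>s t = d3\<close>. These are the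
  scalars by which \<open>x_s\<close> squares in weight \<open>t\<close>.\<close>

definition spar :: "(transp \<Rightarrow> 'k::field) \<Rightarrow> transp \<Rightarrow> 'k" where
  "spar a t = (if t = t12 then a t23 - a t13 else if t = t13 then a t12 - a t23 else a t13 - a t12)"

definition det2 :: "(bool \<Rightarrow> 'k::field) \<Rightarrow> (bool \<Rightarrow> 'k) \<Rightarrow> 'k" where
  "det2 u w = u True * w False - u False * w True"

definition mscale :: "'k::field \<Rightarrow> (s3 \<Rightarrow> bool \<Rightarrow> 'k) \<Rightarrow> s3 \<Rightarrow> bool \<Rightarrow> 'k" where
  "mscale c v = (\<lambda>g b. c * v g b)"

text \<open>The image is described by its value at the target weight \<open>h\<close>, so the source
  is the weight \<open>t h\<close>, and the coefficient of \<open>L\<close> is taken there. Source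
  \<open>1\<close> occurs for \<open>h = t\<close> and target \<open>1\<close> for source
  \<open>t\<close>; these are the two exceptional cases.\<close>

fun model_act :: "(transp \<Rightarrow> 'k::field) \<Rightarrow> gen \<Rightarrow> (s3 \<Rightarrow> bool \<Rightarrow> 'k) \<Rightarrow> s3 \<Rightarrow> bool \<Rightarrow> 'k" where
  "model_act a (Delta h) v = (\<lambda>g b. if g = h then v g b else 0)"
| "model_act a (Xvar t) v = (\<lambda>h b.
    if h = 1 then if b then 0 else det2 (pvec t) (v (Rep_transp t))
    else if h = Rep_transp t then v 1 True * pvec t b / spar a t
    else (if sign (Perm.apply (Rep_transp t * h)) = 1 then 1 else f_fun a t (Rep_transp t * h)) *
      v (Rep_transp t * h) b)"

definition model_one :: "s3 \<Rightarrow> bool \<Rightarrow> 'k::field" where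
  "model_one g b = of_bool (g = 1 \<and> b)"

lemma sum_fun_apply: "(\<Sum>i\<in>I. f i) x = (\<Sum>i\<in>I. f i x)"
  by (induct I rule: infinite_finite_induct) simp_all

lemma model_eqI:
  assumes "\<And>b. v 1 b = w 1 b" "\<And>b. v s12 b = w s12 b" "\<And>b. v s13 b = w s13 b"
    "\<And>b. v s23 b = w s23 b" "\<And>b. v c3 b = w c3 b" "\<And>b. v d3 b = w d3 b"
  shows "v = w"
proof (intro ext)
  show "v g b = w g b" for g b
    using assms s3_cases[of g] by metis
qed

lemma Rep_transp_neq_one [simp]: "Rep_transp t \<noteq> 1" "1 \<noteq> Rep_transp t"
  using transp_cases[of t] by auto

lemma Rep_transp_square [simp]: "Rep_transp t * Rep_transp t = 1"
  using transp_cases[of t] by auto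

lemma Rep_transp_cancel [simp]: "Rep_transp t * (Rep_transp t * g) = g"
  by (simp flip: mult.assoc)

lemma free_rep_model: "free_rep mscale (model_act a)"
proof
  show "model_act a x (v + w) = model_act a x v + model_act a x w" for x v w
    by (cases x) (auto simp: fun_eq_iff det2_def algebra_simps add_divide_distrib)
  show "model_act a x (mscale c v) = mscale c (model_act a x v)" for x c v
    by (cases x) (auto simp: fun_eq_iff mscale_def det2_def algebra_simps)
qed (auto simp: mscale_def fun_eq_iff algebra_simps)

lemma fun_elt_act:
  assumes "free_rep sc \<rho>"
  shows "word_act sc \<rho> (fun_elt f) v = (\<Sum>g\<in>UNIV. sc (f g) (\<rho> (Delta g) v))"
proof -
  interpret free_rep sc \<rho> by fact
  show ?thesis by (simp add: fun_elt_def act_sum)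
qed

lemma generic_simps:
  assumes "generic a"
  shows "a t12 \<noteq> a t13" "a t12 \<noteq> a t23" "a t13 \<noteq> a t23" "a t13 \<noteq> a t12" "a t23 \<noteq> a t12" "a t23 \<noteq> a t13"
  using assms by (auto simp: generic_def)

lemma spar_nonzero: "generic a \<Longrightarrow> spar a t \<noteq> 0"
  using transp_cases[of t] by (auto simp: spar_def generic_def)

text \<open>Weight by weight, a quadratic relation reduces to one of three facts: the vectors
  \<open>pvec t\<close> have sum zero (starting or ending in weight \<open>e\<close>); the two
  \<open>x_s\<close> with \<open>s \<noteq> t\<close> have opposite coefficients at the weight
  \<open>t\<close>, while the remaining term passes through the top vector and dies (starting at a
  transposition); the \<open>spar a t\<close> have sum zero (between \<open>c3\<close> and
  \<open>d3\<close>). For \<open>x_t\<close> squared the point is that \<open>det2 (pvec t)\<close>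
  kills \<open>pvec t\<close>.\<close>

lemma alg_rep_model:
  assumes "generic a"
  shows "alg_rep mscale (model_act a) a UNIV"
proof -
  interpret free_rep mscale "model_act a" by (rule free_rep_model)
  note [simp] = generic_simps[OF assms] act_add act_diff act_mult act_sum
  show ?thesis
  proof
    show "stable UNIV" by (rule stable_UNIV)
    fix r v assume "r \<in> relations a"
    then consider g h where "r = dgen g * dgen h - (if g = h then dgen g else 0)"
      | "r = (\<Sum>g \<in> UNIV. dgen g) - 1"
      | h t where "r = dgen h * xgen t - xgen t * dgen (Rep_transp t * h)"
      | t where "r = xgen t * xgen t - fun_elt (f_fun a t)"
      | "r = xgen t13 * xgen t23 + xgen t23 * xgen t12 + xgen t12 * xgen t13"
      | "r = xgen t23 * xgen t13 + xgen t13 * xgen t12 + xgen t12 * xgen t23"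
      by (auto simp only: relations_def)
    then show "act r v = 0"
    proof cases
      case 1
      then show ?thesis by (auto simp: fun_eq_iff)
    next
      case 2
      have "(\<Sum>g\<in>UNIV. model_act a (Delta g) v) = v"
        by (intro ext) (simp add: sum_fun_apply finite_s3)
      then show ?thesis using 2 by simp
    next
      case (3 h t)
      have "model_act a (Delta h) (model_act a (Xvar t) v) =
          model_act a (Xvar t) (model_act a (Delta (Rep_transp t * h)) v)"
        using transp_cases[of t] s3_cases[of h]
        by (elim disjE; intro model_eqI; simp add: det2_def)
      then show ?thesis using 3 by simp
    next
      case (4 t)
      have "(\<Sum>g\<in>UNIV. mscale (f_fun a t g) (model_act a (Delta g) v)) = (\<lambda>g b. f_fun a t g * v g b)"
        by (intro ext) (simp add: sum_fun_apply mscale_def finite_s3 if_distrib cong: if_cong)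
      moreover have "model_act a (Xvar t) (model_act a (Xvar t) v) = (\<lambda>g b. f_fun a t g * v g b)"
        using transp_cases[of t]
        by (elim disjE; intro model_eqI; simp add: det2_def f_fun_def pvec_def)
      ultimately show ?thesis using 4 by (simp add: fun_elt_act[OF free_rep_axioms])
    next
      case 5
      have "act r v = 0"
        unfolding 5
        by (intro model_eqI; simp add: det2_def f_fun_def pvec_def spar_def; simp add: field_simps)
      then show ?thesis .
    next
      case 6
      have "act r v = 0"
        unfolding 6
        by (intro model_eqI; simp add: det2_def f_fun_def pvec_def spar_def; simp add: field_simps)
      then show ?thesis .
    qed
  qed
qed

section \<open>Words applied to a vector of weight \<open>e\<close>\<close>

text \<open>The relations involving the \<open>x_t\<close> are assumed as operator identities, and
  \<open>m\<close> has weight \<open>e\<close>. The intended \<open>\<sigma>\<close> is left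
  multiplication on the free algebra followed by projection along \<open>verma_ann\<close>, with
  \<open>m\<close> the projection of \<open>1\<close>.\<close>

locale verma_vector = free_rep sc \<sigma> for sc :: "'k::field \<Rightarrow> 'e::ab_group_add \<Rightarrow> 'e" and \<sigma> +
  fixes a :: "transp \<Rightarrow> 'k" and m :: 'e
  assumes generic: "generic a"
    and Delta_Xvar: "\<sigma> (Delta h) (\<sigma> (Xvar t) p) = \<sigma> (Xvar t) (\<sigma> (Delta (Rep_transp t * h)) p)"
    and Xvar_square: "\<sigma> (Xvar t) (\<sigma> (Xvar t) p) = (\<Sum>g\<in>UNIV. sc (f_fun a t g) (\<sigma> (Delta g) p))"
    and rel_c3: "\<sigma> (Xvar t13) (\<sigma> (Xvar t23) p) + \<sigma> (Xvar t23) (\<sigma> (Xvar t12) p) +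
      \<sigma> (Xvar t12) (\<sigma> (Xvar t13) p) = 0"
    and rel_d3: "\<sigma> (Xvar t23) (\<sigma> (Xvar t13) p) + \<sigma> (Xvar t13) (\<sigma> (Xvar t12) p) +
      \<sigma> (Xvar t12) (\<sigma> (Xvar t23) p) = 0"
    and Delta_m: "\<sigma> (Delta h) m = (if h = 1 then m else 0)"
begin

abbreviation "A \<equiv> \<sigma> (Xvar t12)"
abbreviation "B \<equiv> \<sigma> (Xvar t13)"
abbreviation "C \<equiv> \<sigma> (Xvar t23)"

lemma sigma_simps [simp]:
  "\<sigma> x 0 = 0" "\<sigma> x (- v) = - \<sigma> x v" "\<sigma> x (v - w) = \<sigma> x v - \<sigma> x w"
proof -
  show "\<sigma> x 0 = 0" for x using rho_scale[of x 0 0] by simp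
  show minus: "\<sigma> x (- v) = - \<sigma> x v" for x v using rho_scale[of x "-1" v] by simp
  show "\<sigma> x (v - w) = \<sigma> x v - \<sigma> x w" for x v w
    using rho_add[of x v "- w"] by (simp add: minus)
qed

lemmas [simp] = rho_add rho_scale

definition "wt g p \<longleftrightarrow> (\<forall>h. \<sigma> (Delta h) p = (if h = g then p else 0))"

lemma wt_m: "wt 1 m" by (simp add: wt_def Delta_m)

lemma wt_Xvar: "wt g p \<Longrightarrow> wt (Rep_transp t * g) (\<sigma> (Xvar t) p)"
  unfolding wt_def Delta_Xvar by (metis Rep_transp_cancel sigma_simps(1))

lemma square_wt:
  assumes "wt g p"
  shows "\<sigma> (Xvar t) (\<sigma> (Xvar t) p) = sc (f_fun a t g) p"
proof -
  have "(\<Sum>h\<in>UNIV. sc (f_fun a t h) (\<sigma> (Delta h) p)) = (\<Sum>h\<in>UNIV. if h = g then sc (f_fun a t h) p else 0)"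
    using assms by (intro sum.cong) (auto simp: wt_def)
  then show ?thesis using finite_s3 by (simp add: Xvar_square)
qed

text \<open>Apart from \<open>C m\<close>, these words and \<open>m\<close> are the twelve that
  correspond to a basis of the model; \<open>C m\<close> will be a combination of the two longer
  words of weight \<open>s23\<close>.\<close>

lemma wt_words:
  "wt s12 (A m)" "wt s13 (B m)" "wt s23 (C m)"
  "wt c3 (C (A m))" "wt c3 (A (B m))" "wt d3 (B (A m))" "wt d3 (C (B m))"
  "wt s12 (C (A (B m)))" "wt s13 (A (C (A m)))" "wt s23 (B (C (A m)))" "wt s23 (B (A (B m)))"
  "wt 1 (A (C (A (B m))))"
proof -
  show 1: "wt s12 (A m)" "wt s13 (B m)" "wt s23 (C m)"
    using wt_Xvar[OF wt_m, of t12] wt_Xvar[OF wt_m, of t13] wt_Xvar[OF wt_m, of t23] by simp_all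
  show 2: "wt c3 (C (A m))" "wt c3 (A (B m))" "wt d3 (B (A m))" "wt d3 (C (B m))"
    using wt_Xvar[OF 1(1), of t23] wt_Xvar[OF 1(2), of t12] wt_Xvar[OF 1(1), of t13]
      wt_Xvar[OF 1(2), of t23] by simp_all
  show 3: "wt s12 (C (A (B m)))" "wt s13 (A (C (A m)))" "wt s23 (B (C (A m)))" "wt s23 (B (A (B m)))"
    using wt_Xvar[OF 2(2), of t23] wt_Xvar[OF 2(1), of t12] wt_Xvar[OF 2(1), of t13]
      wt_Xvar[OF 2(2), of t13] by simp_all
  show "wt 1 (A (C (A (B m))))"
    using wt_Xvar[OF 3(1), of t12] by simp
qed

lemma BC: "B (C p) = - C (A p) - A (B p)"
  using rel_c3[of p] by (simp add: eq_neg_iff_add_eq_0 algebra_simps)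

lemma CB: "C (B p) + B (A p) + A (C p) = 0"
  using rel_d3[of p] .

lemma words_two:
  "A (A m) = 0" "B (B m) = 0" "C (C m) = 0"
  using square_wt[OF wt_m, of t12] square_wt[OF wt_m, of t13] square_wt[OF wt_m, of t23]
  by (simp_all add: f_fun_def)

text \<open>Squares act on weight vectors by scalars. A quadratic relation applied to
  \<open>A m\<close> or \<open>B m\<close> loses one of its three terms, since
  \<open>A (A m)\<close> and \<open>B (B m)\<close> vanish, and so identifies two words up to
  sign.\<close>

lemma words_three:
  "A (A (B m)) = sc (spar a t13) (B m)" "C (C (A m)) = sc (spar a t12) (A m)"
  "B (B (A m)) = - sc (spar a t12) (A m)" "C (C (B m)) = - sc (spar a t13) (B m)"
  "A (B (A m)) = - B (C (A m))" "A (C (B m)) = - B (A (B m))"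
  "B (C (B m)) = - C (A (B m))" "C (B (A m)) = - A (C (A m))"
  "sc (spar a t23) (C m) = - B (C (A m)) - B (A (B m))"
proof -
  show "A (A (B m)) = sc (spar a t13) (B m)" "C (C (A m)) = sc (spar a t12) (A m)"
    "B (B (A m)) = - sc (spar a t12) (A m)" "C (C (B m)) = - sc (spar a t13) (B m)"
    using square_wt[OF wt_words(2), of t12] square_wt[OF wt_words(1), of t23]
      square_wt[OF wt_words(1), of t13] square_wt[OF wt_words(2), of t23]
    by (simp_all add: f_fun_def spar_def flip: scale_minus_left)
  show "A (B (A m)) = - B (C (A m))" using BC[of "A m"] by (simp add: words_two)
  show "A (C (B m)) = - B (A (B m))" using CB[of "B m"] by (simp add: words_two eq_neg_iff_add_eq_0 add.commute)
  show "B (C (B m)) = - C (A (B m))" using BC[of "B m"] by (simp add: words_two)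
  show "C (B (A m)) = - A (C (A m))" using CB[of "A m"] by (simp add: words_two eq_neg_iff_add_eq_0)
  \<comment> \<open>Expanding the inner \<open>B (C m)\<close> by the first quadratic relation
    expresses \<open>C m\<close>, up to the factor \<open>spar a t23\<close>, by the chosen
    words.\<close>
  have "B (B (C m)) = sc (spar a t23) (C m)"
    using square_wt[OF wt_words(3), of t13] by (simp add: f_fun_def spar_def)
  then show "sc (spar a t23) (C m) = - B (C (A m)) - B (A (B m))" by (simp add: BC[of m])
qed

text \<open>A letter applied to a basis word of length three either completes a square, possibly
  after the word is replaced by its negative equal from \<open>words_three\<close>, or gives the top
  word up to sign.\<close>

lemma words_four:
  "B (C (A (B m))) = sc (spar a t12) (C (B m))" "C (C (A (B m))) = sc (spar a t12) (A (B m))"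
  "A (A (C (A m))) = sc (spar a t13) (C (A m))" "C (A (C (A m))) = sc (spar a t13) (B (A m))"
  "A (B (C (A m))) = sc (spar a t23) (B (A m))" "B (B (C (A m))) = sc (spar a t23) (C (A m))"
  "A (B (A (B m))) = sc (spar a t23) (C (B m))" "B (B (A (B m))) = sc (spar a t23) (A (B m))"
  "C (B (A (B m))) = - A (C (A (B m)))" "C (B (C (A m))) = A (C (A (B m)))"
  "B (A (C (A m))) = - A (C (A (B m)))"
proof -
  show "C (C (A (B m))) = sc (spar a t12) (A (B m))"
    "A (A (C (A m))) = sc (spar a t13) (C (A m))"
    "B (B (C (A m))) = sc (spar a t23) (C (A m))" "B (B (A (B m))) = sc (spar a t23) (A (B m))"
    using square_wt[OF wt_words(5), of t23] square_wt[OF wt_words(4), of t12]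
      square_wt[OF wt_words(4), of t13] square_wt[OF wt_words(5), of t13]
    by (simp_all add: f_fun_def spar_def)
  have "B (B (C (B m))) = - sc (spar a t12) (C (B m))" "C (C (B (A m))) = - sc (spar a t13) (B (A m))"
    "A (A (B (A m))) = - sc (spar a t23) (B (A m))" "A (A (C (B m))) = - sc (spar a t23) (C (B m))"
    using square_wt[OF wt_words(7), of t13] square_wt[OF wt_words(6), of t23]
      square_wt[OF wt_words(6), of t12] square_wt[OF wt_words(7), of t12]
    by (simp_all add: f_fun_def spar_def flip: scale_minus_left)
  then show "B (C (A (B m))) = sc (spar a t12) (C (B m))" "C (A (C (A m))) = sc (spar a t13) (B (A m))"
    "A (B (C (A m))) = sc (spar a t23) (B (A m))" "A (B (A (B m))) = sc (spar a t23) (C (B m))"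
    by (simp_all add: words_three)
  show 1: "C (B (A (B m))) = - A (C (A (B m)))"
    using CB[of "A (B m)"] by (simp add: words_three words_two eq_neg_iff_add_eq_0)
  \<comment> \<open>Since \<open>C\<close> kills \<open>C m\<close>, it also kills the combination
    of two words that represents a multiple of \<open>C m\<close>; this links
    \<open>C (B (C (A m)))\<close> to the top word.\<close>
  have "C (sc (spar a t23) (C m)) = 0" by (simp add: words_two)
  then show 2: "C (B (C (A m))) = A (C (A (B m)))"
    by (simp only: words_three) (simp add: 1)
  show "B (A (C (A m))) = - A (C (A (B m)))"
    using CB[of "C (A m)"] by (simp add: words_three words_two 2 eq_neg_iff_add_eq_0 add.commute)
qed

text \<open>Up to sign the top word can start with any of the three letters, followed by a word
  whose weight is that very transposition. On this weight the square of the letter is zero.\<close>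

lemma words_five:
  "A (A (C (A (B m)))) = 0" "B (A (C (A (B m)))) = 0" "C (A (C (A (B m)))) = 0"
proof -
  show "A (A (C (A (B m)))) = 0"
    using square_wt[OF wt_words(8), of t12] by (simp add: f_fun_def)
  have "B (B (A (C (A m)))) = 0" "C (C (B (C (A m)))) = 0"
    using square_wt[OF wt_words(9), of t13] square_wt[OF wt_words(10), of t23] by (simp_all add: f_fun_def)
  then show "B (A (C (A (B m)))) = 0" "C (A (C (A (B m)))) = 0"
    by (simp_all add: words_four)
qed

text \<open>
  The words are found from the model: with \<open>s t = c3\<close> the vector \<open>x\<^sub>s x\<^sub>t 1\<close> is \<open>v\<^sub>c \<otimes> pvec t\<close>, with
  \<open>s t = d3\<close> it is \<open>- v\<^sub>d \<otimes> pvec t\<close>, and \<open>pvec t12\<close>, \<open>pvec t13\<close> are the unit vectors.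
\<close>

definition Psi :: "(s3 \<Rightarrow> bool \<Rightarrow> 'k) \<Rightarrow> 'e" where
  "Psi v = sc (v 1 True) m + sc (v 1 False) (A (C (A (B m))))
    + sc (spar a t12 * v s12 True) (A m) + sc (v s12 False) (C (A (B m)))
    + sc (v s13 True) (A (C (A m))) + sc (spar a t13 * v s13 False) (B m)
    + sc (v s23 True) (B (C (A m))) + sc (v s23 False) (B (A (B m)))
    + sc (v c3 True) (C (A m)) + sc (v c3 False) (A (B m))
    - sc (v d3 True) (B (A m)) - sc (v d3 False) (C (B m))"

lemma Psi_add: "Psi (v + w) = Psi v + Psi w"
  by (simp add: Psi_def distrib_left scale_left_distrib)

lemma Psi_scale: "Psi (mscale c v) = sc c (Psi v)"
  by (simp add: Psi_def mscale_def scale_right_distrib scale_right_diff_distrib mult_ac)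

lemma Psi_one: "Psi model_one = m"
  by (simp add: Psi_def model_one_def)

lemma Psi_Delta: "Psi (model_act a (Delta h) v) = \<sigma> (Delta h) (Psi v)"
proof -
  note w = wt_words[unfolded wt_def, rule_format] Delta_m
  show ?thesis using s3_cases[of h] by (elim disjE) (simp_all add: Psi_def w)
qed

lemma Psi_Xvar: "Psi (model_act a (Xvar t) v) = \<sigma> (Xvar t) (Psi v)"
proof -
  note w = words_two words_three(1-8) words_four words_five
  have nz: "spar a t \<noteq> 0" for t using generic by (rule spar_nonzero)
  \<comment> \<open>Among the letters applied to \<open>m\<close>, only \<open>C\<close> leaves the
    list of basis words; division by \<open>spar a t23\<close> brings \<open>C m\<close> back into
    it.\<close>
  have C_m: "sc c (C m) = - sc (c / spar a t23) (B (C (A m))) - sc (c / spar a t23) (B (A (B m)))" for c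
    using arg_cong[OF words_three(9), of "sc (c / spar a t23)"] nz[of t23] by (simp add: scale_right_diff_distrib)
  have f: "f_fun a t12 s13 = spar a t13" "f_fun a t12 s23 = - spar a t23"
    "f_fun a t13 s12 = - spar a t12" "f_fun a t13 s23 = spar a t23"
    "f_fun a t23 s12 = spar a t12" "f_fun a t23 s13 = - spar a t13"
    by (simp_all add: f_fun_def spar_def)
  show ?thesis using transp_cases[of t]
    by (elim disjE) (simp_all add: Psi_def w f C_m det2_def pvec_def nz mult_ac
      scale_left_diff_distrib scale_left_distrib)
qed

end

section \<open>Submodules of the model\<close>

text \<open>For \<open>g \<noteq> 1\<close> this is the tensor of \<open>v_g\<close> and
  \<open>w\<close>; for \<open>g = 1\<close> it is \<open>w True\<close> times the generator plus
  \<open>w False\<close> times the top vector.\<close>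

definition supp_at :: "s3 \<Rightarrow> (bool \<Rightarrow> 'k::field) \<Rightarrow> s3 \<Rightarrow> bool \<Rightarrow> 'k" where
  "supp_at g w = (\<lambda>h b. if h = g then w b else 0)"

definition topset :: "(s3 \<Rightarrow> bool \<Rightarrow> 'k::field) set" where
  "topset = {v. v 1 True = 0 \<and> (\<forall>g. g \<noteq> 1 \<longrightarrow> v g = 0)}"

text \<open>For \<open>w \<noteq> 0\<close> this is \<open>L\<close> tensored with the line of
  \<open>w\<close>, plus the top vector; the line is given by its equation. For \<open>w = 0\<close>
  the equation is empty and the set is \<open>midset\<close>.\<close>

definition lineset :: "(bool \<Rightarrow> 'k::field) \<Rightarrow> (s3 \<Rightarrow> bool \<Rightarrow> 'k) set" where
  "lineset w = {v. v 1 True = 0 \<and> (\<forall>g. g \<noteq> 1 \<longrightarrow> det2 w (v g) = 0)}"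

definition midset :: "(s3 \<Rightarrow> bool \<Rightarrow> 'k::field) set" where
  "midset = {v. v 1 True = 0}"

lemma det2_zero [simp]: "det2 w 0 = 0" "det2 w (\<lambda>b. 0) = 0"
  by (simp_all add: det2_def)

lemma det2_add: "det2 w (u + v) = det2 w u + det2 w v"
  by (simp add: det2_def algebra_simps)

lemma det2_scale: "det2 w (\<lambda>b. c * u b) = c * det2 w u"
  by (simp add: det2_def algebra_simps)

lemma det2_eq_0:
  assumes "w \<noteq> 0" "det2 w u = 0"
  obtains c where "u = (\<lambda>b. c * w b)"
proof (cases "w True = 0")
  case True
  then have "w False \<noteq> 0" using assms(1) by (auto simp: fun_eq_iff) (metis (full_types))
  then have "u b = u False / w False * w b" for b
    using True assms(2) by (cases b) (auto simp: det2_def)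
  then show ?thesis by (intro that[of "u False / w False"] ext)
next
  case False
  then have "u b = u True / w True * w b" for b
    using assms(2) by (cases b) (auto simp: det2_def field_simps)
  then show ?thesis by (intro that[of "u True / w True"] ext)
qed

lemma det2_nondegenerate:
  assumes "w \<noteq> 0"
  obtains u where "det2 w u = 1" "u \<noteq> 0"
proof (cases "w True = 0")
  case True
  then have "w False \<noteq> 0" using assms by (auto simp: fun_eq_iff) (metis (full_types))
  then have "det2 w (\<lambda>b. if b then - 1 / w False else 0) = 1" by (simp add: det2_def)
  then show ?thesis using that by fastforce
next
  case False
  then have "det2 w (\<lambda>b. if b then 0 else 1 / w True) = 1" by (simp add: det2_def)
  then show ?thesis using that by fastforce
qed

text \<open>Cramer's rule for the coordinates of \<open>x\<close> in the basis \<open>w\<close>,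
  \<open>u\<close>.\<close>

lemma det2_expand:
  assumes "det2 w u \<noteq> 0"
  shows "x b = det2 x u / det2 w u * w b + det2 w x / det2 w u * u b"
proof -
  have "det2 w u * x b = det2 x u * w b + det2 w x * u b"
    by (cases b) (simp_all add: det2_def algebra_simps)
  then show ?thesis using assms by (simp add: field_simps)
qed

lemma supp_at_apply: "supp_at g w h = (if h = g then w else (\<lambda>b. 0))"
  by (auto simp: supp_at_def)

lemma supp_at_scale: "mscale c (supp_at g w) = supp_at g (\<lambda>b. c * w b)"
  by (auto simp: supp_at_def mscale_def fun_eq_iff)

lemma supp_at_add: "supp_at g u + supp_at g w = supp_at g (\<lambda>b. u b + w b)"
  by (auto simp: supp_at_def fun_eq_iff)

lemma supp_at_expand: "v = supp_at 1 (v 1) + supp_at s12 (v s12) + supp_at s13 (v s13) + supp_at s23 (v s23) + supp_at c3 (v c3) + supp_at d3 (v d3)"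
  by (rule model_eqI) (simp_all add: supp_at_def)

lemma model_one_eq: "model_one = supp_at 1 of_bool"
  by (auto simp: model_one_def supp_at_def fun_eq_iff)

lemma Delta_supp_at: "model_act a (Delta g) v = supp_at g (v g)"
  by (auto simp: supp_at_def fun_eq_iff)

lemma Xvar_supp_at_one: "model_act a (Xvar t) (supp_at 1 w) = supp_at (Rep_transp t) (\<lambda>b. w True * pvec t b / spar a t)"
  by (intro ext) (auto simp: supp_at_def det2_def dest: arg_cong[of _ _ "\<lambda>g. Rep_transp t * g"])

lemma Xvar_supp_at_transp:
  "model_act a (Xvar t) (supp_at (Rep_transp t) w) = supp_at 1 (\<lambda>b. of_bool (\<not> b) * det2 (pvec t) w)"
  by (intro ext) (auto simp: supp_at_def det2_def dest: arg_cong[of _ _ "\<lambda>g. Rep_transp t * g"])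

lemma Xvar_supp_at:
  assumes "g \<noteq> 1" "g \<noteq> Rep_transp t"
  shows "model_act a (Xvar t) (supp_at g w) =
    supp_at (Rep_transp t * g) (\<lambda>b. (if sign (Perm.apply g) = 1 then 1 else f_fun a t g) * w b)"
proof (intro ext)
  fix h b
  have "Rep_transp t * h = g \<longleftrightarrow> h = Rep_transp t * g" by (metis Rep_transp_cancel)
  moreover have "Rep_transp t * g \<noteq> 1" "Rep_transp t * g \<noteq> Rep_transp t"
    using assms by (metis Rep_transp_cancel mult_1_right, metis Rep_transp_cancel Rep_transp_square)
  ultimately show "model_act a (Xvar t) (supp_at g w) h b = supp_at (Rep_transp t * g)
      (\<lambda>b. (if sign (Perm.apply g) = 1 then 1 else f_fun a t g) * w b) h b"
    using assms by (auto simp: supp_at_def det2_def)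
qed

context
  fixes a :: "transp \<Rightarrow> 'k::field"
  assumes generic: "generic a"
begin

interpretation M: alg_rep mscale "model_act a" a UNIV
  by (rule alg_rep_model[OF generic])

lemma model_stableI:
  assumes "0 \<in> U" "\<And>u v. u \<in> U \<Longrightarrow> v \<in> U \<Longrightarrow> u + v \<in> U" "\<And>c v. v \<in> U \<Longrightarrow> mscale c v \<in> U"
    "\<And>g v. v \<in> U \<Longrightarrow> supp_at g (v g) \<in> U" "\<And>t v. v \<in> U \<Longrightarrow> model_act a (Xvar t) v \<in> U"
  shows "M.stable U"
  unfolding M.stable_def
proof (intro conjI ballI allI)
  show "model_act a x v \<in> U" if "v \<in> U" for x v
    using that assms(4,5) by (cases x) (auto simp: Delta_supp_at simp del: model_act.simps)
qed (use assms in auto)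

lemma stable_midset: "M.stable midset"
  by (rule model_stableI) (auto simp: midset_def mscale_def supp_at_def)

lemma stable_topset: "M.stable topset"
proof (rule model_stableI)
  fix t and v :: "s3 \<Rightarrow> bool \<Rightarrow> 'k" assume "v \<in> topset"
  then have v: "v 1 True = 0" "\<And>g. g \<noteq> 1 \<Longrightarrow> v g = 0" by (auto simp: topset_def)
  have "v = supp_at 1 (v 1)" using v by (auto simp: supp_at_def fun_eq_iff)
  then have "model_act a (Xvar t) v = supp_at (Rep_transp t) (\<lambda>b. v 1 True * pvec t b / spar a t)"
    by (metis Xvar_supp_at_one)
  also have "\<dots> = 0" using v by (auto simp: supp_at_def fun_eq_iff)
  finally show "model_act a (Xvar t) v \<in> topset" by (simp add: topset_def)
qed (auto simp: topset_def mscale_def supp_at_def fun_eq_iff)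

text \<open>Between weights other than \<open>e\<close> the operators act on the second tensor
  factor by scalars, and into weight \<open>t\<close> only the coefficient of the generator
  contributes, which is zero here.\<close>

lemma stable_lineset: "M.stable (lineset w)"
proof (rule model_stableI)
  fix t v assume "v \<in> lineset w"
  then have v: "v 1 True = 0" "\<And>g. g \<noteq> 1 \<Longrightarrow> det2 w (v g) = 0" by (auto simp: lineset_def)
  have "det2 w (model_act a (Xvar t) v g) = 0" if "g \<noteq> 1" for g
  proof (cases "g = Rep_transp t")
    case False
    then have "Rep_transp t * g \<noteq> 1" by (metis Rep_transp_cancel mult_1_right)
    with v False that show ?thesis by (simp add: det2_scale)
  qed (use v in simp)
  then show "model_act a (Xvar t) v \<in> lineset w" by (simp add: lineset_def)
qed (auto simp: lineset_def det2_add det2_scale mscale_def supp_at_apply)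

context
  fixes U assumes U: "M.stable U"
begin

lemma stable_closed:
  "0 \<in> U" "u \<in> U \<Longrightarrow> v \<in> U \<Longrightarrow> u + v \<in> U" "v \<in> U \<Longrightarrow> mscale c v \<in> U" "v \<in> U \<Longrightarrow> model_act a x v \<in> U"
  using U by (auto simp: M.stable_def simp del: model_act.simps)

lemma stable_supp_at: "v \<in> U \<Longrightarrow> supp_at g (v g) \<in> U"
  using stable_closed(4)[of v "Delta g"] by (simp only: Delta_supp_at)

lemma stable_supp_at_scale: "supp_at g w \<in> U \<Longrightarrow> supp_at g (\<lambda>b. c * w b) \<in> U"
  using stable_closed(3)[of "supp_at g w" c] by (simp only: supp_at_scale)

lemma stable_supp_at_add: "supp_at g u \<in> U \<Longrightarrow> supp_at g w \<in> U \<Longrightarrow> supp_at g (\<lambda>b. u b + w b) \<in> U"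
  using stable_closed(2)[of "supp_at g u" "supp_at g w"] by (simp only: supp_at_add)

lemma stable_expand: "(\<And>g. supp_at g (v g) \<in> U) \<Longrightarrow> v \<in> U"
  by (subst supp_at_expand) (intro stable_closed)

lemma stable_step:
  assumes "supp_at g w \<in> U" "g \<noteq> 1" "g \<noteq> Rep_transp t" "sign (Perm.apply g) = 1 \<or> f_fun a t g \<noteq> 0"
  shows "supp_at (Rep_transp t * g) w \<in> U"
proof -
  define k where "k = (if sign (Perm.apply g) = 1 then 1 else f_fun a t g)"
  have "k \<noteq> 0" using assms(4) by (auto simp: k_def)
  have "supp_at (Rep_transp t * g) (\<lambda>b. k * w b) \<in> U"
    using stable_closed(4)[OF assms(1), of "Xvar t"] assms by (simp add: Xvar_supp_at k_def del: model_act.simps)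
  from stable_supp_at_scale[OF this, of "1 / k"] show ?thesis using \<open>k \<noteq> 0\<close> by simp
qed

text \<open>All weights are joined through \<open>c3\<close>. Steps from a three-cycle to a
  transposition have coefficient one; steps back have a difference of two parameters as coefficient,
  nonzero by genericity.\<close>

lemma stable_move:
  assumes "supp_at g w \<in> U" "g \<noteq> 1" "h \<noteq> 1"
  shows "supp_at h w \<in> U"
proof -
  note [simp] = generic_simps[OF generic]
  have d12: "supp_at s12 w \<in> U" if "supp_at d3 w \<in> U" using stable_step[OF that, of t13] by simp
  have c12: "supp_at c3 w \<in> U" if "supp_at s12 w \<in> U" using stable_step[OF that, of t23] by (simp add: f_fun_def)
  have c13: "supp_at c3 w \<in> U" if "supp_at s13 w \<in> U" using stable_step[OF that, of t12] by (simp add: f_fun_def)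
  have c23: "supp_at c3 w \<in> U" if "supp_at s23 w \<in> U" using stable_step[OF that, of t13] by (simp add: f_fun_def)
  have c: "supp_at c3 w \<in> U"
    using s3_cases[of g] assms(1,2) d12 c12 c13 c23 by auto
  have 12: "supp_at s12 w \<in> U" using stable_step[OF c, of t23] by simp
  have 13: "supp_at s13 w \<in> U" using stable_step[OF c, of t12] by simp
  have 23: "supp_at s23 w \<in> U" using stable_step[OF c, of t13] by simp
  have d: "supp_at d3 w \<in> U" using stable_step[OF 12, of t13] by (simp add: f_fun_def)
  show ?thesis using s3_cases[of h] assms(3) c 12 13 23 d by auto
qed

text \<open>After moving \<open>w\<close> to the weight of \<open>t\<close>, the operator
  \<open>x_t\<close> produces \<open>det2 (pvec t) w\<close> times the top vector. As
  \<open>pvec t12\<close> and \<open>pvec t13\<close> are the unit vectors, one of these two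
  determinants is nonzero.\<close>

lemma stable_top:
  assumes "supp_at g w \<in> U" "g \<noteq> 1" "w \<noteq> 0" "u True = 0"
  shows "supp_at 1 u \<in> U"
proof -
  have top: "supp_at 1 u \<in> U" if "det2 (pvec t) w \<noteq> 0" for t
  proof -
    have "supp_at (Rep_transp t) w \<in> U" using stable_move assms by simp
    from stable_closed(4)[OF this, of "Xvar t"]
    have "supp_at 1 (\<lambda>b. of_bool (\<not> b) * det2 (pvec t) w) \<in> U" by (simp only: Xvar_supp_at_transp)
    from stable_supp_at_scale[OF this, of "u False / det2 (pvec t) w"]
    have "supp_at 1 (\<lambda>b. u False / det2 (pvec t) w * (of_bool (\<not> b) * det2 (pvec t) w)) \<in> U" .
    moreover have "(\<lambda>b. u False / det2 (pvec t) w * (of_bool (\<not> b) * det2 (pvec t) w)) = u"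
      using that assms(4) by (auto simp: fun_eq_iff)
    ultimately show ?thesis by simp
  qed
  have "w True \<noteq> 0 \<or> w False \<noteq> 0"
    using assms(3) by (auto simp: fun_eq_iff) (metis (full_types))
  then have "det2 (pvec t12) w \<noteq> 0 \<or> det2 (pvec t13) w \<noteq> 0"
    by (auto simp: det2_def pvec_def)
  then show ?thesis using top by blast
qed

lemma lineset_subset:
  assumes "supp_at g w \<in> U" "g \<noteq> 1" "w \<noteq> 0"
  shows "lineset w \<subseteq> U"
proof
  fix v assume v: "v \<in> lineset w"
  show "v \<in> U"
  proof (rule stable_expand)
    fix h show "supp_at h (v h) \<in> U"
    proof (cases "h = 1")
      case True
      then show ?thesis using stable_top[OF assms, of "v 1"] v by (simp add: lineset_def)
    next
      case False
      then have "det2 w (v h) = 0" using v by (simp add: lineset_def)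
      then obtain c where "v h = (\<lambda>b. c * w b)" by (rule det2_eq_0[OF assms(3)])
      then show ?thesis using stable_supp_at_scale[OF stable_move[OF assms(1,2) False]] by simp
    qed
  qed
qed

lemma midset_subset:
  assumes w: "supp_at g w \<in> U" "g \<noteq> 1" and u: "supp_at h u \<in> U" "h \<noteq> 1" and det: "det2 w u \<noteq> 0"
  shows "midset \<subseteq> U"
proof
  fix v :: "s3 \<Rightarrow> bool \<Rightarrow> 'k" assume v: "v \<in> midset"
  show "v \<in> U"
  proof (rule stable_expand)
    fix k show "supp_at k (v k) \<in> U"
    proof (cases "k = 1")
      case True
      have "w \<noteq> 0" using det by (auto simp: det2_def)
      then show ?thesis using stable_top[OF w, of "v 1"] v True by (simp add: midset_def)
    next
      case False
      have "supp_at k (\<lambda>b. det2 (v k) u / det2 w u * w b + det2 w (v k) / det2 w u * u b) \<in> U"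
        using False by (intro stable_supp_at_add stable_supp_at_scale stable_move[OF w] stable_move[OF u])
      moreover have "(\<lambda>b. det2 (v k) u / det2 w u * w b + det2 w (v k) / det2 w u * u b) = v k"
        by (intro ext) (rule det2_expand[OF det, symmetric])
      ultimately show ?thesis by (simp only:)
    qed
  qed
qed

text \<open>The operators \<open>x_t\<close> send the weight-\<open>e\<close> component of
  \<open>v\<close> to nonzero multiples of \<open>pvec t\<close> in weight \<open>t\<close>, the top
  vector contributing nothing. Two of these directions are independent and give
  \<open>midset\<close>; a multiple of \<open>v\<close> supplies the rest.\<close>

lemma stable_eq_UNIV:
  assumes v: "v \<in> U" "v 1 True \<noteq> 0"
  shows "U = UNIV"
proof -
  have one: "supp_at 1 (v 1) \<in> U" by (rule stable_supp_at[OF v(1)])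
  have p: "supp_at (Rep_transp t) (pvec t) \<in> U" for t
  proof -
    have "supp_at (Rep_transp t) (\<lambda>b. v 1 True * pvec t b / spar a t) \<in> U"
      using stable_closed(4)[OF one, of "Xvar t"] by (simp only: Xvar_supp_at_one)
    from stable_supp_at_scale[OF this, of "spar a t / v 1 True"] show ?thesis
      using v(2) spar_nonzero[OF generic, of t] by simp
  qed
  have mid: "midset \<subseteq> U"
    using p[of t12] p[of t13] by (intro midset_subset[of s12 "pvec t12" s13 "pvec t13"]) (auto simp: det2_def pvec_def)
  have "u \<in> U" for u
  proof -
    let ?c = "u 1 True / v 1 True"
    have "u - mscale ?c v \<in> U" using v(2) mid by (auto simp: midset_def mscale_def)
    from stable_closed(2)[OF this stable_closed(3)[OF v(1), of ?c]] show ?thesis by simp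
  qed
  then show ?thesis by auto
qed

lemma stable_classification:
  "U = {0} \<or> U = topset \<or> (\<exists>w. w \<noteq> 0 \<and> U = lineset w) \<or> U = midset \<or> U = UNIV"
proof (cases "U \<subseteq> midset")
  case False
  then show ?thesis using stable_eq_UNIV by (auto simp: midset_def)
next
  case mid: True
  show ?thesis
  proof (cases "U \<subseteq> topset")
    case top: True
    have "topset \<subseteq> U" if v: "v \<in> U" "v \<noteq> 0" for v
    proof
      fix u :: "s3 \<Rightarrow> bool \<Rightarrow> 'k" assume u: "u \<in> topset"
      have v0: "v 1 True = 0" "\<And>g. g \<noteq> 1 \<Longrightarrow> v g = 0" using v top by (auto simp: topset_def)
      have "v 1 False \<noteq> 0"
      proof
        assume "v 1 False = 0"
        then have "v g b = 0" for g b using v0 by (cases "g = 1"; cases b) auto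
        then show False using v by (auto simp: fun_eq_iff)
      qed
      then have "u g b = mscale (u 1 False / v 1 False) v g b" for g b
        using u v0 by (cases "g = 1"; cases b) (auto simp: topset_def mscale_def)
      then have "u = mscale (u 1 False / v 1 False) v" by (intro ext)
      then show "u \<in> U" using stable_closed(3)[OF v(1)] by metis
    qed
    then show ?thesis using top stable_closed(1) by blast
  next
    case False
    then obtain v g where v: "v \<in> U" "g \<noteq> 1" "v g \<noteq> 0"
      using mid by (auto simp: topset_def midset_def)
    have line: "lineset (v g) \<subseteq> U" by (rule lineset_subset[OF stable_supp_at[OF v(1)] v(2,3)])
    show ?thesis
    proof (cases "U \<subseteq> lineset (v g)")
      case True
      then show ?thesis using line v by blast
    next
      case False
      then obtain u h where u: "u \<in> U" "h \<noteq> 1" "det2 (v g) (u h) \<noteq> 0"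
        using mid by (auto simp: lineset_def midset_def)
      have "midset \<subseteq> U"
        by (rule midset_subset[OF stable_supp_at[OF v(1)] v(2) stable_supp_at[OF u(1)] u(2,3)])
      then show ?thesis using mid by blast
    qed
  qed
qed

end

text \<open>Provides surjectivity of the map from the Verma module to the model.\<close>

lemma model_one_generates: obtains p where "M.act p model_one = v"
proof -
  have "M.stable (range (\<lambda>p. M.act p model_one))"
    unfolding M.stable_def
  proof (intro conjI ballI allI)
    show "0 \<in> range (\<lambda>p. M.act p model_one)"
      by (rule range_eqI[of _ _ 0]) simp
    show "u + w \<in> range (\<lambda>p. M.act p model_one)"
      if "u \<in> range (\<lambda>p. M.act p model_one)" "w \<in> range (\<lambda>p. M.act p model_one)" for u w
      using that by (auto simp flip: M.act_add)
    show "mscale c u \<in> range (\<lambda>p. M.act p model_one)"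
      if "u \<in> range (\<lambda>p. M.act p model_one)" for c u
    proof -
      from that obtain p where "u = M.act p model_one" by blast
      then have "mscale c u = M.act (Poly_Mapping.single [] c * p) model_one" by (simp add: M.act_mult)
      then show ?thesis by auto
    qed
    show "model_act a x u \<in> range (\<lambda>p. M.act p model_one)"
      if "u \<in> range (\<lambda>p. M.act p model_one)" for x u
    proof -
      from that obtain p where "u = M.act p model_one" by blast
      then have "model_act a x u = M.act (Poly_Mapping.single [x] 1 * p) model_one"
        by (simp add: M.act_mult del: model_act.simps)
      then show ?thesis by auto
    qed
  qed
  moreover have "model_one \<in> range (\<lambda>p. M.act p model_one)"
    by (rule range_eqI[of _ _ 1]) simp
  ultimately have "range (\<lambda>p. M.act p model_one) = UNIV"
    by (rule stable_eq_UNIV) (simp add: model_one_def)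
  then show ?thesis using that by (metis rangeE UNIV_I)
qed

text \<open>The path runs through the weights \<open>e\<close>, \<open>s12\<close>,
  \<open>c3\<close>, \<open>s13\<close>, \<open>e\<close>. The division by \<open>spar a t12\<close>
  in the first step cancels against the coefficient of the second, and the sign is
  \<open>det2 (pvec t13) (pvec t12) = -1\<close>.\<close>

lemma act_model_top:
  "M.act (xgen t13 * xgen t12 * xgen t23 * xgen t12) model_one = supp_at 1 (\<lambda>b. - of_bool (\<not> b))"
proof -
  have "M.act (xgen t13 * xgen t12 * xgen t23 * xgen t12) model_one =
    model_act a (Xvar t13) (model_act a (Xvar t12) (model_act a (Xvar t23) (model_act a (Xvar t12) (supp_at 1 of_bool))))"
    by (simp add: M.act_mult model_one_eq del: model_act.simps)
  moreover have "model_act a (Xvar t12) (supp_at 1 of_bool) = supp_at s12 (\<lambda>b. pvec t12 b / spar a t12)"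
    using Xvar_supp_at_one[of a t12 of_bool] by simp
  moreover have "model_act a (Xvar t23) (supp_at s12 (\<lambda>b. pvec t12 b / spar a t12)) = supp_at c3 (pvec t12)"
    using spar_nonzero[OF generic, of t12] by (subst Xvar_supp_at) (simp_all add: f_fun_def spar_def)
  moreover have "model_act a (Xvar t12) (supp_at c3 (pvec t12)) = supp_at s13 (pvec t12)"
    by (subst Xvar_supp_at) simp_all
  moreover have "model_act a (Xvar t13) (supp_at s13 (pvec t12)) = supp_at 1 (\<lambda>b. - of_bool (\<not> b))"
    using Xvar_supp_at_transp[of a t13 "pvec t12"] by (simp add: det2_def pvec_def)
  ultimately show ?thesis by (simp only:)
qed

end

section \<open>The Verma module\<close>

text \<open>A basis of \<open>J\<close> is extended to the whole space; \<open>\<pi>\<close> kills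
  the former and fixes the added vectors.\<close>

lemma (in vector_space) subspace_projection:
  assumes J: "subspace J"
  obtains \<pi> where "Vector_Spaces.linear scale scale \<pi>" "\<And>x. \<pi> x = 0 \<longleftrightarrow> x \<in> J" "\<And>x. x - \<pi> x \<in> J"
proof -
  interpret vector_space_pair scale scale ..
  obtain B where B: "B \<subseteq> J" "independent B" "J \<subseteq> span B"
    by (rule maximal_independent_subset[of J])
  obtain B' where B': "B \<subseteq> B'" "B' \<subseteq> UNIV" "independent B'" "UNIV \<subseteq> span B'"
    by (rule maximal_independent_subset_extend[OF subset_UNIV B(2)])
  obtain \<pi> where lin: "Vector_Spaces.linear scale scale \<pi>"
    and \<pi>: "\<And>x. x \<in> B' \<Longrightarrow> \<pi> x = (if x \<in> B then 0 else x)"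
    using linear_independent_extend[OF B'(3), of "\<lambda>x. if x \<in> B then 0 else x"] by blast
  interpret \<pi>: Vector_Spaces.linear scale scale \<pi> by (rule lin)
  have zero: "\<pi> x = 0" if "x \<in> J" for x
  proof -
    have "x \<in> span B" using that B(3) by blast
    then show ?thesis
    proof (induct rule: span_induct_alt)
      case (step c b y)
      then show ?case using \<pi>[of b] B'(1) by (auto simp: \<pi>.add \<pi>.scale)
    qed (rule \<pi>.zero)
  qed
  have diff: "x - \<pi> x \<in> J" for x
  proof -
    have "x \<in> span B'" using B'(4) by blast
    then show ?thesis
    proof (induct rule: span_induct_alt)
      case base
      then show ?case using subspace_0[OF J] by (simp add: \<pi>.zero)
    next
      case (step c b y)
      have "b - \<pi> b \<in> J" using step(1) \<pi>[of b] B(1) subspace_0[OF J] by auto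
      then have "scale c (b - \<pi> b) + (y - \<pi> y) \<in> J"
        using step J by (intro subspace_add subspace_scale)
      then show ?case by (simp add: \<pi>.add \<pi>.scale algebra_simps)
    qed
  qed
  show ?thesis
  proof (rule that[OF lin _ diff])
    show "\<pi> x = 0 \<longleftrightarrow> x \<in> J" for x using zero diff[of x] by auto
  qed
qed

lemma abelian_group_free_pairs: "abelian_group (free_pairs R N)"
proof (rule abelian_groupI)
  show "\<exists>d\<in>carrier (free_pairs R N). d \<oplus>\<^bsub>free_pairs R N\<^esub> c = \<zero>\<^bsub>free_pairs R N\<^esub>"
    if "c \<in> carrier (free_pairs R N)" for c
    using that by (intro bexI[of _ "- c"]) (auto simp: free_pairs_def)
qed (use keys_add in \<open>fastforce simp: free_pairs_def\<close>)+

lemma free_pairs_simps [simp]: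
  "c \<in> carrier (free_pairs R N) \<longleftrightarrow> Poly_Mapping.keys c \<subseteq> carrier R \<times> carrier N"
  "c \<oplus>\<^bsub>free_pairs R N\<^esub> d = c + d" "\<zero>\<^bsub>free_pairs R N\<^esub> = 0"
  "r \<odot>\<^bsub>free_pairs R N\<^esub> c = frag_extend (\<lambda>(t, n). frag_of (r \<otimes>\<^bsub>R\<^esub> t, n)) c"
  by (simp_all add: free_pairs_def)

lemma a_inv_free_pairs: "c \<in> carrier (free_pairs R N) \<Longrightarrow> \<ominus>\<^bsub>free_pairs R N\<^esub> c = - c"
  using abelian_group.minus_equality[OF abelian_group_free_pairs, of R N "- c" c] by simp

text \<open>The additive extension of \<open>f\<close> to the free abelian group, with integer
  coefficients acting through their images in the field.\<close>

definition frag_eval :: "('k::field \<Rightarrow> 'v \<Rightarrow> 'v) \<Rightarrow> ('b \<Rightarrow> 'v::ab_group_add) \<Rightarrow> ('b \<Rightarrow>\<^sub>0 int) \<Rightarrow> 'v" where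
  "frag_eval sc f c = (\<Sum>i\<in>Poly_Mapping.keys c. sc (of_int (Poly_Mapping.lookup c i)) (f i))"

context vector_space
begin

lemma frag_eval_superset:
  assumes "finite S" "Poly_Mapping.keys c \<subseteq> S"
  shows "frag_eval scale f c = (\<Sum>i\<in>S. scale (of_int (Poly_Mapping.lookup c i)) (f i))"
  unfolding frag_eval_def using assms by (intro sum.mono_neutral_left) (auto simp: in_keys_iff)

lemma frag_eval_zero [simp]: "frag_eval scale f 0 = 0"
  by (simp add: frag_eval_def)

lemma frag_eval_of [simp]: "frag_eval scale f (frag_of x) = f x"
  by (simp add: frag_eval_def)

lemma frag_eval_add: "frag_eval scale f (c + d) = frag_eval scale f c + frag_eval scale f d"
  using keys_add[of c d]
  by (simp add: frag_eval_superset[of "Poly_Mapping.keys c \<union> Poly_Mapping.keys d"] lookup_add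
      scale_left_distrib sum.distrib)

lemma frag_eval_diff: "frag_eval scale f (c - d) = frag_eval scale f c - frag_eval scale f d"
  using frag_eval_add[of f "c - d" d] by simp

end

section \<open>The left ideal of the free algebra that annihilates the generator of the Verma
  module\<close>

context
  fixes a :: "transp \<Rightarrow> 'k::field"
begin

abbreviation "verma_pairs \<equiv> free_pairs (alg a) (point_module 1 :: (s3 \<Rightarrow> 'k, 'k) module)"
abbreviation "verma_kernel \<equiv> tensor_kernel (alg a) fun_ring (fun_incl a) (point_module 1 :: (s3 \<Rightarrow> 'k, 'k) module)"

lemma point_module_simps [simp]:
  "carrier (point_module g) = UNIV" "x \<oplus>\<^bsub>point_module g\<^esub> y = x + y" "f \<odot>\<^bsub>point_module g\<^esub> x = f g * x"
  by (simp_all add: point_module_def)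

lemma fun_ring_carrier [simp]: "carrier fun_ring = UNIV"
  by (simp add: ring_of_type_algebra_def)

lemma verma_kernel_relations: "r \<in> tensor_relations (alg a) fun_ring (fun_incl a) (point_module 1) \<Longrightarrow> r \<in> verma_kernel"
  unfolding tensor_kernel_def by (rule generate.incl)

lemma relations_carrier: "tensor_relations (alg a) fun_ring (fun_incl a) (point_module 1) \<subseteq> carrier verma_pairs"
proof
  have clo: "c - d \<in> carrier verma_pairs" if "c \<in> carrier verma_pairs" "d \<in> carrier verma_pairs" for c d
    using that keys_diff[of c d] by fastforce
  have gen: "frag_of (cls a p, n) \<in> carrier verma_pairs" for p n by simp
  fix r assume "r \<in> tensor_relations (alg a) fun_ring (fun_incl a) (point_module 1)"
  then show "r \<in> carrier verma_pairs"
    unfolding tensor_relations_def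
    by (auto simp: fun_incl_def simp del: free_pairs_simps intro!: clo gen)
qed

lemma subgroup_verma_kernel: "subgroup verma_kernel (add_monoid verma_pairs)"
  unfolding tensor_kernel_def
  using abelian_group.axioms(2)[OF abelian_group_free_pairs, unfolded abelian_group_axioms_def] relations_carrier
  by (intro group.generate_is_subgroup comm_group.axioms(2)) simp_all

lemma verma_kernel_closed:
  shows verma_kernel_carrier: "c \<in> verma_kernel \<Longrightarrow> c \<in> carrier verma_pairs"
    and verma_kernel_zero: "0 \<in> verma_kernel"
    and verma_kernel_add: "c \<in> verma_kernel \<Longrightarrow> d \<in> verma_kernel \<Longrightarrow> c + d \<in> verma_kernel"
    and verma_kernel_minus: "c \<in> verma_kernel \<Longrightarrow> - c \<in> verma_kernel"
    and verma_kernel_diff: "c \<in> verma_kernel \<Longrightarrow> d \<in> verma_kernel \<Longrightarrow> c - d \<in> verma_kernel"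
proof -
  show car: "c \<in> carrier verma_pairs" if "c \<in> verma_kernel" for c
    using subgroup.mem_carrier[OF subgroup_verma_kernel that] by simp
  show "0 \<in> verma_kernel" using subgroup.one_closed[OF subgroup_verma_kernel] by simp
  show add: "c + d \<in> verma_kernel" if "c \<in> verma_kernel" "d \<in> verma_kernel" for c d
    using subgroup.m_closed[OF subgroup_verma_kernel that] by simp
  show minus: "- c \<in> verma_kernel" if "c \<in> verma_kernel" for c
    using subgroup.m_inv_closed[OF subgroup_verma_kernel that] a_inv_free_pairs[OF car[OF that]]
    by (simp add: a_inv_def)
  show "c - d \<in> verma_kernel" if "c \<in> verma_kernel" "d \<in> verma_kernel" for c d
    using add[OF that(1) minus[OF that(2)]] by simp
qed

lemma tensor_add_left: "frag_of (cls a (p + q), n) - frag_of (cls a p, n) - frag_of (cls a q, n) \<in> verma_kernel"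
proof (rule verma_kernel_relations)
  show "frag_of (cls a (p + q), n) - frag_of (cls a p, n) - frag_of (cls a q, n)
      \<in> tensor_relations (alg a) fun_ring (fun_incl a) (point_module 1)"
    unfolding tensor_relations_def
    by (intro UnI1 CollectI exI[of _ "cls a p"] exI[of _ "cls a q"] exI[of _ n]) simp
qed

lemma tensor_add_right: "frag_of (cls a p, n + n') - frag_of (cls a p, n) - frag_of (cls a p, n') \<in> verma_kernel"
proof (rule verma_kernel_relations)
  show "frag_of (cls a p, n + n') - frag_of (cls a p, n) - frag_of (cls a p, n')
      \<in> tensor_relations (alg a) fun_ring (fun_incl a) (point_module 1)"
    unfolding tensor_relations_def
    by (rule UnI1, rule UnI2)
      (intro CollectI exI[of _ "cls a p"] exI[of _ n] exI[of _ n'], simp)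
qed

lemma tensor_balanced: "frag_of (cls a (p * fun_elt f), n) - frag_of (cls a p, f 1 * n) \<in> verma_kernel"
proof (rule verma_kernel_relations)
  show "frag_of (cls a (p * fun_elt f), n) - frag_of (cls a p, f 1 * n)
      \<in> tensor_relations (alg a) fun_ring (fun_incl a) (point_module 1)"
    unfolding tensor_relations_def
    by (intro UnI2 CollectI exI[of _ "cls a p"] exI[of _ f] exI[of _ n]) (simp add: fun_incl_def)
qed

text \<open>Left multiplication of first entries turns each tensor relation into one of the same
  kind. Hence \<open>verma_ann\<close> is a left ideal.\<close>

lemma verma_kernel_smult:
  assumes "c \<in> verma_kernel"
  shows "frag_extend (\<lambda>(t, n). frag_of (cls a p \<otimes>\<^bsub>alg a\<^esub> t, n)) c \<in> verma_kernel" (is "?F c \<in> verma_kernel")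
proof -
  have rel: "?F c \<in> verma_kernel" if "c \<in> tensor_relations (alg a) fun_ring (fun_incl a) (point_module 1)" for c
    using that
    by (auto simp: tensor_relations_def frag_extend_diff fun_incl_def distrib_left mult.assoc[symmetric]
        tensor_add_left tensor_add_right tensor_balanced)
  show ?thesis
    using assms[unfolded tensor_kernel_def]
  proof (induct rule: generate.induct)
    case one
    show ?case by (simp add: verma_kernel_zero)
  next
    case (incl h)
    then show ?case by (rule rel)
  next
    case (inv h)
    then have "h \<in> carrier verma_pairs" using relations_carrier by blast
    then have "inv\<^bsub>add_monoid verma_pairs\<^esub> h = - h"
      unfolding a_inv_def[symmetric] by (rule a_inv_free_pairs)
    then show ?case using verma_kernel_minus[OF rel[OF inv]] by (simp only: frag_extend_minus)
  next
    case (eng h1 h2)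
    then show ?case using verma_kernel_add by (simp add: frag_extend_add)
  qed
qed

text \<open>The annihilator of \<open>1 \<otimes> 1\<close>. Every tensor will turn out to be some
  \<open>p \<otimes> 1\<close>, so the Verma module is the free algebra modulo this left
  ideal.\<close>

definition "verma_ann = {p. frag_of (cls a p, 1 :: 'k) \<in> verma_kernel}"

text \<open>Additivity at \<open>0 + 0\<close> is itself the relation
  \<open>-(0 \<otimes> 1)\<close>.\<close>

lemma verma_ann_zero: "0 \<in> verma_ann"
  using verma_kernel_minus[OF tensor_add_left[of 0 0 1]] by (simp add: verma_ann_def)

lemma verma_ann_add:
  assumes "p \<in> verma_ann" "q \<in> verma_ann"
  shows "p + q \<in> verma_ann"
proof -
  have "(frag_of (cls a (p + q), 1) - frag_of (cls a p, 1) - frag_of (cls a q, 1))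
      + frag_of (cls a p, 1) + frag_of (cls a q, 1) \<in> verma_kernel"
    using assms by (intro verma_kernel_add tensor_add_left) (simp_all add: verma_ann_def)
  then show ?thesis by (simp add: verma_ann_def)
qed

lemma verma_ann_mult:
  assumes "p \<in> verma_ann"
  shows "q * p \<in> verma_ann"
  using verma_kernel_smult[of "frag_of (cls a p, 1)" q] assms by (simp add: verma_ann_def)

lemma rel_ideal_verma_ann:
  assumes "p \<in> rel_ideal a"
  shows "p \<in> verma_ann"
proof -
  have "cls a p = cls a 0" using assms by (simp add: cls_eq_iff)
  then show ?thesis using verma_ann_zero by (simp add: verma_ann_def)
qed

text \<open>Balancing moves the characteristic function of \<open>g\<close> across the tensor sign,
  where it acts by its value at \<open>1\<close>. So \<open>1 \<otimes> 1\<close> has weight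
  \<open>e\<close>.\<close>

lemma Delta_verma_ann: "dgen g - (if g = 1 then 1 else 0) \<in> verma_ann"
proof -
  have d: "fun_elt (\<lambda>h. if h = g then 1 else 0) = (dgen g :: 'k free_alg)"
    using finite_s3 by (simp add: fun_elt_def if_distrib cong: if_cong)
  have 1: "frag_of (cls a (dgen g), 1) - frag_of (cls a 1, if 1 = g then 1 else 0) \<in> verma_kernel"
    using tensor_balanced[of 1 "\<lambda>h. if h = g then 1 else 0" 1] by (simp add: d)
  show ?thesis
  proof (cases "g = 1")
    case True
    have "(frag_of (cls a (dgen g), 1) - frag_of (cls a 1, 1))
        - (frag_of (cls a (dgen g - 1 + 1), 1) - frag_of (cls a (dgen g - 1), 1) - frag_of (cls a 1, 1)) \<in> verma_kernel"
      using 1 True by (intro verma_kernel_diff[OF _ tensor_add_left]) simp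
    then show ?thesis using True by (simp add: verma_ann_def)
  next
    case False
    have "frag_of (cls a 1, 0) \<in> verma_kernel" using verma_kernel_minus[OF tensor_add_right[of 1 0 0]] by simp
    from verma_kernel_add[OF 1[unfolded if_not_P[OF False[symmetric]]] this] show ?thesis using False by (simp add: verma_ann_def)
  qed
qed

text \<open>A scalar \<open>n\<close> in the second entry is the action of the constant function
  \<open>n\<close> on \<open>1\<close>, and balancing moves that function into the first
  entry.\<close>

lemma verma_pairs_reduce:
  assumes "c \<in> carrier verma_pairs"
  obtains p where "c - frag_of (cls a p, 1) \<in> verma_kernel"
proof -
  have "\<exists>p. c - frag_of (cls a p, 1) \<in> verma_kernel"
    using assms[simplified]
  proof (induct c rule: frag_induction)
    case zero
    show ?case using verma_ann_zero verma_kernel_minus by (intro exI[of _ 0]) (simp add: verma_ann_def)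
  next
    case (one x)
    then obtain q n where x: "x = (cls a q, n)" by auto
    show ?case
      using verma_kernel_minus[OF tensor_balanced[of q "\<lambda>_. n" 1]] unfolding x by (intro exI[of _ "q * fun_elt (\<lambda>_. n)"]) simp
  next
    case (diff c d)
    then obtain p q where pq: "c - frag_of (cls a p, 1) \<in> verma_kernel" "d - frag_of (cls a q, 1) \<in> verma_kernel" by auto
    have "(c - frag_of (cls a p, 1)) - (d - frag_of (cls a q, 1)) +
        (frag_of (cls a (p - q + q), 1) - frag_of (cls a (p - q), 1) - frag_of (cls a q, 1)) \<in> verma_kernel"
      by (rule verma_kernel_add[OF verma_kernel_diff[OF pq] tensor_add_left])
    then have "(c - d) - frag_of (cls a (p - q), 1) \<in> verma_kernel" by (simp add: algebra_simps)
    then show ?case by blast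
  qed
  then show ?thesis using that by blast
qed

text \<open>A linear retraction onto a complement of the left ideal \<open>verma_ann\<close> turns congruences modulo
  \<open>verma_ann\<close> into equations.\<close>

lemma act_model_one_eq_0:
  assumes generic: "generic a" and p: "word_act mscale (model_act a) p model_one = 0"
  shows "p \<in> verma_ann"
proof -
  interpret M: free_rep mscale "model_act a" by (rule free_rep_model)
  define sc :: "'k \<Rightarrow> 'k free_alg \<Rightarrow> 'k free_alg" where "sc c p = Poly_Mapping.single [] c * p" for c p
  have one: "Poly_Mapping.single [] (1::'k) = 1" by (simp flip: single_one add: zero_list_def)
  interpret S: vector_space sc
    by unfold_locales
      (simp_all add: sc_def distrib_left distrib_right mult.assoc[symmetric] mult_single plus_list_def
        one single_add)
  have sub: "S.subspace verma_ann"
    by (rule S.subspaceI) (auto simp: verma_ann_zero verma_ann_add verma_ann_mult sc_def)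
  obtain \<pi> where lin: "Vector_Spaces.linear sc sc \<pi>"
    and \<pi>0: "\<And>x. \<pi> x = 0 \<longleftrightarrow> x \<in> verma_ann" and \<pi>d: "\<And>x. x - \<pi> x \<in> verma_ann"
    using S.subspace_projection[OF sub] by metis
  interpret \<pi>: Vector_Spaces.linear sc sc \<pi> by (rule lin)
  have \<pi>_eq: "\<pi> x = \<pi> y" if "x - y \<in> verma_ann" for x y
    using that \<pi>0[of "x - y"] by (simp add: \<pi>.diff)
  \<comment> \<open>As \<open>verma_ann\<close> is a left ideal, an inner projection may be dropped,
    so a word in the operators \<open>\<sigma>\<close> is the projection of a product in the free
    algebra.\<close>
  have \<pi>_mult: "\<pi> (u * \<pi> x) = \<pi> (u * x)" for u x
    using \<pi>_eq[of "u * x" "u * \<pi> x"] verma_ann_mult[OF \<pi>d, of u x] by (simp add: right_diff_distrib)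
  \<comment> \<open>The relations must hold as identities of operators, hence after multiplication
    by any \<open>x\<close> on the right; this stays in the two-sided ideal, which lies in
    \<open>verma_ann\<close>.\<close>
  have rel: "\<pi> (r * x) = 0" if "r \<in> relations a" for r x
    using rel_ideal_verma_ann[OF rel_ideal_mult_right[OF relations_rel_ideal[OF that]]] by (simp add: \<pi>0)
  define \<sigma> where "\<sigma> y x = \<pi> (Poly_Mapping.single [y] 1 * x)" for y x
  have \<sigma>2: "\<sigma> y (\<sigma> z x) = \<pi> (Poly_Mapping.single [y] 1 * Poly_Mapping.single [z] 1 * x)" for y z x
    by (simp add: \<sigma>_def \<pi>_mult mult.assoc)
  interpret V: verma_vector sc \<sigma> a "\<pi> 1"
  proof
    show "\<sigma> y (x + x') = \<sigma> y x + \<sigma> y x'" for y x x'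
      by (simp add: \<sigma>_def distrib_left \<pi>.add)
    show "\<sigma> y (sc c x) = sc c (\<sigma> y x)" for y c x
    proof -
      have "Poly_Mapping.single [y] 1 * sc c x = sc c (Poly_Mapping.single [y] 1 * x)"
        by (simp add: sc_def mult.assoc[symmetric] mult_single plus_list_def)
      then show ?thesis by (simp add: \<sigma>_def \<pi>.scale)
    qed
    show "generic a" by fact
    show "\<sigma> (Delta h) (\<sigma> (Xvar t) x) = \<sigma> (Xvar t) (\<sigma> (Delta (Rep_transp t * h)) x)" for h t x
    proof -
      have "dgen h * xgen t - xgen t * dgen (Rep_transp t * h) \<in> relations a"
        by (auto simp: relations_def)
      from rel[OF this, of x] show ?thesis by (simp add: \<sigma>2 left_diff_distrib \<pi>.diff)
    qed
    show "\<sigma> (Xvar t) (\<sigma> (Xvar t) x) = (\<Sum>g\<in>UNIV. sc (f_fun a t g) (\<sigma> (Delta g) x))" for t x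
    proof -
      have "xgen t * xgen t - fun_elt (f_fun a t) \<in> relations a"
        by (auto simp: relations_def)
      from rel[OF this, of x] have "\<sigma> (Xvar t) (\<sigma> (Xvar t) x) = \<pi> (fun_elt (f_fun a t) * x)"
        by (simp add: \<sigma>2 left_diff_distrib \<pi>.diff)
      also have "fun_elt (f_fun a t) * x = (\<Sum>g\<in>UNIV. sc (f_fun a t g) (dgen g * x))"
        by (simp add: fun_elt_def sum_distrib_right sc_def mult.assoc[symmetric] mult_single plus_list_def)
      also have "\<pi> \<dots> = (\<Sum>g\<in>UNIV. sc (f_fun a t g) (\<sigma> (Delta g) x))"
        by (simp add: \<pi>.sum \<pi>.scale \<sigma>_def)
      finally show ?thesis .
    qed
    show "\<sigma> (Xvar t13) (\<sigma> (Xvar t23) x) + \<sigma> (Xvar t23) (\<sigma> (Xvar t12) x) +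
      \<sigma> (Xvar t12) (\<sigma> (Xvar t13) x) = 0" for x
    proof -
      have "xgen t13 * xgen t23 + xgen t23 * xgen t12 + xgen t12 * xgen t13 \<in> relations a"
        by (auto simp: relations_def)
      from rel[OF this, of x] show ?thesis by (simp add: \<sigma>2 distrib_right \<pi>.add)
    qed
    show "\<sigma> (Xvar t23) (\<sigma> (Xvar t13) x) + \<sigma> (Xvar t13) (\<sigma> (Xvar t12) x) +
      \<sigma> (Xvar t12) (\<sigma> (Xvar t23) x) = 0" for x
    proof -
      have "xgen t23 * xgen t13 + xgen t13 * xgen t12 + xgen t12 * xgen t23 \<in> relations a"
        by (auto simp: relations_def)
      from rel[OF this, of x] show ?thesis by (simp add: \<sigma>2 distrib_right \<pi>.add)
    qed
    show "\<sigma> (Delta h) (\<pi> 1) = (if h = 1 then \<pi> 1 else 0)" for h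
      using \<pi>_eq[OF Delta_verma_ann, of h] by (auto simp: \<sigma>_def \<pi>_mult \<pi>.zero)
  qed
  have word: "\<pi> (Poly_Mapping.single w 1) = V.Psi (foldr (model_act a) w model_one)" for w
  proof (induct w)
    case Nil
    show ?case by (simp add: one V.Psi_one)
  next
    case (Cons y w)
    have "\<pi> (Poly_Mapping.single (y # w) 1) = \<sigma> y (\<pi> (Poly_Mapping.single w 1))"
      by (simp add: \<sigma>_def \<pi>_mult mult_single plus_list_def)
    also have "\<dots> = V.Psi (model_act a y (foldr (model_act a) w model_one))"
      unfolding Cons by (cases y) (simp_all only: V.Psi_Delta V.Psi_Xvar)
    finally show ?case by simp
  qed
  \<comment> \<open>So the class of \<open>q\<close> modulo the left ideal depends only on the
    action of \<open>q\<close> on \<open>model_one\<close>.\<close>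
  have "\<pi> q = V.Psi (M.act q model_one)" for q
  proof (induct q rule: free_alg_induct)
    case (single w c)
    have "Poly_Mapping.single w c = sc c (Poly_Mapping.single w 1)"
      by (simp add: sc_def mult_single plus_list_def)
    then have "\<pi> (Poly_Mapping.single w c) = sc c (\<pi> (Poly_Mapping.single w 1))"
      by (simp only: \<pi>.scale)
    then show ?case by (simp add: word V.Psi_scale)
  next
    case (add p q)
    then show ?case by (simp only: \<pi>.add M.act_add V.Psi_add)
  qed
  from this[of p] have "\<pi> p = V.Psi 0" by (simp only: p)
  also have "\<dots> = 0" by (simp add: V.Psi_def)
  finally have "\<pi> p = 0" .
  then show ?thesis by (simp add: \<pi>0)
qed

text \<open>The map sends \<open>p \<otimes> n\<close> to \<open>n\<close> times \<open>p\<close>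
  applied to \<open>model_one\<close>. A tensor in its kernel reduces to some
  \<open>p \<otimes> 1\<close> with \<open>p\<close> killing \<open>model_one\<close>, and is zero
  by \<open>act_model_one_eq_0\<close>. Values on pure tensors are recorded so that
  \<open>m_top\<close> can be located.\<close>

lemma verma_iso:
  assumes generic: "generic a"
  obtains \<Phi> where "is_module_iso (alg a) (verma a 1) (rep_module mscale (model_act a) UNIV) \<Phi>"
    "\<And>p. pure_tensor (alg a) fun_ring (fun_incl a) (point_module 1) (cls a p) 1 \<in> carrier (verma a 1)"
    "\<And>p. \<Phi> (pure_tensor (alg a) fun_ring (fun_incl a) (point_module 1) (cls a p) 1) =
      word_act mscale (model_act a) p model_one"
proof -
  interpret M: alg_rep mscale "model_act a" a UNIV by (rule alg_rep_model[OF generic])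
  define f where "f = (\<lambda>(r, n). r \<odot>\<^bsub>M.Rep\<^esub> mscale n model_one)"
  define ev where "ev = frag_eval mscale f"
  have f: "f (cls a p, n) = M.act p (mscale n model_one)" for p n
    by (simp add: f_def)
  have ev [simp]: "ev 0 = 0" "ev (frag_of x) = f x" "ev (c + d) = ev c + ev d" "ev (c - d) = ev c - ev d"
    "ev (- c) = - ev c" for x c d
    using M.frag_eval_diff[of f 0 c] by (simp_all add: ev_def M.frag_eval_add M.frag_eval_diff)
  have one: "mscale 1 model_one = (model_one :: s3 \<Rightarrow> bool \<Rightarrow> 'k)" by (simp add: mscale_def)
  \<comment> \<open>Balancing holds in the model because \<open>model_one\<close> has weight
    \<open>e\<close>.\<close>
  have fun_act: "M.act (fun_elt g) (mscale n model_one) = mscale (g 1 * n) model_one" for g n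
  proof (intro ext)
    fix h b
    have "(\<Sum>k\<in>UNIV. mscale (g k) (model_act a (Delta k) (mscale n model_one)) h b) =
        (\<Sum>k\<in>UNIV. if k = h then g h * (n * model_one h b) else 0)"
      by (intro sum.cong) (auto simp: mscale_def)
    then show "M.act (fun_elt g) (mscale n model_one) h b = mscale (g 1 * n) model_one h b"
      by (simp add: fun_elt_act[OF M.free_rep_axioms] sum_fun_apply finite_s3)
        (simp add: mscale_def model_one_def)
  qed
  have ev_rel: "ev c = 0" if "c \<in> tensor_relations (alg a) fun_ring (fun_incl a) (point_module 1)" for c
    using that unfolding tensor_relations_def
    by (auto simp: f fun_incl_def M.act_add M.act_add_right M.act_mult fun_act M.scale_left_distrib)
  have ev_kernel: "ev c = 0" if c: "c \<in> verma_kernel" for c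
    using c[unfolded tensor_kernel_def]
  proof (induct rule: generate.induct)
    case (inv h)
    then have "h \<in> carrier verma_pairs" using relations_carrier by blast
    then have "inv\<^bsub>add_monoid verma_pairs\<^esub> h = - h"
      unfolding a_inv_def[symmetric] by (rule a_inv_free_pairs)
    then show ?case using ev_rel[OF inv] by simp
  qed (simp_all add: ev_rel)
  have kernel: "verma_kernel = {c \<in> carrier verma_pairs. ev c = \<zero>\<^bsub>M.Rep\<^esub>}"
  proof (intro equalityI subsetI)
    fix c assume "c \<in> {c \<in> carrier verma_pairs. ev c = \<zero>\<^bsub>M.Rep\<^esub>}"
    then have c: "c \<in> carrier verma_pairs" "ev c = 0" by simp_all
    obtain p where p: "c - frag_of (cls a p, 1) \<in> verma_kernel" by (rule verma_pairs_reduce[OF c(1)])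
    have "M.act p model_one = 0" using ev_kernel[OF p] c by (simp add: f one)
    then have "p \<in> verma_ann" by (rule act_model_one_eq_0[OF generic])
    then show "c \<in> verma_kernel" using verma_kernel_add[OF p, of "frag_of (cls a p, 1)"] by (simp add: verma_ann_def)
  qed (use verma_kernel_carrier ev_kernel in simp)
  have gen: "frag_of (cls a p, 1) \<in> carrier verma_pairs" for p by simp
  obtain \<psi> where \<psi>: "is_module_iso (alg a) (quot_module verma_pairs verma_kernel) M.Rep \<psi>"
    "\<And>c. c \<in> carrier verma_pairs \<Longrightarrow> \<psi> (verma_kernel +>\<^bsub>verma_pairs\<^esub> c) = ev c"
  proof (rule quot_module_iso[OF M.left_module_rep abelian_group_free_pairs _ _ _ _ kernel])
    show "r \<odot>\<^bsub>verma_pairs\<^esub> c \<in> carrier verma_pairs" if "r \<in> carrier (alg a)" "c \<in> carrier verma_pairs" for r c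
    proof -
      from that(1) obtain p where p: "r = cls a p" by auto
      have "Poly_Mapping.keys (case x of (t, n) \<Rightarrow> frag_of (r \<otimes>\<^bsub>alg a\<^esub> t, n)) \<subseteq> carrier (alg a) \<times> UNIV"
        if "x \<in> Poly_Mapping.keys c" for x
        using that \<open>c \<in> carrier verma_pairs\<close> p by (auto split: prod.splits dest!: subsetD)
      then show ?thesis using keys_frag_extend by fastforce
    qed
    show "ev (r \<odot>\<^bsub>verma_pairs\<^esub> c) = r \<odot>\<^bsub>M.Rep\<^esub> ev c" if "r \<in> carrier (alg a)" and c: "c \<in> carrier verma_pairs" for r c
    proof -
      from that(1) obtain p where p: "r = cls a p" by auto
      have "ev (frag_extend (\<lambda>(t, n). frag_of (r \<otimes>\<^bsub>alg a\<^esub> t, n)) c) = M.act p (ev c)"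
        using c[simplified]
      proof (induct c rule: frag_induction)
        case (one x)
        then show ?case by (auto simp: p f M.act_mult)
      next
        case (diff c d)
        have "M.act p (x - y) = M.act p x - M.act p y" for x y
          using M.act_add_right[of p "x - y" y] by (metis diff_add_cancel add_diff_cancel_right')
        with diff show ?case by (simp only: frag_extend_diff ev)
      qed (simp only: frag_extend_0 ev M.act_zero_right)
      then show ?thesis by (simp add: p)
    qed
    show "ev ` carrier verma_pairs = carrier M.Rep"
    proof -
      have "v \<in> ev ` carrier verma_pairs" for v
      proof -
        obtain p where p: "M.act p model_one = v" by (rule model_one_generates[OF generic])
        then have "v = ev (frag_of (cls a p, 1))" by (simp add: f one)
        then show ?thesis using gen by blast
      qed
      then show ?thesis by auto
    qed
  qed (simp, rule that)
  show ?thesis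
  proof (rule that)
    show "is_module_iso (alg a) (verma a 1) M.Rep \<psi>"
      using \<psi>(1) by (simp add: verma_def extend_scalars_def)
    show "pure_tensor (alg a) fun_ring (fun_incl a) (point_module 1) (cls a p) 1 \<in> carrier (verma a 1)" for p
      using gen[of p] unfolding pure_tensor_def verma_def extend_scalars_def quot_module_def A_RCOSETS_def' by auto
    show "\<psi> (pure_tensor (alg a) fun_ring (fun_incl a) (point_module 1) (cls a p) 1) = M.act p model_one" for p
      unfolding pure_tensor_def using \<psi>(2)[OF gen[of p]] by (simp add: f one)
  qed
qed

end

section \<open>The quotients\<close>

lemma free_rep_L: "free_rep (\<lambda>b c g. b * c g) (L_act a)"
proof
  show "L_act a x (v + w) = L_act a x v + L_act a x w" for x v w
    by (cases x) (auto simp: fun_eq_iff sum_fun_apply algebra_simps sum.distrib)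
  show "L_act a x (\<lambda>g. c * v g) = (\<lambda>g. c * L_act a x v g)" for x c v
    by (cases x) (auto simp: fun_eq_iff sum_fun_apply sum_distrib_left algebra_simps)
qed (auto simp: fun_eq_iff algebra_simps)

lemma f_fun_transp: "f_fun a t (Rep_transp t) = 0"
  using transp_cases[of t] by (auto simp: f_fun_def)

lemma sign_transp: "sign (Perm.apply (Rep_transp t)) = -1"
  using transp_cases[of t] by auto

text \<open>The action on \<open>L\<close> in the form used for \<open>model_act\<close>, by its
  value at a target weight.\<close>

lemma L_act_Xvar:
  "L_act a (Xvar t) c h = (if Rep_transp t * h = 1 then 0
    else c (Rep_transp t * h) * (if sign (Perm.apply (Rep_transp t * h)) = 1 then 1
      else f_fun a t (Rep_transp t * h)))"
proof -
  define k where "k = Rep_transp t * h"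
  define F where "F g = c g * (if sign (Perm.apply g) = 1 then 1 else f_fun a t g)" for g
  have eq: "h = Rep_transp t * g \<longleftrightarrow> g = k" for g
    unfolding k_def by (metis Rep_transp_cancel)
  have "L_act a (Xvar t) c h = (\<Sum>g\<in>UNIV - {1}. if g = k then F k else 0)"
    unfolding L_act.simps sum_fun_apply
    by (intro sum.cong) (simp_all add: basis_vec_def eq F_def)
  also have "\<dots> = (if k = 1 then 0 else F k)"
    using finite_s3 by simp
  finally show ?thesis by (simp only: F_def k_def)
qed

text \<open>The pairing with \<open>l\<close> is an intertwiner from \<open>midset\<close> to \<open>L\<close> because the model
  acts on \<open>midset\<close> modulo \<open>topset\<close> as on two copies of \<open>L\<close>.\<close>

definition pairing :: "(bool \<Rightarrow> 'k::field) \<Rightarrow> (s3 \<Rightarrow> bool \<Rightarrow> 'k) \<Rightarrow> s3 \<Rightarrow> 'k" where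
  "pairing l v g = (if g = 1 then 0 else det2 l (v g))"

lemma pairing_add: "pairing l (u + v) = pairing l u + pairing l v"
  by (auto simp: pairing_def fun_eq_iff det2_add)

lemma pairing_scale: "pairing l (mscale c v) = (\<lambda>g. c * pairing l v g)"
  by (auto simp: pairing_def fun_eq_iff mscale_def det2_scale)

text \<open>Only the targets \<open>1\<close> and \<open>t\<close> differ from copies of
  \<open>L\<close>. At \<open>1\<close> the pairing discards the top vector and \<open>L\<close> has
  the coefficient \<open>f_fun a t t = 0\<close>; at \<open>t\<close> the model has only the
  contribution of the generator, absent from \<open>midset\<close>, and \<open>L\<close> has
  none.\<close>

lemma pairing_act:
  assumes "v \<in> midset"
  shows "pairing l (model_act a x v) = L_act a x (pairing l v)"
proof (cases x)
  case (Delta h)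
  then show ?thesis by (auto simp: pairing_def fun_eq_iff)
next
  case (Xvar t)
  have t1: "Rep_transp t * h = 1 \<longleftrightarrow> h = Rep_transp t" for h
    by (metis Rep_transp_cancel Rep_transp_square)
  have th: "Rep_transp t * h = Rep_transp t \<longleftrightarrow> h = 1" for h
    by (metis Rep_transp_cancel mult_1_right)
  have "pairing l (model_act a x v) h = L_act a x (pairing l v) h" for h
    using assms unfolding Xvar L_act_Xvar
    by (auto simp: pairing_def t1 th midset_def det2_scale f_fun_transp sign_transp)
  then show ?thesis by (intro ext)
qed

lemma pairing_image:
  assumes "det2 l w = 1" "\<And>c. c 1 = 0 \<Longrightarrow> (\<lambda>g b. c g * w b) \<in> U"
  shows "pairing l ` U = {c. c 1 = 0}"
proof (intro equalityI subsetI)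
  fix c :: "s3 \<Rightarrow> 'a" assume "c \<in> {c. c 1 = 0}"
  then have c: "c 1 = 0" by simp
  then have "c = pairing l (\<lambda>g b. c g * w b)"
    using assms(1) by (auto simp: pairing_def fun_eq_iff det2_scale)
  then show "c \<in> pairing l ` U" using assms(2)[of c] c by (intro image_eqI)
qed (auto simp: pairing_def)

lemma free_rep_k_e: "free_rep ((*) :: 'k::field \<Rightarrow> 'k \<Rightarrow> 'k) k_e_act"
proof
  show "k_e_act x (v + w) = k_e_act x v + k_e_act x w" for x and v w :: 'k by (cases x) simp_all
  show "k_e_act x (c * v) = c * k_e_act x v" for x and c v :: 'k by (cases x) simp_all
qed (simp_all add: algebra_simps)

lemma supp_at_lineset: "g \<noteq> 1 \<Longrightarrow> supp_at g w \<in> lineset w"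
  by (auto simp: lineset_def supp_at_apply det2_def)

lemma lineset_midset: "lineset w \<subseteq> midset"
  by (auto simp: lineset_def midset_def)

lemma topset_lineset: "topset \<subset> lineset w" if "w \<noteq> 0"
proof -
  have "supp_at c3 w \<notin> topset" using that by (auto simp: topset_def supp_at_apply fun_eq_iff)
  moreover have "topset \<subseteq> lineset w" by (auto simp: topset_def lineset_def)
  ultimately show ?thesis using supp_at_lineset[of c3 w] by auto
qed

lemma lineset_psubset_midset: "lineset w \<subset> midset" if w: "w \<noteq> 0"
proof -
  obtain u where "det2 w u = 1" by (rule det2_nondegenerate[OF w])
  then have "supp_at c3 u \<notin> lineset w" by (auto simp: lineset_def supp_at_apply)
  moreover have "supp_at c3 u \<in> midset" by (simp add: midset_def supp_at_def)
  ultimately show ?thesis using lineset_midset by blast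
qed

lemma midset_psubset_UNIV: "midset \<subset> (UNIV :: (s3 \<Rightarrow> bool \<Rightarrow> 'k::field) set)"
proof -
  have "model_one \<notin> (midset :: (s3 \<Rightarrow> bool \<Rightarrow> 'k) set)" by (simp add: midset_def model_one_def)
  then show ?thesis by blast
qed

lemma topset_eq: "topset = range (\<lambda>c. mscale c (supp_at 1 (\<lambda>b. - of_bool (\<not> b))))"
proof (intro equalityI subsetI)
  fix v :: "s3 \<Rightarrow> bool \<Rightarrow> 'a" assume v: "v \<in> topset"
  have "v g b = mscale (- v 1 False) (supp_at 1 (\<lambda>b. - of_bool (\<not> b))) g b" for g b
    using v by (cases "g = 1"; cases b) (auto simp: topset_def mscale_def supp_at_def)
  then have "v = mscale (- v 1 False) (supp_at 1 (\<lambda>b. - of_bool (\<not> b)))" by (intro ext)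
  then show "v \<in> range (\<lambda>c. mscale c (supp_at 1 (\<lambda>b. - of_bool (\<not> b))))" by (rule range_eqI)
qed (auto simp: topset_def mscale_def supp_at_def fun_eq_iff)

lemma range_Delta:
  fixes a :: "transp \<Rightarrow> 'k::field"
  shows "range (model_act a (Delta g)) = range (supp_at g)"
proof (intro equalityI subsetI)
  fix v :: "s3 \<Rightarrow> bool \<Rightarrow> 'k" assume "v \<in> range (supp_at g)"
  then obtain w where "v = supp_at g w" by auto
  then have "v = model_act a (Delta g) v" by (simp add: supp_at_def fun_eq_iff)
  then show "v \<in> range (model_act a (Delta g))" by (metis rangeI)
qed (auto simp: Delta_supp_at simp del: model_act.simps)

lemma lineset_scale:
  assumes "w \<noteq> 0" "u \<noteq> 0"
  shows "lineset u = lineset w \<longleftrightarrow> (\<exists>c. u = (\<lambda>b. c * w b))"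
proof
  assume "lineset u = lineset w"
  then have "supp_at c3 u \<in> lineset w" using supp_at_lineset[of c3 u] by simp
  then have "det2 w u = 0" by (auto simp: lineset_def supp_at_apply dest: spec[of _ c3])
  then show "\<exists>c. u = (\<lambda>b. c * w b)" using det2_eq_0[OF assms(1)] by metis
next
  assume "\<exists>c. u = (\<lambda>b. c * w b)"
  then obtain c where c: "u = (\<lambda>b. c * w b)" by blast
  then have "c \<noteq> 0" using assms(2) by (auto simp: fun_eq_iff)
  moreover have "det2 u x = c * det2 w x" for x by (simp add: c det2_def algebra_simps)
  ultimately show "lineset u = lineset w" by (simp add: lineset_def)
qed

section \<open>The assertions about the Verma module read off from the model\<close>

locale verma_model =
  fixes a :: "transp \<Rightarrow> 'k::field" and \<Phi>
  assumes generic: "generic a"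
    and Phi: "is_module_iso (alg a) (verma a 1) (rep_module mscale (model_act a) UNIV) \<Phi>"
    and top_carrier: "m_top a 1 \<in> carrier (verma a 1)"
    and Phi_top: "\<Phi> (m_top a 1) = supp_at 1 (\<lambda>b. - of_bool (\<not> b))"
begin

abbreviation "P \<equiv> verma a 1"

sublocale module_model mscale "model_act a" a P \<Phi>
  using alg_rep_model[OF generic] Phi by (intro module_model.intro module_model_axioms.intro)

lemma lin_span_top: "lin_span a P {m_top a 1} = pull topset"
  by (simp add: lin_span_eq[OF top_carrier] Phi_top topset_eq)

lemma W_e_eq: "W_e a = pull (range (supp_at c3))"
proof -
  have "Rep_transp t13 * Rep_transp t23 = c3" by simp
  then show ?thesis by (simp only: W_e_def weight_space_eq range_Delta)
qed

lemma W_eE: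
  assumes "v \<in> W_e a - {\<zero>\<^bsub>P\<^esub>}"
  obtains w where "v \<in> carrier P" "\<Phi> v = supp_at c3 w" "w \<noteq> 0"
proof -
  from assms obtain w where w: "v \<in> carrier P" "\<Phi> v = supp_at c3 w" by (auto simp: W_e_eq pull_def)
  have "w \<noteq> 0"
  proof
    assume "w = 0"
    then have "\<Phi> v = 0" using w by (simp add: supp_at_def zero_fun_def)
    then show False using assms w(1) by (simp add: Phi_eq_zero)
  qed
  with w show ?thesis by (rule that)
qed

lemma W_eI:
  assumes "w \<noteq> 0"
  obtains v where "v \<in> W_e a - {\<zero>\<^bsub>P\<^esub>}" "v \<in> carrier P" "\<Phi> v = supp_at c3 w"
proof -
  obtain v where v: "v \<in> carrier P" "\<Phi> v = supp_at c3 w" by (rule Phi_surj)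
  have "supp_at c3 w \<noteq> 0" using assms by (auto simp: supp_at_def fun_eq_iff)
  then have "v \<noteq> \<zero>\<^bsub>P\<^esub>" using v by auto
  then show ?thesis using v by (intro that) (auto simp: W_e_eq pull_def)
qed

lemma alg_span_line:
  assumes v: "v \<in> carrier P" "\<Phi> v = supp_at c3 w" and w: "w \<noteq> 0"
  shows "alg_span a P {v} = pull (lineset w)"
proof (rule alg_span_eq)
  show "{v} \<subseteq> pull (lineset w)" using v supp_at_lineset[of c3 w] by (simp add: pull_def)
  show "stable (lineset w)" by (rule stable_lineset[OF generic])
  show "lineset w \<subseteq> U" if "stable U" "\<Phi> ` {v} \<subseteq> U" for U
    using that v w by (intro lineset_subset[OF generic that(1), of c3]) auto
qed

lemma N_e_eq: "N_e a = pull midset"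
  unfolding N_e_def
proof (rule alg_span_eq)
  show "W_e a \<subseteq> pull midset"
    unfolding W_e_eq pull_subset_iff by (auto simp: midset_def supp_at_def)
  show "stable midset" by (rule stable_midset[OF generic])
  show "midset \<subseteq> U" if "stable U" "\<Phi> ` W_e a \<subseteq> U" for U
  proof (rule midset_subset[OF generic that(1)])
    have "supp_at c3 w \<in> U" for w using that(2) by (auto simp: W_e_eq pull_image)
    then show "supp_at c3 (\<lambda>b. of_bool b) \<in> U" "supp_at c3 (\<lambda>b. of_bool (\<not> b)) \<in> U" by blast+
  qed (simp_all add: det2_def)
qed

text \<open>Under the isomorphism this is the decomposition of a function into its values; in weight
  \<open>e\<close> only the top component belongs to \<open>midset\<close>.\<close>

lemma direct_sum:
  "internal_direct_sum P
    (\<lambda>g. if g = 1 then lin_span a P {m_top a 1} else weight_space a P g) UNIV (N_e a)"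
proof -
  define piece :: "s3 \<Rightarrow> (s3 \<Rightarrow> bool \<Rightarrow> 'k) set"
    where "piece = (\<lambda>g. if g = 1 then topset else range (supp_at g))"
  define W where "W = (\<lambda>g. pull (piece g))"
  have W: "(\<lambda>g. if g = 1 then lin_span a P {m_top a 1} else weight_space a P g) = W"
    by (simp only: fun_eq_iff W_def piece_def lin_span_top weight_space_eq range_Delta) simp
  have piece: "v \<in> piece g \<longleftrightarrow> v = supp_at g (v g) \<and> (g = 1 \<longrightarrow> v 1 True = 0)" for v g
  proof (cases "g = 1")
    case True
    then show ?thesis by (auto simp: piece_def topset_def supp_at_apply fun_eq_iff)
  next
    case False
    then show ?thesis by (auto simp: piece_def supp_at_apply)
  qed
  \<comment> \<open>The summand with index \<open>g\<close> is supported in weight \<open>g\<close>,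
    so the value at \<open>h\<close> sees only the summand with index \<open>h\<close>.\<close>
  have eval: "\<Phi> (finsum P m UNIV) h = \<Phi> (m h) h" if m: "\<And>g. m g \<in> W g" for m h
  proof -
    have "m \<in> UNIV \<rightarrow> carrier P" using m by (auto simp: W_def pull_def)
    then have "\<Phi> (finsum P m UNIV) h = (\<Sum>g\<in>UNIV. \<Phi> (m g) h)"
      by (simp add: Phi_finsum sum_fun_apply)
    also have "\<dots> = (\<Sum>g\<in>UNIV. if g = h then \<Phi> (m h) h else 0)"
    proof (rule sum.cong)
      show "\<Phi> (m g) h = (if g = h then \<Phi> (m h) h else 0)" for g
      proof -
        have "\<Phi> (m g) = supp_at g (\<Phi> (m g) g)" using m[of g] piece by (simp add: W_def pull_def)
        then have "\<Phi> (m g) h = supp_at g (\<Phi> (m g) g) h" by simp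
        then show ?thesis by (auto simp: supp_at_apply zero_fun_def)
      qed
    qed simp
    also have "\<dots> = \<Phi> (m h) h" using finite_s3 by simp
    finally show ?thesis .
  qed
  have "bij_betw (\<lambda>m. finsum P m UNIV) (Pi\<^sub>E UNIV W) (pull midset)"
    unfolding bij_betw_def
  proof (intro conjI equalityI subsetI)
    show "inj_on (\<lambda>m. finsum P m UNIV) (Pi\<^sub>E UNIV W)"
    proof (rule inj_onI)
      fix m n assume mn: "m \<in> Pi\<^sub>E UNIV W" "n \<in> Pi\<^sub>E UNIV W" and eq: "finsum P m UNIV = finsum P n UNIV"
      show "m = n"
      proof
        fix g
        have m: "m g \<in> W g" "n g \<in> W g" using mn by auto
        have "\<Phi> (m g) g = \<Phi> (n g) g"
          using eval[of m g] eval[of n g] eq mn by (auto simp: PiE_iff)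
        moreover have "\<Phi> (m g) = supp_at g (\<Phi> (m g) g)" "\<Phi> (n g) = supp_at g (\<Phi> (n g) g)"
          using m piece by (simp_all add: W_def pull_def)
        ultimately have "\<Phi> (m g) = \<Phi> (n g)" by metis
        then show "m g = n g" using m Phi_inj by (simp add: W_def pull_def)
      qed
    qed
    fix x assume "x \<in> (\<lambda>m. finsum P m UNIV) ` Pi\<^sub>E UNIV W"
    then obtain m where m: "\<And>g. m g \<in> W g" and x: "x = finsum P m UNIV" by (auto simp: PiE_iff)
    have "x \<in> carrier P" unfolding x using m by (intro P.finsum_closed) (auto simp: W_def pull_def)
    moreover have "\<Phi> (m 1) 1 True = 0" using m[of 1] piece by (simp add: W_def pull_def)
    then have "\<Phi> x \<in> midset" using eval[OF m, of 1] by (simp add: x midset_def)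
    ultimately show "x \<in> pull midset" by (simp add: pull_def)
  next
    fix x assume x: "x \<in> pull midset"
    have "\<exists>y. y \<in> carrier P \<and> \<Phi> y = supp_at g (\<Phi> x g)" for g by (metis Phi_surj)
    then obtain m where m: "\<And>g. m g \<in> carrier P" "\<And>g. \<Phi> (m g) = supp_at g (\<Phi> x g)" by metis
    have mW: "m g \<in> W g" for g
      using m[of g] m[of 1] x piece[of "\<Phi> (m g)" g] by (simp add: W_def pull_def supp_at_apply midset_def)
    have "\<Phi> (finsum P m UNIV) = \<Phi> x"
      using eval[OF mW] m(2) by (simp add: fun_eq_iff supp_at_apply)
    moreover have "finsum P m UNIV \<in> carrier P" using m by (intro P.finsum_closed) auto
    ultimately have "x = finsum P m UNIV" using x Phi_inj by (simp add: pull_def)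
    then show "x \<in> (\<lambda>m. finsum P m UNIV) ` Pi\<^sub>E UNIV W" using mW by (auto simp: PiE_iff)
  qed
  moreover have "subgroup (W g) (add_monoid P)" for g
    unfolding W_def
  proof (rule subgroup_pull)
    show "0 \<in> piece g" by (simp add: piece) (simp add: supp_at_def zero_fun_def)
    have supp: "u h b = (if h = g then u g b else 0)" if "u \<in> piece g" for u h b
      using that[unfolded piece] by (metis supp_at_def)
    have suppI: "u \<in> piece g" if "\<And>h b. h \<noteq> g \<Longrightarrow> u h b = 0" "g = 1 \<Longrightarrow> u 1 True = 0" for u
      using that by (auto simp: piece supp_at_def fun_eq_iff)
    have piece': "u \<in> piece g \<longleftrightarrow> (\<forall>h b. h \<noteq> g \<longrightarrow> u h b = 0) \<and> (g = 1 \<longrightarrow> u 1 True = 0)" for u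
    proof
      assume u: "u \<in> piece g"
      then have "g = 1 \<longrightarrow> u 1 True = 0" unfolding piece by blast
      then show "(\<forall>h b. h \<noteq> g \<longrightarrow> u h b = 0) \<and> (g = 1 \<longrightarrow> u 1 True = 0)"
        using supp[OF u] by metis
    qed (use suppI in blast)
    show "u + v \<in> piece g" if "u \<in> piece g" "v \<in> piece g" for u v
      using that by (simp add: piece')
    show "- u \<in> piece g" if "u \<in> piece g" for u
      using that by (simp add: piece')
  qed
  ultimately show ?thesis
    unfolding internal_direct_sum_def N_e_eq W using finite_s3 by simp
qed

lemma submodules:
  "{H. submodule H (alg a) P \<and> H \<noteq> {\<zero>\<^bsub>P\<^esub>}} =
    {lin_span a P {m_top a 1}} \<union> {alg_span a P {v} | v. v \<in> W_e a - {\<zero>\<^bsub>P\<^esub>}} \<union> {N_e a, carrier P}"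
proof (intro equalityI subsetI)
  fix H assume "H \<in> {H. submodule H (alg a) P \<and> H \<noteq> {\<zero>\<^bsub>P\<^esub>}}"
  then obtain U where U: "stable U" "H = pull U" "U \<noteq> {0}"
    using submodule_iff pull_zero by (metis (mono_tags, lifting) mem_Collect_eq)
  from stable_classification[OF generic U(1)] U(3)
  consider "U = topset" | w where "w \<noteq> 0" "U = lineset w" | "U = midset" | "U = UNIV" by blast
  then show "H \<in> {lin_span a P {m_top a 1}} \<union> {alg_span a P {v} | v. v \<in> W_e a - {\<zero>\<^bsub>P\<^esub>}} \<union>
      {N_e a, carrier P}"
  proof cases
    case (2 w)
    then obtain v where "v \<in> W_e a - {\<zero>\<^bsub>P\<^esub>}" "v \<in> carrier P" "\<Phi> v = supp_at c3 w" by (elim W_eI)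
    then have "H = alg_span a P {v}" "v \<in> W_e a - {\<zero>\<^bsub>P\<^esub>}" using 2 U by (simp_all add: alg_span_line)
    then show ?thesis by blast
  qed (use U in \<open>simp_all add: lin_span_top N_e_eq pull_UNIV\<close>)
next
  have ne: "pull U \<noteq> {\<zero>\<^bsub>P\<^esub>}" if "topset \<subseteq> U" for U
  proof -
    have "supp_at 1 (\<lambda>b. - of_bool (\<not> b)) \<in> topset" by (simp add: topset_def supp_at_def fun_eq_iff)
    then have "supp_at 1 (\<lambda>b. - of_bool (\<not> b)) \<in> U" using that by blast
    moreover have "supp_at 1 (\<lambda>b. - of_bool (\<not> b)) \<noteq> (0 :: s3 \<Rightarrow> bool \<Rightarrow> 'k)"
      by (auto simp: supp_at_def fun_eq_iff)
    ultimately have "U \<noteq> {0}" by blast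
    then show ?thesis by (simp flip: pull_zero add: pull_eq_iff)
  qed
  have top_mid: "topset \<subseteq> (midset :: (s3 \<Rightarrow> bool \<Rightarrow> 'k) set)" by (auto simp: topset_def midset_def)
  fix H assume "H \<in> {lin_span a P {m_top a 1}} \<union> {alg_span a P {v} | v. v \<in> W_e a - {\<zero>\<^bsub>P\<^esub>}} \<union>
      {N_e a, carrier P}"
  then consider "H = pull topset" | v where "v \<in> W_e a - {\<zero>\<^bsub>P\<^esub>}" "H = alg_span a P {v}"
    | "H = pull midset" | "H = pull UNIV"
    by (auto simp: lin_span_top N_e_eq pull_UNIV)
  then have "\<exists>U. H = pull U \<and> stable U \<and> topset \<subseteq> U"
  proof cases
    case 1
    then show ?thesis using stable_topset[OF generic] by blast
  next
    case (2 v)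
    obtain w where w: "v \<in> carrier P" "\<Phi> v = supp_at c3 w" "w \<noteq> 0" by (rule W_eE[OF 2(1)])
    then show ?thesis
      using 2(2) alg_span_line[OF w] stable_lineset[OF generic, of w] topset_lineset[OF w(3)] by blast
  next
    case 3
    then show ?thesis using stable_midset[OF generic] top_mid by blast
  next
    case 4
    then show ?thesis using stable_UNIV by blast
  qed
  then obtain U where "H = pull U" "stable U" "topset \<subseteq> U" by blast
  then show "H \<in> {H. submodule H (alg a) P \<and> H \<noteq> {\<zero>\<^bsub>P\<^esub>}}"
    by (simp only: mem_Collect_eq submodule_pull ne) simp
qed

lemma chain:
  assumes "v \<in> W_e a - {\<zero>\<^bsub>P\<^esub>}"
  shows "lin_span a P {m_top a 1} \<subset> alg_span a P {v}" "alg_span a P {v} \<subset> N_e a" "N_e a \<subset> carrier P"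
proof -
  obtain w where w: "v \<in> carrier P" "\<Phi> v = supp_at c3 w" "w \<noteq> 0" by (rule W_eE[OF assms])
  note s = lin_span_top alg_span_line[OF w] N_e_eq pull_psubset_iff
  show "lin_span a P {m_top a 1} \<subset> alg_span a P {v}" unfolding s by (rule topset_lineset[OF w(3)])
  show "alg_span a P {v} \<subset> N_e a" unfolding s by (rule lineset_psubset_midset[OF w(3)])
  show "N_e a \<subset> carrier P" unfolding s pull_UNIV[symmetric] by (rule midset_psubset_UNIV)
qed

lemma coincide:
  assumes "u \<in> W_e a - {\<zero>\<^bsub>P\<^esub>}" "v \<in> W_e a - {\<zero>\<^bsub>P\<^esub>}"
  shows "alg_span a P {v} = alg_span a P {u} \<longleftrightarrow> v \<in> lin_span a P {u}"
proof -
  obtain w where w: "v \<in> carrier P" "\<Phi> v = supp_at c3 w" "w \<noteq> 0" by (rule W_eE[OF assms(2)])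
  obtain x where x: "u \<in> carrier P" "\<Phi> u = supp_at c3 x" "x \<noteq> 0" by (rule W_eE[OF assms(1)])
  have "supp_at c3 w = mscale c (supp_at c3 x) \<longleftrightarrow> w = (\<lambda>b. c * x b)" for c
    by (auto simp: supp_at_def mscale_def fun_eq_iff)
  then show ?thesis
    using w x by (auto simp: alg_span_line pull_eq_iff lineset_scale lin_span_eq pull_def[of "range _"])
qed

text \<open>The pairing with \<open>l\<close> maps \<open>U\<close> to \<open>L\<close>; since
  \<open>l\<close> takes the value one on \<open>w\<close>, the copy of \<open>L\<close> along
  \<open>w\<close> inside \<open>U\<close> makes this surjective.\<close>

lemma pairing_quotient:
  assumes U: "stable U" "U \<subseteq> midset" and w: "det2 l w = 1" "\<And>c. c 1 = 0 \<Longrightarrow> (\<lambda>g b. c g * w b) \<in> U"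
    and U': "U' = {u \<in> U. \<forall>g. g \<noteq> 1 \<longrightarrow> det2 l (u g) = 0}"
  shows "module_isomorphic (alg a) (quot_module (P\<lparr>carrier := pull U\<rparr>) (pull U')) (L_mod a)"
proof -
  have "module_isomorphic (alg a) (quot_module (P\<lparr>carrier := pull U\<rparr>) (pull U'))
      (rep_module (\<lambda>b c g. b * c g) (L_act a) (pairing l ` U))"
  proof (rule quot_pull_isomorphic[OF U(1) free_rep_L])
    show "pairing l (model_act a x v) = L_act a x (pairing l v)" if "v \<in> U" for x v
      using U(2) that by (intro pairing_act) blast
    show "U' = {u \<in> U. pairing l u = 0}"
      unfolding U' by (auto simp: pairing_def fun_eq_iff)
  qed (simp_all add: pairing_add pairing_scale)
  moreover have "pairing l ` U = {c. c 1 = 0}"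
    using w by (intro pairing_image)
  ultimately show ?thesis by (simp only: L_mod_def)
qed

lemma quotient_line_top:
  assumes "v \<in> W_e a - {\<zero>\<^bsub>P\<^esub>}"
  shows "module_isomorphic (alg a)
    (quot_module (P\<lparr>carrier := alg_span a P {v}\<rparr>) (lin_span a P {m_top a 1})) (L_mod a)"
proof -
  obtain w where w: "v \<in> carrier P" "\<Phi> v = supp_at c3 w" "w \<noteq> 0" by (rule W_eE[OF assms])
  obtain u where u: "det2 w u = 1" by (rule det2_nondegenerate[OF w(3)])
  \<comment> \<open>Within \<open>lineset w\<close> the pairing must detect multiples of
    \<open>w\<close>. Pairing with \<open>-u\<close> does so, and its common zeros with the pairing
    by \<open>w\<close> are zero because \<open>w\<close> and \<open>u\<close> are
    independent.\<close>
  have lw: "det2 (\<lambda>b. - u b) w = 1" using u by (simp add: det2_def algebra_simps)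
  have "topset = {x \<in> lineset w. \<forall>g. g \<noteq> 1 \<longrightarrow> det2 (\<lambda>b. - u b) (x g) = 0}"
  proof -
    have "y = 0" if "det2 w y = 0" "det2 (\<lambda>b. - u b) y = 0" for y
    proof -
      have "det2 y u = 0" using that(2) by (simp add: det2_def algebra_simps)
      then have "y b = 0" for b using det2_expand[of w u y b] u that(1) by simp
      then show ?thesis by (simp add: fun_eq_iff)
    qed
    then show ?thesis by (auto simp: topset_def lineset_def)
  qed
  then show ?thesis
    unfolding alg_span_line[OF w] lin_span_top
    by (intro pairing_quotient[OF stable_lineset[OF generic] lineset_midset lw])
      (auto simp: lineset_def det2_def)
qed

lemma quotient_N_line:
  assumes "v \<in> W_e a - {\<zero>\<^bsub>P\<^esub>}"
  shows "module_isomorphic (alg a) (quot_module (P\<lparr>carrier := N_e a\<rparr>) (alg_span a P {v})) (L_mod a)"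
proof -
  obtain w where w: "v \<in> carrier P" "\<Phi> v = supp_at c3 w" "w \<noteq> 0" by (rule W_eE[OF assms])
  obtain u where u: "det2 w u = 1" by (rule det2_nondegenerate[OF w(3)])
  \<comment> \<open>Pairing with \<open>w\<close> itself has kernel \<open>lineset w\<close> in
    \<open>midset\<close>, and \<open>u\<close> yields surjectivity.\<close>
  show ?thesis
    unfolding alg_span_line[OF w] N_e_eq
    by (rule pairing_quotient[OF stable_midset[OF generic] subset_refl u])
      (auto simp: lineset_def midset_def)
qed

lemma quotient_verma_N: "module_isomorphic (alg a) (quot_module P (N_e a)) k_e"
proof -
  have "module_isomorphic (alg a) (quot_module (P\<lparr>carrier := pull UNIV\<rparr>) (pull midset))
      (rep_module (*) k_e_act (range (\<lambda>v :: s3 \<Rightarrow> bool \<Rightarrow> 'k. v 1 True)))"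
  proof (rule quot_pull_isomorphic[where \<phi> = "\<lambda>v :: s3 \<Rightarrow> bool \<Rightarrow> 'k. v 1 True", OF stable_UNIV free_rep_k_e])
    show "model_act a x v 1 True = k_e_act x (v 1 True)" for x v by (cases x) auto
  qed (auto simp: midset_def mscale_def)
  moreover have "range (\<lambda>v :: s3 \<Rightarrow> bool \<Rightarrow> 'k. v 1 True) = UNIV"
    by (auto intro: range_eqI[of _ _ "\<lambda>g b. x" for x])
  ultimately show ?thesis by (simp add: k_e_def N_e_eq pull_UNIV)
qed

lemma top_k_e: "module_isomorphic (alg a) (P\<lparr>carrier := lin_span a P {m_top a 1}\<rparr>) k_e"
proof -
  have "module_isomorphic (alg a) (P\<lparr>carrier := pull topset\<rparr>)
      (rep_module (*) k_e_act ((\<lambda>v :: s3 \<Rightarrow> bool \<Rightarrow> 'k. v 1 False) ` topset))"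
  proof (rule pull_isomorphic[where \<phi> = "\<lambda>v :: s3 \<Rightarrow> bool \<Rightarrow> 'k. v 1 False", OF stable_topset[OF generic] free_rep_k_e])
    show "model_act a x v 1 False = k_e_act x (v 1 False)" if "v \<in> topset" for x v
      using that by (cases x) (auto simp: topset_def)
    show "inj_on (\<lambda>v :: s3 \<Rightarrow> bool \<Rightarrow> 'k. v 1 False) topset"
    proof (rule inj_onI)
      fix u v :: "s3 \<Rightarrow> bool \<Rightarrow> 'k"
      assume uv: "u \<in> topset" "v \<in> topset" "u 1 False = v 1 False"
      have "u g b = v g b" for g b using uv by (cases "g = 1"; cases b) (auto simp: topset_def)
      then show "u = v" by (intro ext)
    qed
  qed (auto simp: mscale_def)
  moreover have "(\<lambda>v :: s3 \<Rightarrow> bool \<Rightarrow> 'k. v 1 False) ` topset = UNIV"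
  proof -
    have "c \<in> (\<lambda>v :: s3 \<Rightarrow> bool \<Rightarrow> 'k. v 1 False) ` topset" for c
      by (rule image_eqI[of _ _ "supp_at 1 (\<lambda>b. c * of_bool (\<not> b))"]) (auto simp: topset_def supp_at_apply)
    then show ?thesis by blast
  qed
  ultimately show ?thesis by (simp add: k_e_def lin_span_top)
qed

end

lemma verma_model_exists:
  assumes generic: "generic a"
  shows "\<exists>\<Phi>. verma_model a \<Phi>"
proof -
  obtain \<Phi> where \<Phi>: "is_module_iso (alg a) (verma a 1) (rep_module mscale (model_act a) UNIV) \<Phi>"
    "\<And>p. pure_tensor (alg a) fun_ring (fun_incl a) (point_module 1) (cls a p) 1 \<in> carrier (verma a 1)"
    "\<And>p. \<Phi> (pure_tensor (alg a) fun_ring (fun_incl a) (point_module 1) (cls a p) 1) =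
      word_act mscale (model_act a) p model_one"
    by (rule verma_iso[OF generic]) blast
  have top: "m_top a 1 = pure_tensor (alg a) fun_ring (fun_incl a) (point_module 1)
      (cls a (xgen t13 * xgen t12 * xgen t23 * xgen t12)) 1"
    by (simp add: m_top_def)
  have "verma_model a \<Phi>"
    by unfold_locales (use generic \<Phi> in \<open>simp_all only: top act_model_top\<close>)
  then show ?thesis by blast
qed

theorem lemma10:
  fixes a :: "transp \<Rightarrow> 'k::{alg_closed_field, field_char_0}"
  assumes "a \<in> parameters" and "generic a"
  shows
    "internal_direct_sum (verma a 1)
        (\<lambda>g. if g = 1 then lin_span a (verma a 1) {m_top a 1} else weight_space a (verma a 1) g)
        UNIV (N_e a) \<and>
     {H. submodule H (alg a) (verma a 1) \<and> H \<noteq> {\<zero>\<^bsub>verma a 1\<^esub>}} =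
        {lin_span a (verma a 1) {m_top a 1}} \<union>
        {alg_span a (verma a 1) {v} | v. v \<in> W_e a - {\<zero>\<^bsub>verma a 1\<^esub>}} \<union>
        {N_e a, carrier (verma a 1)} \<and>
     (\<forall>v \<in> W_e a - {\<zero>\<^bsub>verma a 1\<^esub>}.
        lin_span a (verma a 1) {m_top a 1} \<subset> alg_span a (verma a 1) {v} \<and>
        alg_span a (verma a 1) {v} \<subset> N_e a \<and>
        N_e a \<subset> carrier (verma a 1)) \<and>
     (\<forall>u \<in> W_e a - {\<zero>\<^bsub>verma a 1\<^esub>}. \<forall>v \<in> W_e a - {\<zero>\<^bsub>verma a 1\<^esub>}.
        alg_span a (verma a 1) {v} = alg_span a (verma a 1) {u} \<longleftrightarrow>
        v \<in> lin_span a (verma a 1) {u}) \<and>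
     (\<forall>v \<in> W_e a - {\<zero>\<^bsub>verma a 1\<^esub>}.
        module_isomorphic (alg a)
          (quot_module ((verma a 1)\<lparr>carrier := alg_span a (verma a 1) {v}\<rparr>)
            (lin_span a (verma a 1) {m_top a 1})) (L_mod a) \<and>
        module_isomorphic (alg a)
          (quot_module ((verma a 1)\<lparr>carrier := N_e a\<rparr>) (alg_span a (verma a 1) {v})) (L_mod a)) \<and>
     module_isomorphic (alg a) (quot_module (verma a 1) (N_e a)) k_e \<and>
     module_isomorphic (alg a)
        ((verma a 1)\<lparr>carrier := lin_span a (verma a 1) {m_top a 1}\<rparr>) k_e"
proof -
  obtain \<Phi> where "verma_model a \<Phi>" using verma_model_exists[OF assms(2)] by blast
  then interpret verma_model a \<Phi> .
  show ?thesis
    by (intro conjI ballI; (rule direct_sum submodules quotient_verma_N top_k_e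
      | rule chain coincide quotient_line_top quotient_N_line; assumption))
qed

end
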